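(* Consider a random dynamical system $S(\omega,x)=(\theta\omega,T_\omega x)$ on $\Omega\times X$ preserving $\nu=\mathbb{P}\otimes\mu_\omega$. Assume that the compact metric space $X$ has bounded local complexity, that the fiber measures $\mu_\omega$ depend in a Lipschitz way on $\omega$, that $\theta$ has stretched exponential $4$-mixing and that $S$ mixes stretched exponentially along the fibers. Assume also that $S$ is Lipschitz. Then, for $\mathbb{P}$-almost every $\omega$, for $\mu_\omega^{\otimes2}$-almost every $(x,y)$, $$\liminf_{n\to\infty}\frac{-\log m_n^{\gg}(\omega;x,y)}{\log n}\ge\frac{2}{\overline{D}_2^{\mathrm{an}}},$$ where $m_n^{\gg}(\omega;x,y)=\min\{d(T_\omega^ix,T_\omega^jy): 0\le i<n/3,\ 2n/3\le j<n\}$.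
   Context: Random dynamical system: $\Omega$ is a compact metric space with a probability measure $\mathbb{P}$, and $\theta:\Omega\to\Omega$ is invertible and preserves $\mathbb{P}$. $(X,d)$ is a metric space and, for each $\omega\in\Omega$, $T_\omega:X\to X$ is measurable, such that the skew product $S(\omega,x)=(\theta\omega,T_\omega x)$ is measurable and preserves a probability measure $\nu$ on $\Omega\times X$ whose marginal on $\Omega$ is $\mathbb{P}$. Write $T_\omega^n=T_{\theta^{n-1}\omega}\circ\dots\circ T_\omega$. The measure $\nu$ is disintegrated above $\mathbb{P}$ into probability measures $\mu_\omega$ on $X$ depending measurably on $\omega$: $\int f\,d\nu=\int(\int f(\omega,x)\,d\mu_\omega(x))\,d\mathbb{P}(\omega)$, written $\nu=\mathbb{P}\otimes\mu_\omega$; one has $(T_\omega)_*\mu_\omega=\mu_{\theta\omega}$ for $\mathbb{P}$-a.e. $\omega$. Let $\mu=\int\mu_\omega\,d\mathbb{P}(\omega)$ be the marginal of $\nu$ on $X$. $S$ Lipschitz refers to a standard product metric on $\Omega\times X$. Lipschitz norm: $\|f\|_{\mathrm{Lip}}=\|f\|_\infty+\mathrm{Lip}(f)$, where $\mathrm{Lip}(f)$ is the best Lipschitz constant of $f$. Bounded local complexity: a compact metric space $X$ has bounded local complexity if there is a constant $C_0$ such that, for every small enough $r>0$, there are $k(r)<\infty$ and points $x^{(r)}_1,\dots,x^{(r)}_{k(r)}\in X$ such that the balls $B(x^{(r)}_p,r)$, $1\le p\le k(r)$, cover $X$ and any point of $X$ belongs to at most $C_0$ of the balls $B(x^{(r)}_p,4r)$.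 Upper annealed correlation dimension: $\overline{D}_2^{\mathrm{an}}=\limsup_{r\to0}\frac{\log\int\mu(B(x,r))\,d\mu(x)}{\log r}$. The measures $\mu_\omega$ depend in a Lipschitz way on $\omega$: there is $C_1>0$ such that $|\int f\,d\mu_\omega-\int f\,d\mu_{\omega'}|\le C_1\|f\|_{\mathrm{Lip}}\,d(\omega,\omega')$ for every Lipschitz $f:X\to\mathbb{R}$ and all $\omega,\omega'\in\Omega$. Stretched exponential $4$-mixing of $\theta$: there are $c_2,C_2>0$ such that for all Lipschitz $f_1,f_2,g_1,g_2:\Omega\to\mathbb{R}$, all $n\in\mathbb{N}$ and all nonnegative integers $a\le b\le c$ with $b-a\ge n$, $$\left|\int f_1\cdot f_2\circ\theta^a\cdot g_1\circ\theta^b\cdot g_2\circ\theta^c\,d\mathbb{P}-\left(\int f_1\cdot f_2\circ\theta^a\,d\mathbb{P}\right)\left(\int g_1\cdot g_2\circ\theta^{c-b}\,d\mathbb{P}\right)\right|\le C_2e^{-n^{c_2}}\|f_1\|_{\mathrm{Lip}}\|f_2\|_{\mathrm{Lip}}\|g_1\|_{\mathrm{Lip}}\|g_2\|_{\mathrm{Lip}}.$$ $S$ mixes stretched exponentially along the fibers: there are $c_3,C_3>0$ such that for all Lipschitz $f,g:X\to\mathbb{R}$, all $n\in\mathbb{N}$ and all $\omega\in\Omega$, $$\left|\int f\cdot g\circ T_\omega^n\,d\mu_\omega-\left(\int f\,d\mu_\omega\right)\left(\int g\,d\mu_{\theta^n\omega}\right)\right|\le C_3e^{-n^{c_3}}\|f\|_{\mathrm{Lip}}\|g\|_{\mathrm{Lip}}.$$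 Conventions: $-\log0=+\infty$, $2/0=+\infty$, and the minimum of an empty set is $+\infty$ (irrelevant for large $n$). *)

theory Defs
  imports "HOL-Probability.Probability"
begin

text \<open>
  Metric spaces are rendered as types of class \<open>metric_space\<close>, with compactness of the whole
  space as an explicit hypothesis. Only the case where both the base and the fiber space are compact
  is used; there the product sigma-algebra \<open>borel \<Otimes>\<^sub>M borel\<close> is the Borel sigma-algebra of the
  product space. \<open>ball\<close> is the open ball.
\<close>

definition skew_product :: "('w \<Rightarrow> 'w) \<Rightarrow> ('w \<Rightarrow> 'x \<Rightarrow> 'x) \<Rightarrow> 'w \<times> 'x \<Rightarrow> 'w \<times> 'x" where
  "skew_product \<theta> T = (\<lambda>(\<omega>, x). (\<theta> \<omega>, T \<omega> x))"

primrec fiber_iterate :: "('w \<Rightarrow> 'w) \<Rightarrow> ('w \<Rightarrow> 'x \<Rightarrow> 'x) \<Rightarrow> nat \<Rightarrow> 'w \<Rightarrow> 'x \<Rightarrow> 'x" where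
  "fiber_iterate \<theta> T 0 \<omega> = id"
| "fiber_iterate \<theta> T (Suc n) \<omega> = T ((\<theta> ^^ n) \<omega>) \<circ> fiber_iterate \<theta> T n \<omega>"

text \<open>
  The family \<open>\<mu>\<close> is the disintegration of \<open>\<nu>\<close> above \<open>P\<close>. The equivariance of \<open>\<mu>\<close>, almost
  everywhere, is a consequence of the invariance of \<open>\<nu>\<close> and is not assumed.
\<close>

locale random_dynamical_system =
  fixes P :: "'w :: metric_space measure"
    and \<theta> :: "'w \<Rightarrow> 'w"
    and T :: "'w \<Rightarrow> 'x :: metric_space \<Rightarrow> 'x"
    and \<nu> :: "('w \<times> 'x) measure"
    and \<mu> :: "'w \<Rightarrow> 'x measure"
  assumes compact_base: "compact (UNIV :: 'w set)"
    and prob_base: "prob_space P"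
    and sets_base: "sets P = sets borel"
    and invertible_base: "bij \<theta>"
    and measurable_base: "\<theta> \<in> measurable P P"
    and invariant_base: "distr P P \<theta> = P"
    and measurable_fiber_maps: "\<And>\<omega>. T \<omega> \<in> measurable borel borel"
    and prob_total: "prob_space \<nu>"
    and sets_total: "sets \<nu> = sets (borel \<Otimes>\<^sub>M borel)"
    and measurable_skew: "skew_product \<theta> T \<in> measurable \<nu> \<nu>"
    and invariant_total: "distr \<nu> \<nu> (skew_product \<theta> T) = \<nu>"
    and marginal_base: "distr \<nu> P fst = P"
    and measurable_fiber_measures: "\<mu> \<in> measurable P (prob_algebra borel)"
    and disintegration: "\<And>f :: 'w \<times> 'x \<Rightarrow> ennreal. f \<in> borel_measurable \<nu> \<Longrightarrow>
      (\<integral>\<^sup>+ z. f z \<partial>\<nu>) = (\<integral>\<^sup>+ \<omega>. (\<integral>\<^sup>+ x. f (\<omega>, x) \<partial>\<mu> \<omega>) \<partial>P)"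

definition fiber_marginal :: "('w \<times> 'x :: metric_space) measure \<Rightarrow> 'x measure" where
  "fiber_marginal \<nu> = distr \<nu> borel snd"

definition is_lipschitz :: "('a :: metric_space \<Rightarrow> 'b :: metric_space) \<Rightarrow> bool" where
  "is_lipschitz f \<longleftrightarrow> (\<exists>C. C-lipschitz_on UNIV f)"

definition lip_const :: "('a :: metric_space \<Rightarrow> real) \<Rightarrow> real" where
  "lip_const f = Inf {C. C-lipschitz_on UNIV f}"

text \<open>
  Meaningful for bounded Lipschitz functions only; on a compact space every Lipschitz function is
  bounded.
\<close>

definition lip_norm :: "('a :: metric_space \<Rightarrow> real) \<Rightarrow> real" where
  "lip_norm f = (SUP x. \<bar>f x\<bar>) + lip_const f"

definition bounded_local_complexity :: "'a :: metric_space set \<Rightarrow> bool" where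
  "bounded_local_complexity X \<longleftrightarrow>
    (\<exists>C\<^sub>0 :: nat. \<forall>\<^sub>F r in at_right (0 :: real). \<exists>(k :: nat) (c :: nat \<Rightarrow> 'a).
      c ` {1..k} \<subseteq> X \<and>
      X \<subseteq> (\<Union>p\<in>{1..k}. ball (c p) r) \<and>
      (\<forall>x\<in>X. card {p \<in> {1..k}. x \<in> ball (c p) (4 * r)} \<le> C\<^sub>0))"

text \<open>
  The integral lies in \<open>{0<..1}\<close> for a Borel probability measure on a separable metric space, so that
  the real logarithm is not evaluated at \<open>0\<close>.
\<close>

definition upper_correlation_dimension :: "'x :: metric_space measure \<Rightarrow> ereal" where
  "upper_correlation_dimension m =
    Limsup (at_right 0) (\<lambda>r. ereal (ln (\<integral>x. measure m (ball x r) \<partial>m) / ln r))"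

definition lipschitz_dependence :: "('w :: metric_space \<Rightarrow> 'x :: metric_space measure) \<Rightarrow> bool" where
  "lipschitz_dependence \<mu> \<longleftrightarrow>
    (\<exists>C\<^sub>1 > 0. \<forall>f :: 'x \<Rightarrow> real. is_lipschitz f \<longrightarrow>
      (\<forall>\<omega> \<omega>'. \<bar>(\<integral>x. f x \<partial>\<mu> \<omega>) - (\<integral>x. f x \<partial>\<mu> \<omega>')\<bar> \<le> C\<^sub>1 * lip_norm f * dist \<omega> \<omega>'))"

definition stretched_exponential_4_mixing ::
    "'w :: metric_space measure \<Rightarrow> ('w \<Rightarrow> 'w) \<Rightarrow> bool" where
  "stretched_exponential_4_mixing P \<theta> \<longleftrightarrow>
    (\<exists>c\<^sub>2 > 0. \<exists>C\<^sub>2 > 0. \<forall>(f\<^sub>1 :: 'w \<Rightarrow> real) (f\<^sub>2 :: 'w \<Rightarrow> real) (g\<^sub>1 :: 'w \<Rightarrow> real) (g\<^sub>2 :: 'w \<Rightarrow> real).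
      is_lipschitz f\<^sub>1 \<longrightarrow> is_lipschitz f\<^sub>2 \<longrightarrow> is_lipschitz g\<^sub>1 \<longrightarrow> is_lipschitz g\<^sub>2 \<longrightarrow>
      (\<forall>(n :: nat) (a :: nat) (b :: nat) (c :: nat). a \<le> b \<longrightarrow> b \<le> c \<longrightarrow> n \<le> b - a \<longrightarrow>
        \<bar>(\<integral>\<omega>. f\<^sub>1 \<omega> * f\<^sub>2 ((\<theta> ^^ a) \<omega>) * g\<^sub>1 ((\<theta> ^^ b) \<omega>) * g\<^sub>2 ((\<theta> ^^ c) \<omega>) \<partial>P)
          - (\<integral>\<omega>. f\<^sub>1 \<omega> * f\<^sub>2 ((\<theta> ^^ a) \<omega>) \<partial>P) * (\<integral>\<omega>. g\<^sub>1 \<omega> * g\<^sub>2 ((\<theta> ^^ (c - b)) \<omega>) \<partial>P)\<bar>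
        \<le> C\<^sub>2 * exp (- (real n powr c\<^sub>2)) * lip_norm f\<^sub>1 * lip_norm f\<^sub>2 * lip_norm g\<^sub>1 * lip_norm g\<^sub>2))"

definition stretched_exponential_fiber_mixing ::
    "('w \<Rightarrow> 'w) \<Rightarrow> ('w \<Rightarrow> 'x :: metric_space \<Rightarrow> 'x) \<Rightarrow> ('w \<Rightarrow> 'x measure) \<Rightarrow> bool" where
  "stretched_exponential_fiber_mixing \<theta> T \<mu> \<longleftrightarrow>
    (\<exists>c\<^sub>3 > 0. \<exists>C\<^sub>3 > 0. \<forall>(f :: 'x \<Rightarrow> real) (g :: 'x \<Rightarrow> real).
      is_lipschitz f \<longrightarrow> is_lipschitz g \<longrightarrow>
      (\<forall>(n :: nat) \<omega>.
        \<bar>(\<integral>x. f x * g (fiber_iterate \<theta> T n \<omega> x) \<partial>\<mu> \<omega>)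
          - (\<integral>x. f x \<partial>\<mu> \<omega>) * (\<integral>x. g x \<partial>\<mu> ((\<theta> ^^ n) \<omega>))\<bar>
        \<le> C\<^sub>3 * exp (- (real n powr c\<^sub>3)) * lip_norm f * lip_norm g))"

text \<open>Extended-real valued, so that the minimum of the empty set is \<open>\<infinity>\<close>.\<close>

definition min_dist_separated ::
    "('w \<Rightarrow> 'w) \<Rightarrow> ('w \<Rightarrow> 'x :: metric_space \<Rightarrow> 'x) \<Rightarrow> nat \<Rightarrow> 'w \<Rightarrow> 'x \<Rightarrow> 'x \<Rightarrow> ereal" where
  "min_dist_separated \<theta> T n \<omega> x y =
    Inf {ereal (dist (fiber_iterate \<theta> T i \<omega> x) (fiber_iterate \<theta> T j \<omega> y)) | i j.
      real i < real n / 3 \<and> 2 * real n / 3 \<le> real j \<and> j < n}"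

definition neg_log :: "ereal \<Rightarrow> ereal" where
  "neg_log t = (if t = 0 then \<infinity> else if t = \<infinity> then -\<infinity> else ereal (- ln (real_of_ereal t)))"

end

theory Submission
  imports Defs "HOL-Real_Asymp.Real_Asymp"
begin

text \<open>
  Close encounters come from a count. Let \<open>D\<close> be slightly larger than the upper correlation
  dimension and \<open>\<beta>\<close> slightly smaller than \<open>2 / D\<close>, and put \<open>r = u powr - \<beta>\<close>. For two blocks
  of \<open>u\<close> times, \<open>{0..<u}\<close> and \<open>{v..<v + u}\<close>, the mean number of pairs \<open>(i, j)\<close> for which
  \<open>T\<^sup>i x\<close> and \<open>T\<^sup>j y\<close> are at distance of order \<open>r\<close> is about \<open>u\<^sup>2 \<integral> \<mu>(B(x, r)) d\<mu>(x)\<close>, at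
  least \<open>u powr (2 - \<beta> * D)\<close>, which is a positive power of \<open>u\<close>. If the count has small variance,
  Chebyshev's inequality bounds the probability of having no encounter by a negative power of
  \<open>u\<close>. This is summable over \<open>u = 2\<^sup>k\<close>, and finitely many block pairs for each \<open>k\<close> serve all
  large \<open>n\<close> (\<open>dyadic_block\<close>), so the Borel-Cantelli lemma gives the theorem.

  To make the count a sum of products, cover \<open>X\<close> by balls of radius \<open>r\<close> with centres \<open>c p\<close> and
  bounded multiplicity, let \<open>\<rho> p\<close> be a Lipschitz bump around \<open>c p\<close>, and count
  \<open>Z = \<Sum>p. N p x * N' p y\<close>, where \<open>N p x\<close> adds up \<open>\<rho> p (T\<^sup>i x)\<close> over the first block and
  \<open>N' p y\<close> adds up \<open>\<rho> p (T\<^sup>j y)\<close> over the second. Given \<open>\<omega>\<close> the points \<open>x\<close> and \<open>y\<close> are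
  independent, so the second moment of \<open>Z\<close> is the sum over \<open>p, q\<close> of
  \<open>(\<integral> N p * N q d\<mu> \<omega>) * (\<integral> N' p * N' q d\<mu> \<omega>)\<close>, a product of two functions of \<open>\<omega>\<close> that
  concern two blocks separated by a gap of length at least \<open>u\<close>.

  The main point is that the \<open>\<omega>\<close>-integral of such a product factorises (\<open>decoupling\<close>). A
  correlation \<open>\<integral> \<rho> p (T\<^sup>i x) * \<rho> q (T\<^sup>j x) d\<mu> \<omega>\<close> is nearly a product of Lipschitz functions of
  \<open>\<theta>\<^sup>i \<omega>\<close> and \<open>\<theta>\<^sup>j \<omega>\<close>: if \<open>\<bar>i - j\<bar> \<ge> L\<close> by mixing along the fibers, since fiber means are
  Lipschitz in \<open>\<omega>\<close>; and if \<open>\<bar>i - j\<bar> < L\<close> because the correlation itself is a Lipschitz function of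
  the earlier base point, with a constant of order \<open>K\<^sup>L\<close>, where \<open>K\<close> is the Lipschitz constant of
  \<open>S\<close>. For \<open>L\<close> a small power of \<open>u\<close>, the loss \<open>K\<^sup>L\<close> is negligible against the gain
  \<open>exp (- (u powr c\<^sub>2))\<close> of the 4-mixing over the gap.

  By invariance of \<open>\<nu>\<close> the two factors have the same mean \<open>Q p q\<close>, so the second moment of \<open>Z\<close>
  is nearly the square of the \<open>\<ell>\<^sup>2\<close> norm of \<open>Q\<close>. Now \<open>Q p q\<close> is \<open>u\<^sup>2 * m p * m q\<close>, with
  \<open>m p = \<integral> \<rho> p d\<mu>\<close>, up to a tiny error and up to the contribution of \<open>\<bar>i - j\<bar> < L\<close>. The first
  part has norm \<open>u\<^sup>2 * E\<close> with \<open>E = \<Sum>p. (m p)\<^sup>2\<close>, which is nearly the mean of \<open>Z\<close>; the second has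
  norm at most \<open>2 * L * u * sqrt (C * E)\<close> because \<open>(\<Sum>q. \<rho> q) \<le> C\<close>. As \<open>u\<^sup>2 * E\<close> is a positive
  power of \<open>u\<close> and \<open>L\<close> an arbitrarily small one, the variance is small compared to the squared
  mean (\<open>integral_miss_bound_le\<close>, \<open>moment_bound_asymptotics\<close>).
\<close>

section \<open>Lipschitz functions\<close>

lemma lip_norm_bounds:
  fixes f :: "'a :: metric_space \<Rightarrow> real"
  assumes "C-lipschitz_on UNIV f" and "\<And>x. \<bar>f x\<bar> \<le> M"
  shows "0 \<le> lip_norm f" and "lip_norm f \<le> M + C"
proof -
  have bdd: "bdd_above (range (\<lambda>x. \<bar>f x\<bar>))"
    using assms(2) by (auto intro!: bdd_aboveI[of _ M])
  have "0 \<le> \<bar>f undefined\<bar>" by simp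
  also have "\<dots> \<le> (SUP x. \<bar>f x\<bar>)" using bdd by (rule cSUP_upper2) auto
  finally have sup_nonneg: "0 \<le> (SUP x. \<bar>f x\<bar>)" .
  have sup_le: "(SUP x. \<bar>f x\<bar>) \<le> M" using assms(2) by (intro cSUP_least) auto
  have "0 \<le> lip_const f"
    unfolding lip_const_def using assms(1) by (intro cInf_greatest) (auto dest: lipschitz_on_nonneg)
  moreover have "lip_const f \<le> C"
    unfolding lip_const_def using assms(1)
    by (intro cInf_lower) (auto intro!: bdd_belowI[of _ 0] dest: lipschitz_on_nonneg)
  ultimately show "0 \<le> lip_norm f" "lip_norm f \<le> M + C"
    using sup_nonneg sup_le by (auto simp: lip_norm_def)
qed

lemma lipschitz_borel_measurable:
  fixes f :: "'a :: metric_space \<Rightarrow> 'b :: metric_space"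
  shows "C-lipschitz_on UNIV f \<Longrightarrow> f \<in> borel_measurable borel"
  by (intro borel_measurable_continuous_onI lipschitz_on_continuous_on)

lemma lipschitz_on_mult_unit:
  fixes f g :: "'a :: metric_space \<Rightarrow> real"
  assumes "C-lipschitz_on UNIV f" "D-lipschitz_on UNIV g"
    and "\<And>x. \<bar>f x\<bar> \<le> 1" "\<And>x. \<bar>g x\<bar> \<le> 1"
  shows "(C + D)-lipschitz_on UNIV (\<lambda>x. f x * g x)"
proof (rule lipschitz_onI)
  fix x y :: 'a
  have "\<bar>f x * g x - f y * g y\<bar> = \<bar>f x * (g x - g y) + (f x - f y) * g y\<bar>"
    by (simp add: algebra_simps)
  also have "\<dots> \<le> \<bar>f x\<bar> * \<bar>g x - g y\<bar> + \<bar>f x - f y\<bar> * \<bar>g y\<bar>"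
    by (metis abs_mult abs_triangle_ineq)
  also have "\<dots> \<le> 1 * (D * dist x y) + (C * dist x y) * 1"
    using lipschitz_onD[OF assms(1), of x y] lipschitz_onD[OF assms(2), of x y] assms(3)[of x] assms(4)[of y]
      lipschitz_on_nonneg[OF assms(1)] lipschitz_on_nonneg[OF assms(2)]
    by (intro add_mono mult_mono) (auto simp: dist_real_def)
  finally show "dist (f x * g x) (f y * g y) \<le> (C + D) * dist x y"
    by (simp add: dist_real_def algebra_simps)
qed (use lipschitz_on_nonneg[OF assms(1)] lipschitz_on_nonneg[OF assms(2)] in simp)

definition bump :: "'a :: metric_space \<Rightarrow> real \<Rightarrow> 'a \<Rightarrow> real" where
  "bump c r x = max 0 (min 1 (2 - dist x c / (2 * r)))"

lemma bump_unit: "0 \<le> bump c r x" "bump c r x \<le> 1"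
  by (auto simp: bump_def)

lemma bump_eq_1: "0 < r \<Longrightarrow> dist x c < 2 * r \<Longrightarrow> bump c r x = 1"
  by (auto simp: bump_def field_simps)

lemma bump_pos_imp_dist: "0 < r \<Longrightarrow> bump c r x \<noteq> 0 \<Longrightarrow> dist x c < 4 * r"
  by (auto simp: bump_def field_simps max_def min_def split: if_splits)

lemma lipschitz_bump:
  assumes "0 < r"
  shows "(1 / (2 * r))-lipschitz_on UNIV (bump c r)"
proof (rule lipschitz_onI)
  fix x y :: 'a
  have "\<bar>bump c r x - bump c r y\<bar> \<le> \<bar>dist x c / (2 * r) - dist y c / (2 * r)\<bar>"
    by (auto simp: bump_def)
  also have "\<dots> = \<bar>dist x c - dist y c\<bar> / (2 * r)"
    using assms by (simp add: diff_divide_distrib[symmetric])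
  also have "\<dots> \<le> dist x y / (2 * r)"
    using assms abs_dist_diff_le[of x c y] by (intro divide_right_mono) (auto simp: dist_commute)
  finally show "dist (bump c r x) (bump c r y) \<le> 1 / (2 * r) * dist x y"
    by (simp add: dist_real_def)
qed (use assms in simp)

section \<open>Covers of bounded multiplicity\<close>

text \<open>
  The multiplicity is counted at radius \<open>4 * r\<close>, which is the radius of the supports of the functions
  \<open>bump (c p) r\<close>.
\<close>

definition good_cover :: "nat \<Rightarrow> real \<Rightarrow> nat \<Rightarrow> (nat \<Rightarrow> 'a :: metric_space) \<Rightarrow> bool" where
  "good_cover C r k c \<longleftrightarrow>
    (\<Union>p\<in>{1..k}. ball (c p) r) = UNIV \<and> (\<forall>x. card {p \<in> {1..k}. x \<in> ball (c p) (4 * r)} \<le> C)"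

text \<open>
  Each centre lies within \<open>4 * r\<close> of some point of \<open>Z\<close>, and a point of \<open>Z\<close> can serve at most \<open>C\<close>
  centres.
\<close>

lemma good_cover_card_le:
  fixes c :: "nat \<Rightarrow> 'a :: metric_space"
  assumes gc: "good_cover C r k c" and "finite Z" and "\<And>x :: 'a. \<exists>z\<in>Z. dist z x < 4 * r"
  shows "k \<le> C * card Z"
proof -
  have "{1..k} \<subseteq> (\<Union>z\<in>Z. {p \<in> {1..k}. z \<in> ball (c p) (4 * r)})"
    using assms(3) by (fastforce simp: dist_commute)
  then have "card {1..k} \<le> card (\<Union>z\<in>Z. {p \<in> {1..k}. z \<in> ball (c p) (4 * r)})"
    using \<open>finite Z\<close> by (intro card_mono) auto
  also have "\<dots> \<le> (\<Sum>z\<in>Z. card {p \<in> {1..k}. z \<in> ball (c p) (4 * r)})"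
    using \<open>finite Z\<close> by (rule card_UN_le)
  also have "\<dots> \<le> (\<Sum>z\<in>Z. C)"
    using gc by (intro sum_mono) (auto simp: good_cover_def)
  finally show ?thesis by (simp add: mult.commute)
qed

text \<open>
  The centres of a cover at scale \<open>4 * r\<close> form a set \<open>Z\<close> as in \<open>good_cover_card_le\<close>, so the number
  of balls grows by a factor of at most \<open>C\<close> when the scale is divided by 4. Iterating down from a fixed
  scale gives about \<open>C powr (log 4 (1 / r))\<close> balls. The exponent \<open>C\<close> in the conclusion is crude: it comes
  from \<open>C \<le> 2 ^ C \<le> 4 ^ C\<close>.
\<close>

lemma good_covers_polynomial:
  assumes "compact (UNIV :: 'a :: metric_space set)"
    and "bounded_local_complexity (UNIV :: 'a set)"
  obtains C :: nat and A r0 :: real where "0 < r0" "0 \<le> A"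
    "\<And>r. 0 < r \<Longrightarrow> r < r0 \<Longrightarrow>
      \<exists>k (c :: nat \<Rightarrow> 'a). good_cover C r k c \<and> real k \<le> A * (1 / r) ^ C"
proof -
  obtain C where "\<forall>\<^sub>F r in at_right (0 :: real). \<exists>k (c :: nat \<Rightarrow> 'a). good_cover C r k c"
    using assms(2) by (auto simp: bounded_local_complexity_def good_cover_def top.extremum_unique)
  then obtain r0 where r0: "0 < r0"
    and ex: "\<And>r. 0 < r \<Longrightarrow> r < r0 \<Longrightarrow> \<exists>k (c :: nat \<Rightarrow> 'a). good_cover C r k c"
    by (auto simp: eventually_at_right_field)
  obtain Z :: "'a set" where Z: "finite Z" "UNIV \<subseteq> (\<Union>z\<in>Z. ball z r0)"
  proof (rule compactE_image[OF assms(1), of UNIV "\<lambda>z. ball z r0"])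
    show "UNIV \<subseteq> (\<Union>z. ball z r0)" using r0 by (auto intro: centre_in_ball[THEN iffD2])
  qed auto
  have near: "\<exists>z\<in>Z. dist z x < r0" for x
  proof -
    have "x \<in> (\<Union>z\<in>Z. ball z r0)" using Z(2) by blast
    then show ?thesis by auto
  qed
  have bound: "k \<le> card Z * C ^ Suc s"
    if "good_cover C r k c" "r < r0" "r0 \<le> 4 ^ Suc s * r" "0 < r" for r k s and c :: "nat \<Rightarrow> 'a"
    using that
  proof (induction s arbitrary: r k c)
    case 0
    have "\<exists>z\<in>Z. dist z x < 4 * r" for x using near[of x] 0(3) by (auto elim!: rev_bexI)
    from good_cover_card_le[OF 0(1) Z(1) this] show ?case by (simp add: mult.commute)
  next
    case (Suc s)
    show ?case
    proof (cases "4 * r < r0")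
      case True
      then obtain k' and c' :: "nat \<Rightarrow> 'a" where kc: "good_cover C (4 * r) k' c'"
        using ex[of "4 * r"] Suc.prems by auto
      have "k' \<le> card Z * C ^ Suc s"
        using Suc.IH[OF kc] True Suc.prems by simp
      moreover have "\<exists>z\<in>c' ` {1..k'}. dist z x < 4 * r" for x
      proof -
        have "x \<in> (\<Union>p\<in>{1..k'}. ball (c' p) (4 * r))" using kc by (simp add: good_cover_def)
        then show ?thesis by auto
      qed
      then have "k \<le> C * card (c' ` {1..k'})"
        using good_cover_card_le[OF Suc.prems(1)] by blast
      moreover have "card (c' ` {1..k'}) \<le> k'" using card_image_le[of "{1..k'}" c'] by simp
      ultimately have "k \<le> C * (card Z * C ^ Suc s)"
        by (meson le_trans mult_le_mono2)
      then show ?thesis by (simp add: ac_simps)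
    next
      case False
      have "\<exists>z\<in>Z. dist z x < 4 * r" for x using near[of x] False by (auto elim!: rev_bexI)
      from good_cover_card_le[OF Suc.prems(1) Z(1) this] have "k \<le> C * card Z" .
      also have "\<dots> \<le> card Z * C ^ Suc (Suc s)" by (cases "C = 0") (simp_all add: Suc_leI)
      finally show ?thesis .
    qed
  qed
  have "\<exists>k (c :: nat \<Rightarrow> 'a). good_cover C r k c \<and> real k \<le> real (card Z) * C * r0 ^ C * (1 / r) ^ C"
    if r: "0 < r" "r < r0" for r
  proof -
    obtain k and c :: "nat \<Rightarrow> 'a" where kc: "good_cover C r k c" using ex[OF r] by blast
    have "\<exists>s. r0 \<le> 4 ^ Suc s * r"
    proof -
      obtain n where "r0 / r < 4 ^ n" using real_arch_pow[of 4 "r0 / r"] by auto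
      then have "r0 < 4 ^ n * r" using r by (simp add: field_simps)
      also have "\<dots> \<le> 4 ^ Suc n * r" using r by simp
      finally have "r0 \<le> 4 ^ Suc n * r" by simp
      then show ?thesis ..
    qed
    define s where "s = (LEAST s. r0 \<le> 4 ^ Suc s * r)"
    have s: "r0 \<le> 4 ^ Suc s * r"
      unfolding s_def using \<open>\<exists>s. r0 \<le> 4 ^ Suc s * r\<close> by (rule LeastI_ex)
    have s': "4 ^ s * r \<le> r0"
    proof (cases s)
      case (Suc t)
      then have "\<not> r0 \<le> 4 ^ Suc t * r" using not_less_Least[of t "\<lambda>s. r0 \<le> 4 ^ Suc s * r"] by (simp add: s_def)
      then show ?thesis using Suc by simp
    qed (use r in simp)
    have "real k \<le> real (card Z * C ^ Suc s)"
      using bound[OF kc r(2) s r(1)] of_nat_le_iff by blast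
    also have "\<dots> = real (card Z) * C * real (C ^ s)" by simp
    also have "real (C ^ s) \<le> real ((2 ^ C) ^ s)"
      by (intro of_nat_mono power_mono less_imp_le[OF less_exp] le0)
    also have "real ((2 ^ C) ^ s) = (2 ^ s) ^ C" by (simp add: power_mult[symmetric] mult.commute)
    also have "\<dots> \<le> (4 ^ s) ^ C" by (intro power_mono) simp_all
    also have "\<dots> \<le> (r0 / r) ^ C" using s' r by (intro power_mono) (auto simp: field_simps)
    also have "real (card Z) * C * (r0 / r) ^ C = real (card Z) * C * r0 ^ C * (1 / r) ^ C"
      by (simp add: power_divide)
    finally have "real k \<le> real (card Z) * C * r0 ^ C * (1 / r) ^ C" by (simp add: mult_left_mono)
    then show ?thesis using kc by blast
  qed
  then show thesis using r0 by (intro that[of r0 "real (card Z) * C * r0 ^ C" C]) auto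
qed

lemma sum_bump_le:
  assumes "good_cover C r k c" "0 < r"
  shows "(\<Sum>p\<in>{1..k}. bump (c p) r x) \<le> C"
proof -
  have "(\<Sum>p\<in>{1..k}. bump (c p) r x) = (\<Sum>p\<in>{p\<in>{1..k}. x \<in> ball (c p) (4 * r)}. bump (c p) r x)"
  proof (rule sum.mono_neutral_right)
    show "\<forall>p\<in>{1..k} - {p \<in> {1..k}. x \<in> ball (c p) (4 * r)}. bump (c p) r x = 0"
      using bump_pos_imp_dist[OF assms(2)] by (metis DiffE dist_commute mem_Collect_eq mem_ball)
  qed auto
  also have "\<dots> \<le> (\<Sum>p\<in>{p\<in>{1..k}. x \<in> ball (c p) (4 * r)}. 1)"
    by (intro sum_mono bump_unit)
  also have "\<dots> \<le> C" using assms(1) by (simp add: good_cover_def)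
  finally show ?thesis .
qed

section \<open>The correlation integral\<close>

text \<open>
  The space is not assumed to be second countable, so measurability cannot be read off from a product
  sigma-algebra. Instead the measure of a ball is the limit of the Lipschitz functions of the centre obtained
  by replacing the indicator of the ball by a continuous function of the distance.
\<close>

lemma measurable_measure_ball:
  fixes M :: "'a :: metric_space measure"
  assumes "finite_measure M" "sets M = sets borel"
  shows "(\<lambda>x. measure M (ball x r)) \<in> borel_measurable borel"
proof -
  interpret finite_measure M by fact
  define h where "h n t = max 0 (min 1 (real n * (r - t)))" for n and t :: real
  have h_unit: "0 \<le> h n t" "h n t \<le> 1" for n t by (auto simp: h_def)
  have h_lip: "\<bar>h n s - h n t\<bar> \<le> real n * \<bar>s - t\<bar>" for n s t
  proof -
    have "\<bar>h n s - h n t\<bar> \<le> \<bar>real n * (r - s) - real n * (r - t)\<bar>" by (auto simp: h_def)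
    also have "\<dots> = real n * \<bar>s - t\<bar>"
      by (metis abs_minus_commute abs_mult abs_of_nat diff_diff_eq2 diff_add_cancel add_diff_cancel_left' right_diff_distrib')
    finally show ?thesis .
  qed
  have h_meas[measurable]: "(\<lambda>y. h n (dist x y)) \<in> borel_measurable M" for n x
  proof -
    have "(\<lambda>y. h n (dist x y)) \<in> borel_measurable borel"
      unfolding h_def by (intro borel_measurable_continuous_onI continuous_intros)
    then show ?thesis using assms(2) by (simp cong: measurable_cong_sets)
  qed
  have h_int: "integrable M (\<lambda>y. h n (dist x y))" for n x
    by (rule integrable_const_bound[where B = 1]) (use h_unit in auto)
  have h_lim: "(\<lambda>n. h n t) \<longlonglongrightarrow> (if t < r then 1 else 0)" for t
  proof (cases "t < r")
    case True
    obtain N where N: "1 / (r - t) < real N" using reals_Archimedean2 by blast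
    have "h n t = 1" if "n \<ge> N" for n
    proof -
      have "1 < real N * (r - t)" using N True by (simp add: field_simps)
      also have "\<dots> \<le> real n * (r - t)" using that True by (intro mult_right_mono) auto
      finally show ?thesis by (simp add: h_def)
    qed
    then have "\<forall>\<^sub>F n in sequentially. h n t = 1" by (auto simp: eventually_sequentially)
    then show ?thesis using True by (simp add: tendsto_eventually)
  next
    case False
    then have "real n * (r - t) \<le> 0" for n by (intro mult_nonneg_nonpos) auto
    then have "h n t = 0" for n by (metis h_def max.absorb1 min.coboundedI2)
    then show ?thesis using False by simp
  qed
  have lim: "(\<lambda>n. \<integral>y. h n (dist x y) \<partial>M) \<longlonglongrightarrow> (\<integral>y. indicator (ball x r) y \<partial>M)" for x
  proof (rule integral_dominated_convergence[where w = "\<lambda>_. 1"])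
    show "AE y in M. (\<lambda>n. h n (dist x y)) \<longlonglongrightarrow> indicator (ball x r) y"
    proof (rule AE_I2)
      fix y
      show "(\<lambda>n. h n (dist x y)) \<longlonglongrightarrow> indicator (ball x r) y"
        using h_lim[of "dist x y"] by (cases "dist x y < r") simp_all
    qed
  qed (use h_unit assms(2) in \<open>auto intro!: borel_measurable_indicator\<close>)
  have eq: "(\<integral>y. indicator (ball x r) y \<partial>M) = measure M (ball x r)" for x
    using assms(2) by (simp add: sets_eq_imp_space_eq)
  have meas: "(\<lambda>x. \<integral>y. h n (dist x y) \<partial>M) \<in> borel_measurable borel" for n
  proof (rule lipschitz_borel_measurable[of "real n * measure M (space M)"], rule lipschitz_onI)
    fix x x'
    have "dist (\<integral>y. h n (dist x y) \<partial>M) (\<integral>y. h n (dist x' y) \<partial>M)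
        = \<bar>\<integral>y. h n (dist x y) - h n (dist x' y) \<partial>M\<bar>"
      using h_int by (simp add: dist_real_def)
    also have "\<dots> \<le> (\<integral>y. \<bar>h n (dist x y) - h n (dist x' y)\<bar> \<partial>M)"
      by (rule integral_abs_bound)
    also have "\<dots> \<le> (\<integral>y. real n * dist x x' \<partial>M)"
    proof (intro integral_mono)
      fix y
      have "\<bar>h n (dist x y) - h n (dist x' y)\<bar> \<le> real n * \<bar>dist x y - dist x' y\<bar>" by (rule h_lip)
      also have "\<dots> \<le> real n * dist x x'"
        using abs_dist_diff_le[of x y x'] by (intro mult_left_mono) (auto simp: dist_commute)
      finally show "\<bar>h n (dist x y) - h n (dist x' y)\<bar> \<le> real n * dist x x'" .
    qed (use h_int in auto)
    finally show "dist (\<integral>y. h n (dist x y) \<partial>M) (\<integral>y. h n (dist x' y) \<partial>M)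
        \<le> real n * measure M (space M) * dist x x'" by (simp add: ac_simps)
  qed simp
  show ?thesis
    by (rule borel_measurable_LIMSEQ_real[OF lim[unfolded eq] meas])
qed

text \<open>
  Positivity matters because \<open>ln 0 = 0\<close>: at a scale where the integral vanished, the quotient in the
  definition of the correlation dimension would carry no information.
\<close>

lemma correlation_integral_pos:
  fixes M :: "'a :: metric_space measure"
  assumes "prob_space M" "sets M = sets borel" "compact (UNIV :: 'a set)" "0 < r"
  shows "0 < (\<integral>x. measure M (ball x r) \<partial>M)"
proof -
  interpret prob_space M by fact
  have [measurable]: "ball x s \<in> sets M" for x s using assms(2) by simp
  have [measurable]: "(\<lambda>x. measure M (ball x r)) \<in> borel_measurable M"
    using measurable_measure_ball[OF finite_measure_axioms assms(2)] assms(2)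
    by (simp cong: measurable_cong_sets)
  obtain Z :: "'a set" where Z: "finite Z" "UNIV \<subseteq> (\<Union>z\<in>Z. ball z (r / 2))"
  proof (rule compactE_image[OF assms(3), of UNIV "\<lambda>z. ball z (r / 2)"])
    show "UNIV \<subseteq> (\<Union>z. ball z (r / 2))" using \<open>0 < r\<close> by (auto intro: centre_in_ball[THEN iffD2])
  qed auto
  have "\<exists>z\<in>Z. 0 < prob (ball z (r / 2))"
  proof (rule ccontr)
    assume "\<not> ?thesis"
    then have "prob (ball z (r / 2)) = 0" if "z \<in> Z" for z
      using that by (auto simp: not_less measure_le_0_iff)
    moreover have "prob (\<Union>z\<in>Z. ball z (r / 2)) \<le> (\<Sum>z\<in>Z. prob (ball z (r / 2)))"
      using Z(1) by (intro finite_measure_subadditive_finite) auto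
    moreover have "(\<Union>z\<in>Z. ball z (r / 2)) = space M"
      using Z(2) assms(2) by (simp add: sets_eq_imp_space_eq top.extremum_unique)
    ultimately show False using prob_space by simp
  qed
  then obtain z where z: "0 < prob (ball z (r / 2))" by blast
  have "0 < prob (ball z (r / 2)) * prob (ball z (r / 2))" using z by simp
  also have "\<dots> = (\<integral>x. prob (ball z (r / 2)) * indicator (ball z (r / 2)) x \<partial>M)"
    by simp
  also have "\<dots> \<le> (\<integral>x. prob (ball x r) \<partial>M)"
  proof (rule integral_mono)
    fix x
    show "prob (ball z (r / 2)) * indicator (ball z (r / 2)) x \<le> prob (ball x r)"
    proof (cases "x \<in> ball z (r / 2)")
      case True
      have "ball z (r / 2) \<subseteq> ball x r"
      proof
        fix y assume "y \<in> ball z (r / 2)"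
        then show "y \<in> ball x r"
          using True dist_triangle[of x y z] by (simp add: dist_commute)
      qed
      then show ?thesis using True by (simp add: finite_measure_mono)
    qed simp
  qed (auto intro!: integrable_const_bound[where B = 1])
  finally show ?thesis .
qed

text \<open>
  If \<open>x\<close> lies in the ball of radius \<open>r\<close> around \<open>c p\<close>, then the ball of radius \<open>r\<close> around \<open>x\<close> lies in
  the plateau of \<open>bump (c p) r\<close>, of radius \<open>2 * r\<close>.
\<close>

lemma correlation_integral_le_sum_bump:
  fixes M :: "'a :: metric_space measure"
  assumes "prob_space M" "sets M = sets borel" "good_cover C r k c" "0 < r"
  shows "(\<integral>x. measure M (ball x r) \<partial>M) \<le> (\<Sum>p\<in>{1..k}. (\<integral>x. bump (c p) r x \<partial>M)\<^sup>2)"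
proof -
  interpret prob_space M by fact
  have [measurable]: "ball x s \<in> sets M" for x s using assms(2) by simp
  have [measurable]: "(\<lambda>x. measure M (ball x r)) \<in> borel_measurable M"
    using measurable_measure_ball[OF finite_measure_axioms assms(2)] assms(2)
    by (simp cong: measurable_cong_sets)
  have [measurable]: "bump z r \<in> borel_measurable M" for z
    using lipschitz_borel_measurable[OF lipschitz_bump[OF \<open>0 < r\<close>], of z] assms(2)
    by (simp cong: measurable_cong_sets)
  have le_bump: "prob (ball z (2 * r)) \<le> (\<integral>x. bump z r x \<partial>M)" for z
  proof -
    have "prob (ball z (2 * r)) = (\<integral>x. indicator (ball z (2 * r)) x \<partial>M)"
      by simp
    also have "\<dots> \<le> (\<integral>x. bump z r x \<partial>M)"
    proof (rule integral_mono)
      fix x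
      show "indicator (ball z (2 * r)) x \<le> bump z r x"
        using bump_eq_1[OF \<open>0 < r\<close>, of x z] bump_unit[of z r x]
        by (simp add: indicator_def dist_commute)
    qed (auto intro!: integrable_const_bound[where B = 1] simp: bump_unit)
    finally show ?thesis .
  qed
  have int_ball: "integrable M (\<lambda>x. prob (ball (c p) (2 * r)) * indicator (ball (c p) r) x)" for p
    by (intro integrable_mult_right integrable_real_indicator) (simp_all add: less_top[symmetric])
  have "(\<integral>x. prob (ball x r) \<partial>M)
      \<le> (\<integral>x. (\<Sum>p\<in>{1..k}. prob (ball (c p) (2 * r)) * indicator (ball (c p) r) x) \<partial>M)"
  proof (rule integral_mono)
    fix x
    obtain p where p: "p \<in> {1..k}" "x \<in> ball (c p) r"
      using assms(3) unfolding good_cover_def by blast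
    have "ball x r \<subseteq> ball (c p) (2 * r)"
    proof
      fix y assume "y \<in> ball x r"
      then show "y \<in> ball (c p) (2 * r)" using p(2) dist_triangle[of "c p" y x] by simp
    qed
    then have "prob (ball x r) \<le> prob (ball (c p) (2 * r)) * indicator (ball (c p) r) x"
      using p(2) by (simp add: finite_measure_mono)
    also have "\<dots> \<le> (\<Sum>p\<in>{1..k}. prob (ball (c p) (2 * r)) * indicator (ball (c p) r) x)"
      using p(1) by (intro member_le_sum) auto
    finally show "prob (ball x r) \<le> \<dots>" .
  qed (intro Bochner_Integration.integrable_sum int_ball integrable_const_bound[where B = 1]; simp)+
  also have "\<dots> = (\<Sum>p\<in>{1..k}. prob (ball (c p) (2 * r)) * prob (ball (c p) r))"
    by (subst Bochner_Integration.integral_sum, rule int_ball) simp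
  also have "\<dots> \<le> (\<Sum>p\<in>{1..k}. (\<integral>x. bump (c p) r x \<partial>M)\<^sup>2)"
  proof (rule sum_mono)
    fix p
    have "prob (ball (c p) r) \<le> prob (ball (c p) (2 * r))"
      using \<open>0 < r\<close> by (intro finite_measure_mono) auto
    then show "prob (ball (c p) (2 * r)) * prob (ball (c p) r) \<le> (\<integral>x. bump (c p) r x \<partial>M)\<^sup>2"
      unfolding power2_eq_square using le_bump[of "c p"] 
      by (intro mult_mono) (auto intro: order_trans[OF measure_nonneg])
  qed
  finally show ?thesis .
qed

section \<open>A second moment inequality on a product\<close>

text \<open>
  Chebyshev's inequality for \<open>Z = \<Sum>p. f p x * g p y\<close> with independent \<open>x\<close> and \<open>y\<close>, about an arbitrary
  centre \<open>c\<close> instead of the mean. One centre can then serve all the measures \<open>\<mu> \<omega>\<close>, and the bound can be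
  integrated over \<open>\<omega>\<close> term by term.
\<close>

lemma (in prob_space) second_moment_product:
  fixes f g :: "'i \<Rightarrow> 'a \<Rightarrow> real"
  assumes "finite I" and "0 < c"
    and [measurable]: "\<And>p. p \<in> I \<Longrightarrow> f p \<in> borel_measurable M" "\<And>p. p \<in> I \<Longrightarrow> g p \<in> borel_measurable M"
    and bdd: "\<And>p x. \<bar>f p x\<bar> \<le> B" "\<And>p x. \<bar>g p x\<bar> \<le> B"
  shows "measure (M \<Otimes>\<^sub>M M) {z \<in> space (M \<Otimes>\<^sub>M M). (\<Sum>p\<in>I. f p (fst z) * g p (snd z)) = 0}
    \<le> ((\<Sum>p\<in>I. \<Sum>q\<in>I. (\<integral>x. f p x * f q x \<partial>M) * (\<integral>x. g p x * g q x \<partial>M))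
        - 2 * c * (\<Sum>p\<in>I. (\<integral>x. f p x \<partial>M) * (\<integral>x. g p x \<partial>M)) + c\<^sup>2) / c\<^sup>2"
proof -
  interpret pair_prob_space M M ..
  have B: "0 \<le> B" using bdd(1) abs_ge_zero order_trans by blast
  have int: "integrable (M \<Otimes>\<^sub>M M) (\<lambda>z. u (fst z) * v (snd z))"
    and eq: "(\<integral>z. u (fst z) * v (snd z) \<partial>(M \<Otimes>\<^sub>M M)) = (\<integral>x. u x \<partial>M) * (\<integral>x. v x \<partial>M)"
    if [measurable]: "u \<in> borel_measurable M" "v \<in> borel_measurable M"
      and "\<And>x. \<bar>u x\<bar> \<le> B'" "\<And>x. \<bar>v x\<bar> \<le> B'" for u v :: "'a \<Rightarrow> real" and B'
  proof -
    have "0 \<le> B'" using that(3) abs_ge_zero order_trans by blast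
    then show *: "integrable (M \<Otimes>\<^sub>M M) (\<lambda>z. u (fst z) * v (snd z))"
      using that(3,4) by (intro P.integrable_const_bound[where B = "B' * B'"])
        (auto simp: abs_mult intro!: mult_mono)
    then have "(\<integral>z. u (fst z) * v (snd z) \<partial>(M \<Otimes>\<^sub>M M)) = (\<integral>x. \<integral>y. u x * v y \<partial>M \<partial>M)"
      using integral_fst'[of "\<lambda>z. u (fst z) * v (snd z)"] by simp
    then show "(\<integral>z. u (fst z) * v (snd z) \<partial>(M \<Otimes>\<^sub>M M)) = (\<integral>x. u x \<partial>M) * (\<integral>x. v x \<partial>M)"
      by simp
  qed
  define Z where "Z z = (\<Sum>p\<in>I. f p (fst z) * g p (snd z))" for z
  have [measurable]: "Z \<in> borel_measurable (M \<Otimes>\<^sub>M M)"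
    unfolding Z_def by measurable
  have expand: "(Z z - c)\<^sup>2 = (\<Sum>p\<in>I. \<Sum>q\<in>I. (f p (fst z) * f q (fst z)) * (g p (snd z) * g q (snd z)))
      - 2 * c * (\<Sum>p\<in>I. f p (fst z) * g p (snd z)) + c\<^sup>2" for z
    unfolding power2_diff unfolding Z_def
    by (simp add: power2_eq_square sum_product algebra_simps)
  have i1: "integrable (M \<Otimes>\<^sub>M M) (\<lambda>z. f p (fst z) * g p (snd z))"
    "(\<integral>z. f p (fst z) * g p (snd z) \<partial>(M \<Otimes>\<^sub>M M)) = (\<integral>x. f p x \<partial>M) * (\<integral>x. g p x \<partial>M)"
    if "p \<in> I" for p
    using int[of "f p" "g p", OF _ _ bdd(1) bdd(2)] eq[of "f p" "g p", OF _ _ bdd(1) bdd(2)] that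
    by simp_all
  have i2: "integrable (M \<Otimes>\<^sub>M M) (\<lambda>z. (f p (fst z) * f q (fst z)) * (g p (snd z) * g q (snd z)))"
    "(\<integral>z. (f p (fst z) * f q (fst z)) * (g p (snd z) * g q (snd z)) \<partial>(M \<Otimes>\<^sub>M M))
      = (\<integral>x. f p x * f q x \<partial>M) * (\<integral>x. g p x * g q x \<partial>M)"
    if "p \<in> I" "q \<in> I" for p q
  proof -
    have b: "\<bar>f p x * f q x\<bar> \<le> B * B" "\<bar>g p x * g q x\<bar> \<le> B * B" for x
      using bdd B by (auto simp: abs_mult intro!: mult_mono)
    show "integrable (M \<Otimes>\<^sub>M M) (\<lambda>z. (f p (fst z) * f q (fst z)) * (g p (snd z) * g q (snd z)))"
      by (rule int[of "\<lambda>x. f p x * f q x" "\<lambda>x. g p x * g q x", OF _ _ b]) (use that in measurable)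
    show "(\<integral>z. (f p (fst z) * f q (fst z)) * (g p (snd z) * g q (snd z)) \<partial>(M \<Otimes>\<^sub>M M))
      = (\<integral>x. f p x * f q x \<partial>M) * (\<integral>x. g p x * g q x \<partial>M)"
      by (rule eq[of "\<lambda>x. f p x * f q x" "\<lambda>x. g p x * g q x", OF _ _ b]) (use that in measurable)
  qed
  have int_sq: "integrable (M \<Otimes>\<^sub>M M) (\<lambda>z. (Z z - c)\<^sup>2)"
    unfolding expand using i1 i2
    by (intro Bochner_Integration.integrable_add Bochner_Integration.integrable_diff
        Bochner_Integration.integrable_sum integrable_mult_right) auto
  have "measure (M \<Otimes>\<^sub>M M) {z \<in> space (M \<Otimes>\<^sub>M M). Z z = 0}
      = (\<integral>z. indicator {z \<in> space (M \<Otimes>\<^sub>M M). Z z = 0} z \<partial>(M \<Otimes>\<^sub>M M))"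
    by simp
  also have "\<dots> \<le> (\<integral>z. (Z z - c)\<^sup>2 / c\<^sup>2 \<partial>(M \<Otimes>\<^sub>M M))"
    using \<open>0 < c\<close> int_sq
    by (intro integral_mono) (auto intro!: P.integrable_const_bound[where B = 1] simp: indicator_def)
  also have "\<dots> = (\<integral>z. (Z z - c)\<^sup>2 \<partial>(M \<Otimes>\<^sub>M M)) / c\<^sup>2" by simp
  also have "(\<integral>z. (Z z - c)\<^sup>2 \<partial>(M \<Otimes>\<^sub>M M))
      = (\<Sum>p\<in>I. \<Sum>q\<in>I. (\<integral>x. f p x * f q x \<partial>M) * (\<integral>x. g p x * g q x \<partial>M))
        - 2 * c * (\<Sum>p\<in>I. (\<integral>x. f p x \<partial>M) * (\<integral>x. g p x \<partial>M)) + c\<^sup>2"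
    unfolding expand using i1 i2 P.prob_space
    by (subst Bochner_Integration.integral_add Bochner_Integration.integral_diff
        Bochner_Integration.integral_sum,
        (auto intro!: Bochner_Integration.integrable_sum integrable_mult_right)[2])+
  finally show ?thesis by (simp add: Z_def)
qed

section \<open>Random dynamical systems\<close>

context random_dynamical_system
begin

abbreviation orb :: "nat \<Rightarrow> 'w \<Rightarrow> 'x \<Rightarrow> 'x" where "orb \<equiv> fiber_iterate \<theta> T"
abbreviation S :: "'w \<times> 'x \<Rightarrow> 'w \<times> 'x" where "S \<equiv> skew_product \<theta> T"

sublocale P: prob_space P by (rule prob_base)
sublocale \<nu>: prob_space \<nu> by (rule prob_total)

lemma space_base[simp]: "space P = UNIV"
  using sets_base by (auto dest: sets_eq_imp_space_eq)

lemma space_total[simp]: "space \<nu> = UNIV"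
  using sets_eq_imp_space_eq[OF sets_total] by (simp add: space_pair_measure)

lemma prob_space_fiber: "prob_space (\<mu> \<omega>)"
  and sets_fiber[simp, measurable_cong]: "sets (\<mu> \<omega>) = sets borel"
  using measurable_space[OF measurable_fiber_measures, of \<omega>] by (auto simp: space_prob_algebra)

lemma space_fiber[simp]: "space (\<mu> \<omega>) = UNIV"
  using sets_eq_imp_space_eq[OF sets_fiber[of \<omega>]] by simp

lemma measurable_total_iff: "f \<in> measurable \<nu> N \<longleftrightarrow> f \<in> measurable (P \<Otimes>\<^sub>M borel) N"
  by (rule arg_cong[where f = "\<lambda>A. f \<in> A"], rule measurable_cong_sets)
    (simp_all add: sets_total sets_base cong: sets_pair_measure_cong)

lemma skew_iterate: "(S ^^ n) (\<omega>, x) = ((\<theta> ^^ n) \<omega>, orb n \<omega> x)"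
  by (induction n) (simp_all add: skew_product_def)

lemma orb_add: "orb (m + n) \<omega> x = orb n ((\<theta> ^^ m) \<omega>) (orb m \<omega> x)"
  by (induction n) (simp_all, metis add.commute comp_apply funpow_add)

lemma measurable_base_iterate[measurable]: "(\<theta> ^^ n) \<in> measurable P P"
  using measurable_base by (rule measurable_compose_n)

lemma measurable_skew_iterate[measurable]: "(S ^^ n) \<in> measurable \<nu> \<nu>"
  using measurable_skew by (rule measurable_compose_n)

lemma measurable_orb_total[measurable]: "(\<lambda>z. orb n (fst z) (snd z)) \<in> measurable \<nu> borel"
proof -
  have "(\<lambda>z. snd ((S ^^ n) z)) \<in> measurable \<nu> borel"
    by (rule measurable_compose[OF measurable_skew_iterate]) (simp add: measurable_total_iff)
  then show ?thesis by (simp add: case_prod_beta skew_iterate[of n "fst z" "snd z" for z, simplified])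
qed

lemma measurable_orb[measurable]: "orb n \<omega> \<in> measurable borel borel"
  by (induction n) (auto intro: measurable_compose measurable_fiber_maps simp: comp_def)

lemma distr_base_iterate: "distr P P (\<theta> ^^ n) = P"
proof (induction n)
  case (Suc n)
  have "distr P P (\<theta> ^^ Suc n) = distr (distr P P (\<theta> ^^ n)) P \<theta>"
    using measurable_base by (subst distr_distr) simp_all
  then show ?case by (simp only: Suc invariant_base)
qed (simp add: distr_id id_def)

lemma distr_total_iterate: "distr \<nu> \<nu> (S ^^ n) = \<nu>"
proof (induction n)
  case (Suc n)
  have "distr \<nu> \<nu> (S ^^ Suc n) = distr (distr \<nu> \<nu> (S ^^ n)) \<nu> S"
    using measurable_skew by (subst distr_distr) simp_all
  then show ?case by (simp only: Suc invariant_total)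
qed (simp add: distr_id id_def)

lemma integral_base_iterate:
  fixes f :: "'w \<Rightarrow> real"
  assumes "f \<in> borel_measurable P"
  shows "(\<integral>\<omega>. f ((\<theta> ^^ n) \<omega>) \<partial>P) = (\<integral>\<omega>. f \<omega> \<partial>P)"
  using integral_distr[OF measurable_base_iterate assms, of n] by (simp add: distr_base_iterate)

lemma measurable_fiber_nn_integral:
  fixes f :: "'w \<times> 'x \<Rightarrow> ennreal"
  assumes "f \<in> borel_measurable \<nu>"
  shows "(\<lambda>\<omega>. \<integral>\<^sup>+ x. f (\<omega>, x) \<partial>\<mu> \<omega>) \<in> borel_measurable P"
  using measurable_prob_algebraD[OF measurable_fiber_measures] assms
  by (intro nn_integral_measurable_subprob_algebra2[where N = borel]) (simp_all add: measurable_total_iff)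

lemma measurable_fiber_section:
  assumes "f \<in> borel_measurable \<nu>"
  shows "(\<lambda>x. f (\<omega>, x)) \<in> borel_measurable (\<mu> \<omega>)"
  using measurable_compose[OF measurable_Pair1'[of \<omega> P borel] assms[unfolded measurable_total_iff]]
  by (simp cong: measurable_cong_sets)

lemma measurable_fiber_integral:
  fixes f :: "'w \<times> 'x \<Rightarrow> real"
  assumes [measurable]: "f \<in> borel_measurable \<nu>" and "\<And>z. 0 \<le> f z"
  shows "(\<lambda>\<omega>. \<integral>x. f (\<omega>, x) \<partial>\<mu> \<omega>) \<in> borel_measurable P"
proof -
  have "(\<lambda>\<omega>. \<integral>x. f (\<omega>, x) \<partial>\<mu> \<omega>) = (\<lambda>\<omega>. enn2real (\<integral>\<^sup>+ x. ennreal (f (\<omega>, x)) \<partial>\<mu> \<omega>))"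
    using assms(2) measurable_fiber_section[OF assms(1)] by (intro ext integral_eq_nn_integral) auto
  also have "\<dots> \<in> borel_measurable P"
    using measurable_fiber_nn_integral[of "\<lambda>z. ennreal (f z)"] by simp
  finally show ?thesis .
qed

text \<open>
  The function \<open>f\<close> may depend on the base point; for functions of \<open>x\<close> alone this says that \<open>T\<close> maps
  \<open>\<mu> \<omega>\<close> to \<open>\<mu> (\<theta> \<omega>)\<close>. Both sides have the same integral over each measurable set \<open>B\<close> of base
  points, by invariance of \<open>\<nu>\<close>, provided that \<open>B\<close> is the preimage of a measurable set under the iterate of
  \<open>\<theta>\<close>. Measurability of the inverse makes every measurable \<open>B\<close> such a preimage.
\<close>

lemma equivariance:
  fixes f :: "'w \<times> 'x \<Rightarrow> ennreal"
  assumes [measurable]: "f \<in> borel_measurable \<nu>"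
    and inv_meas: "inv (\<theta> ^^ n) \<in> measurable P P"
  shows "AE \<omega> in P. (\<integral>\<^sup>+ x. f ((\<theta> ^^ n) \<omega>, orb n \<omega> x) \<partial>\<mu> \<omega>)
    = (\<integral>\<^sup>+ x. f ((\<theta> ^^ n) \<omega>, x) \<partial>\<mu> ((\<theta> ^^ n) \<omega>))"
proof (rule P.density_unique)
  let ?L = "\<lambda>\<omega>. \<integral>\<^sup>+ x. f ((\<theta> ^^ n) \<omega>, orb n \<omega> x) \<partial>\<mu> \<omega>"
  let ?F = "\<lambda>\<omega>. \<integral>\<^sup>+ x. f (\<omega>, x) \<partial>\<mu> \<omega>"
  have fS: "(\<lambda>z. f ((S ^^ n) z)) \<in> borel_measurable \<nu>" by measurable
  from measurable_fiber_nn_integral[OF this]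
  show L[measurable]: "?L \<in> borel_measurable P" by (simp add: skew_iterate)
  have F[measurable]: "?F \<in> borel_measurable P" by (rule measurable_fiber_nn_integral) fact
  show R[measurable]: "(\<lambda>\<omega>. ?F ((\<theta> ^^ n) \<omega>)) \<in> borel_measurable P" by measurable
  show "density P ?L = density P (\<lambda>\<omega>. ?F ((\<theta> ^^ n) \<omega>))"
  proof (rule measure_eqI)
    fix B assume "B \<in> sets (density P ?L)"
    then have B[measurable]: "B \<in> sets P" by simp
    define B' where "B' = inv (\<theta> ^^ n) -` B"
    have B'[measurable]: "B' \<in> sets P"
      using measurable_sets[OF inv_meas B] by (simp add: B'_def)
    have "inj (\<theta> ^^ n)" using bij_fn[OF invertible_base] by (rule bij_is_inj)
    then have ind: "indicator B \<omega> = (indicator B' ((\<theta> ^^ n) \<omega>) :: ennreal)" for \<omega>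
      by (simp add: B'_def indicator_def)
    have [measurable]: "(\<lambda>z. indicator B' (fst z) :: ennreal) \<in> borel_measurable \<nu>"
      unfolding measurable_total_iff by measurable
    have "emeasure (density P ?L) B = (\<integral>\<^sup>+ \<omega>. ?L \<omega> * indicator B \<omega> \<partial>P)"
      by (rule emeasure_density) measurable
    also have "\<dots> = (\<integral>\<^sup>+ \<omega>. (\<integral>\<^sup>+ x. indicator B' ((\<theta> ^^ n) \<omega>) * f ((\<theta> ^^ n) \<omega>, orb n \<omega> x) \<partial>\<mu> \<omega>) \<partial>P)"
      using measurable_fiber_section[OF fS] ind
      by (intro nn_integral_cong, subst nn_integral_cmult) (simp_all add: skew_iterate mult.commute)
    also have "\<dots> = (\<integral>\<^sup>+ z. indicator B' (fst ((S ^^ n) z)) * f ((S ^^ n) z) \<partial>\<nu>)"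
      by (subst disintegration) (simp_all add: skew_iterate)
    also have "\<dots> = (\<integral>\<^sup>+ z. indicator B' (fst z) * f z \<partial>distr \<nu> \<nu> (S ^^ n))"
      by (subst nn_integral_distr) simp_all
    also have "\<dots> = (\<integral>\<^sup>+ z. indicator B' (fst z) * f z \<partial>\<nu>)" by (simp add: distr_total_iterate)
    also have "\<dots> = (\<integral>\<^sup>+ \<omega>. indicator B' \<omega> * ?F \<omega> \<partial>P)"
      using measurable_fiber_section[of f]
      by (subst disintegration) (auto intro!: nn_integral_cong nn_integral_cmult)
    also have "\<dots> = (\<integral>\<^sup>+ \<omega>. indicator B' \<omega> * ?F \<omega> \<partial>distr P P (\<theta> ^^ n))"
      by (simp add: distr_base_iterate)
    also have "\<dots> = (\<integral>\<^sup>+ \<omega>. indicator B' ((\<theta> ^^ n) \<omega>) * ?F ((\<theta> ^^ n) \<omega>) \<partial>P)"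
      by (subst nn_integral_distr) simp_all
    also have "\<dots> = (\<integral>\<^sup>+ \<omega>. ?F ((\<theta> ^^ n) \<omega>) * indicator B \<omega> \<partial>P)"
      by (simp add: ind mult.commute)
    also have "\<dots> = emeasure (density P (\<lambda>\<omega>. ?F ((\<theta> ^^ n) \<omega>))) B"
      by (rule emeasure_density[symmetric]) measurable
    finally show "emeasure (density P ?L) B = emeasure (density P (\<lambda>\<omega>. ?F ((\<theta> ^^ n) \<omega>))) B" .
  qed simp
qed

lemma disintegration_bounded:
  fixes f :: "'w \<times> 'x \<Rightarrow> real"
  assumes [measurable]: "f \<in> borel_measurable \<nu>" and "\<And>z. 0 \<le> f z" "\<And>z. f z \<le> 1"
  shows "(\<integral>z. f z \<partial>\<nu>) = (\<integral>\<omega>. (\<integral>x. f (\<omega>, x) \<partial>\<mu> \<omega>) \<partial>P)"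
proof -
  have fib: "(\<integral>\<^sup>+ x. ennreal (f (\<omega>, x)) \<partial>\<mu> \<omega>) = ennreal (\<integral>x. f (\<omega>, x) \<partial>\<mu> \<omega>)" for \<omega>
  proof -
    interpret prob_space "\<mu> \<omega>" by (rule prob_space_fiber)
    show ?thesis using assms(2,3) measurable_fiber_section[OF assms(1)]
      by (intro nn_integral_eq_integral integrable_const_bound[where B = 1]) auto
  qed
  have "(\<integral>z. f z \<partial>\<nu>) = enn2real (\<integral>\<^sup>+ z. ennreal (f z) \<partial>\<nu>)"
    using assms by (intro integral_eq_nn_integral) auto
  also have "\<dots> = enn2real (\<integral>\<^sup>+ \<omega>. ennreal (\<integral>x. f (\<omega>, x) \<partial>\<mu> \<omega>) \<partial>P)"
    by (subst disintegration) (simp_all add: fib)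
  also have "\<dots> = (\<integral>\<omega>. (\<integral>x. f (\<omega>, x) \<partial>\<mu> \<omega>) \<partial>P)"
    using assms(2) measurable_fiber_integral[OF assms(1,2)] by (intro integral_eq_nn_integral[symmetric]) auto
  finally show ?thesis .
qed

end

section \<open>Fiber correlations\<close>

definition unit_lipschitz :: "real \<Rightarrow> ('a :: metric_space \<Rightarrow> real) \<Rightarrow> bool" where
  "unit_lipschitz l f \<longleftrightarrow> l-lipschitz_on UNIV f \<and> (\<forall>x. 0 \<le> f x \<and> f x \<le> 1)"

lemma unit_lipschitzD:
  assumes "unit_lipschitz l f"
  shows "l-lipschitz_on UNIV f" "is_lipschitz f" "0 \<le> f x" "f x \<le> 1" "\<bar>f x\<bar> \<le> 1" "0 \<le> l"
    "f \<in> borel_measurable borel" "0 \<le> lip_norm f" "lip_norm f \<le> 1 + l"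
  using assms lip_norm_bounds[of l f 1] lipschitz_on_nonneg[of l UNIV f] lipschitz_borel_measurable[of l f]
  by (auto simp: unit_lipschitz_def is_lipschitz_def)

lemma unit_lipschitz_1: "0 \<le> l \<Longrightarrow> unit_lipschitz l (\<lambda>_. 1)"
  by (auto simp: unit_lipschitz_def lipschitz_on_def)

text \<open>
  Used to replace correlations by products of Lipschitz functions of the base point, to which mixing of
  the base applies.
\<close>

lemma (in prob_space) covariance_perturbation:
  fixes X Y U V :: "'a \<Rightarrow> real"
  assumes [measurable]: "X \<in> borel_measurable M" "Y \<in> borel_measurable M"
      "U \<in> borel_measurable M" "V \<in> borel_measurable M"
    and bdd: "\<And>x. \<bar>X x\<bar> \<le> 1" "\<And>x. \<bar>Y x\<bar> \<le> 1" "\<And>x. \<bar>U x\<bar> \<le> 1" "\<And>x. \<bar>V x\<bar> \<le> 1"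
    and near: "AE x in M. \<bar>X x - U x\<bar> \<le> \<eta>" "AE x in M. \<bar>Y x - V x\<bar> \<le> \<eta>"
    and cov: "\<bar>(\<integral>x. U x * V x \<partial>M) - (\<integral>x. U x \<partial>M) * (\<integral>x. V x \<partial>M)\<bar> \<le> \<epsilon>"
  shows "\<bar>(\<integral>x. X x * Y x \<partial>M) - (\<integral>x. X x \<partial>M) * (\<integral>x. Y x \<partial>M)\<bar> \<le> 4 * \<eta> + \<epsilon>"
proof -
  have prod_near: "\<bar>a * b - u * v\<bar> \<le> \<bar>a - u\<bar> + \<bar>b - v\<bar>" if "\<bar>b\<bar> \<le> 1" "\<bar>u\<bar> \<le> 1" for a b u v :: real
  proof -
    have "\<bar>a * b - u * v\<bar> = \<bar>(a - u) * b + u * (b - v)\<bar>" by (simp add: algebra_simps)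
    also have "\<dots> \<le> \<bar>a - u\<bar> * \<bar>b\<bar> + \<bar>u\<bar> * \<bar>b - v\<bar>" by (metis abs_mult abs_triangle_ineq)
    also have "\<dots> \<le> \<bar>a - u\<bar> * 1 + 1 * \<bar>b - v\<bar>" using that by (intro add_mono mult_mono) auto
    finally show ?thesis by simp
  qed
  have mult1: "\<bar>a * b\<bar> \<le> 1" if "\<bar>a\<bar> \<le> 1" "\<bar>b\<bar> \<le> 1" for a b :: real
    using mult_mono[OF that] by (simp add: abs_mult)
  have int: "integrable M f" if "f \<in> borel_measurable M" "\<And>x. \<bar>f x\<bar> \<le> 1" for f :: "'a \<Rightarrow> real"
    using that by (intro integrable_const_bound[where B = 1]) auto
  have ints: "integrable M X" "integrable M Y" "integrable M U" "integrable M V"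
    "integrable M (\<lambda>x. X x * Y x)" "integrable M (\<lambda>x. U x * V x)"
    using bdd mult1 by (auto intro!: int)
  have diff: "\<bar>(\<integral>x. f x \<partial>M) - (\<integral>x. g x \<partial>M)\<bar> \<le> e"
    if "integrable M f" "integrable M g" "AE x in M. \<bar>f x - g x\<bar> \<le> e" for f g :: "'a \<Rightarrow> real" and e
  proof -
    have "\<bar>(\<integral>x. f x \<partial>M) - (\<integral>x. g x \<partial>M)\<bar> = \<bar>\<integral>x. f x - g x \<partial>M\<bar>" using that by simp
    also have "\<dots> \<le> (\<integral>x. \<bar>f x - g x\<bar> \<partial>M)" by (rule integral_abs_bound)
    also have "\<dots> \<le> (\<integral>x. e \<partial>M)" using that by (intro integral_mono_AE) auto
    finally show ?thesis by (simp add: prob_space)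
  qed
  have mean1: "\<bar>\<integral>x. f x \<partial>M\<bar> \<le> 1" if "\<And>x. \<bar>f x\<bar> \<le> 1" "integrable M f" for f :: "'a \<Rightarrow> real"
  proof -
    have "\<bar>\<integral>x. f x \<partial>M\<bar> \<le> (\<integral>x. \<bar>f x\<bar> \<partial>M)" by (rule integral_abs_bound)
    also have "\<dots> \<le> (\<integral>x. 1 \<partial>M)" using that by (intro integral_mono) auto
    finally show ?thesis by (simp add: prob_space)
  qed
  have "AE x in M. \<bar>X x * Y x - U x * V x\<bar> \<le> 2 * \<eta>"
    using near
  proof eventually_elim
    case (elim x)
    then show ?case using prod_near[OF bdd(2)[of x] bdd(3)[of x], of "X x" "V x"] by simp
  qed
  then have "\<bar>(\<integral>x. X x * Y x \<partial>M) - (\<integral>x. U x * V x \<partial>M)\<bar> \<le> 2 * \<eta>"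
    using ints by (intro diff) auto
  moreover have "\<bar>(\<integral>x. X x \<partial>M) * (\<integral>x. Y x \<partial>M) - (\<integral>x. U x \<partial>M) * (\<integral>x. V x \<partial>M)\<bar> \<le> 2 * \<eta>"
    using prod_near[OF mean1[OF bdd(2) ints(2)] mean1[OF bdd(3) ints(3)], of "\<integral>x. X x \<partial>M" "\<integral>x. V x \<partial>M"]
      diff[OF ints(1,3) near(1)] diff[OF ints(2,4) near(2)] by linarith
  ultimately show ?thesis using cov by linarith
qed

context random_dynamical_system
begin

definition corr :: "('x \<Rightarrow> real) \<Rightarrow> ('x \<Rightarrow> real) \<Rightarrow> nat \<Rightarrow> nat \<Rightarrow> 'w \<Rightarrow> real" where
  "corr \<phi> \<psi> i j \<omega> = (\<integral>x. \<phi> (orb i \<omega> x) * \<psi> (orb j \<omega> x) \<partial>\<mu> \<omega>)"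

definition mean_corr :: "('x \<Rightarrow> real) \<Rightarrow> ('x \<Rightarrow> real) \<Rightarrow> nat \<Rightarrow> nat \<Rightarrow> real" where
  "mean_corr \<phi> \<psi> i j = (\<integral>\<omega>. corr \<phi> \<psi> i j \<omega> \<partial>P)"

definition mean :: "('x \<Rightarrow> real) \<Rightarrow> real" where
  "mean \<phi> = (\<integral>x. \<phi> x \<partial>fiber_marginal \<nu>)"

lemma corr_commute: "corr \<phi> \<psi> i j = corr \<psi> \<phi> j i"
  by (auto simp: corr_def mult.commute)

lemma integrable_fiber:
  fixes h :: "'x \<Rightarrow> real"
  assumes "h \<in> borel_measurable borel" "\<And>x. \<bar>h x\<bar> \<le> B"
  shows "integrable (\<mu> \<omega>) h"
proof -
  interpret prob_space "\<mu> \<omega>" by (rule prob_space_fiber)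
  show ?thesis using assms by (intro integrable_const_bound[where B = B]) (auto cong: measurable_cong_sets)
qed

lemma fiber_integral_bounds:
  fixes h :: "'x \<Rightarrow> real"
  assumes "h \<in> borel_measurable borel" "\<And>x. 0 \<le> h x" "\<And>x. h x \<le> B"
  shows "0 \<le> (\<integral>x. h x \<partial>\<mu> \<omega>)" "(\<integral>x. h x \<partial>\<mu> \<omega>) \<le> B"
proof -
  interpret prob_space "\<mu> \<omega>" by (rule prob_space_fiber)
  show "0 \<le> (\<integral>x. h x \<partial>\<mu> \<omega>)" using assms(2) by simp
  have "integrable (\<mu> \<omega>) h" using assms by (intro integrable_fiber[where B = B]) auto
  then have "(\<integral>x. h x \<partial>\<mu> \<omega>) \<le> (\<integral>x. B \<partial>\<mu> \<omega>)" using assms by (intro integral_mono) auto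
  then show "(\<integral>x. h x \<partial>\<mu> \<omega>) \<le> B" using prob_space by simp
qed

context
  fixes l :: real and \<phi> \<psi> :: "'x \<Rightarrow> real"
  assumes \<phi>: "unit_lipschitz l \<phi>" and \<psi>: "unit_lipschitz l \<psi>"
begin

lemmas obs_measurable[measurable] = unit_lipschitzD(7)[OF \<phi>] unit_lipschitzD(7)[OF \<psi>]

lemma prod_unit: "0 \<le> \<phi> x * \<psi> y" "\<phi> x * \<psi> y \<le> 1" "\<bar>\<phi> x * \<psi> y\<bar> \<le> 1"
  using unit_lipschitzD(3,4)[OF \<phi>] unit_lipschitzD(3,4)[OF \<psi>] by (simp_all add: mult_le_one)

lemma corr_bounds: "0 \<le> corr \<phi> \<psi> i j \<omega>" "corr \<phi> \<psi> i j \<omega> \<le> 1" "\<bar>corr \<phi> \<psi> i j \<omega>\<bar> \<le> 1"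
  unfolding corr_def
  using fiber_integral_bounds[of "\<lambda>x. \<phi> (orb i \<omega> x) * \<psi> (orb j \<omega> x)" 1 \<omega>] prod_unit by simp_all

lemma measurable_orb_prod[measurable]:
  "(\<lambda>z. \<phi> (orb i (fst z) (snd z)) * \<psi> (orb j (fst z) (snd z))) \<in> borel_measurable \<nu>"
  by measurable

lemma measurable_corr[measurable]: "corr \<phi> \<psi> i j \<in> borel_measurable P"
  using measurable_fiber_integral[OF measurable_orb_prod] prod_unit by (simp add: corr_def[abs_def])

lemma mean_corr_eq:
  "mean_corr \<phi> \<psi> i j = (\<integral>z. \<phi> (orb i (fst z) (snd z)) * \<psi> (orb j (fst z) (snd z)) \<partial>\<nu>)"
  using disintegration_bounded[OF measurable_orb_prod] prod_unit by (simp add: mean_corr_def corr_def)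

lemma mean_corr_bounds: "0 \<le> mean_corr \<phi> \<psi> i j" "mean_corr \<phi> \<psi> i j \<le> 1"
proof -
  show "0 \<le> mean_corr \<phi> \<psi> i j" unfolding mean_corr_def using corr_bounds by simp
  have "mean_corr \<phi> \<psi> i j \<le> (\<integral>\<omega>. 1 \<partial>P)"
    unfolding mean_corr_def using corr_bounds
    by (intro integral_mono P.integrable_const_bound[where B = 1]) auto
  then show "mean_corr \<phi> \<psi> i j \<le> 1" using P.prob_space by simp
qed

text \<open>
  This stationarity under \<open>\<nu>\<close> is the reason why both time blocks have the same mean correlations.
\<close>

lemma mean_corr_shift: "mean_corr \<phi> \<psi> (n + i) (n + j) = mean_corr \<phi> \<psi> i j"
proof -
  have "mean_corr \<phi> \<psi> i j
      = (\<integral>z. \<phi> (orb i (fst z) (snd z)) * \<psi> (orb j (fst z) (snd z)) \<partial>distr \<nu> \<nu> (S ^^ n))"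
    by (simp add: mean_corr_eq distr_total_iterate)
  also have "\<dots> = (\<integral>z. \<phi> (orb i (fst ((S ^^ n) z)) (snd ((S ^^ n) z)))
      * \<psi> (orb j (fst ((S ^^ n) z)) (snd ((S ^^ n) z))) \<partial>\<nu>)"
    by (rule integral_distr) measurable
  also have "\<dots> = mean_corr \<phi> \<psi> (n + i) (n + j)"
    unfolding mean_corr_eq by (intro Bochner_Integration.integral_cong)
      (auto simp: skew_iterate orb_add)
  finally show ?thesis ..
qed

lemma corr_equivariant:
  assumes "inv (\<theta> ^^ n) \<in> measurable P P"
  shows "AE \<omega> in P. corr \<phi> \<psi> (n + i) (n + j) \<omega> = corr \<phi> \<psi> i j ((\<theta> ^^ n) \<omega>)"
proof -
  have nn: "(\<integral>\<^sup>+ x. ennreal (\<phi> (orb a \<omega>' x) * \<psi> (orb b \<omega>' x)) \<partial>\<mu> \<omega>') = ennreal (corr \<phi> \<psi> a b \<omega>')"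
    for a b \<omega>'
    unfolding corr_def using prod_unit
    by (intro nn_integral_eq_integral integrable_fiber[where B = 1]) auto
  have "AE \<omega> in P. ennreal (corr \<phi> \<psi> (n + i) (n + j) \<omega>) = ennreal (corr \<phi> \<psi> i j ((\<theta> ^^ n) \<omega>))"
    using equivariance[of "\<lambda>z. ennreal (\<phi> (orb i (fst z) (snd z)) * \<psi> (orb j (fst z) (snd z)))", OF _ assms]
    by (simp add: nn orb_add[symmetric] del: ennreal_inj)
  then show ?thesis by eventually_elim (simp add: corr_bounds)
qed

end

lemma mean_eq_mean_corr:
  assumes \<phi>: "unit_lipschitz l \<phi>"
  shows "mean \<phi> = mean_corr \<phi> (\<lambda>_. 1) i i"
proof -
  have one: "unit_lipschitz l (\<lambda>_. 1)" using unit_lipschitz_1 unit_lipschitzD(6)[OF \<phi>] by blast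
  have [measurable]: "\<phi> \<in> borel_measurable borel" by (rule unit_lipschitzD(7)[OF \<phi>])
  have "mean_corr \<phi> (\<lambda>_. 1) i i = mean_corr \<phi> (\<lambda>_. 1) 0 0"
    using mean_corr_shift[OF \<phi> one, of i 0 0] by simp
  also have "\<dots> = (\<integral>z. \<phi> (snd z) \<partial>\<nu>)" using mean_corr_eq[OF \<phi> one, of 0 0] by simp
  also have "\<dots> = mean \<phi>"
    unfolding mean_def fiber_marginal_def
    by (rule integral_distr[symmetric]) (simp_all add: measurable_total_iff)
  finally show ?thesis ..
qed

end

section \<open>Decoupling\<close>

locale lipschitz_mixing_rds = random_dynamical_system P \<theta> T \<nu> \<mu>
  for P :: "'w :: metric_space measure" and \<theta> :: "'w \<Rightarrow> 'w"
    and T :: "'w \<Rightarrow> 'x :: metric_space \<Rightarrow> 'x"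
    and \<nu> :: "('w \<times> 'x) measure" and \<mu> :: "'w \<Rightarrow> 'x measure" +
  fixes K C\<^sub>1 c\<^sub>2 C\<^sub>2 c\<^sub>3 C\<^sub>3 :: real
  assumes constants: "1 \<le> K" "0 < C\<^sub>1" "0 < c\<^sub>2" "0 < C\<^sub>2" "0 < c\<^sub>3" "0 < C\<^sub>3"
    and skew_lipschitz: "K-lipschitz_on UNIV (skew_product \<theta> T)"
    and dependence: "\<And>(f :: 'x \<Rightarrow> real) \<omega> \<omega>'. is_lipschitz f \<Longrightarrow>
      \<bar>(\<integral>x. f x \<partial>\<mu> \<omega>) - (\<integral>x. f x \<partial>\<mu> \<omega>')\<bar> \<le> C\<^sub>1 * lip_norm f * dist \<omega> \<omega>'"
    and base_mixing: "\<And>(f\<^sub>1 :: 'w \<Rightarrow> real) f\<^sub>2 g\<^sub>1 g\<^sub>2 n a b c.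
      is_lipschitz f\<^sub>1 \<Longrightarrow> is_lipschitz f\<^sub>2 \<Longrightarrow> is_lipschitz g\<^sub>1 \<Longrightarrow> is_lipschitz g\<^sub>2 \<Longrightarrow>
      a \<le> b \<Longrightarrow> b \<le> c \<Longrightarrow> n \<le> b - a \<Longrightarrow>
        \<bar>(\<integral>\<omega>. f\<^sub>1 \<omega> * f\<^sub>2 ((\<theta> ^^ a) \<omega>) * g\<^sub>1 ((\<theta> ^^ b) \<omega>) * g\<^sub>2 ((\<theta> ^^ c) \<omega>) \<partial>P)
          - (\<integral>\<omega>. f\<^sub>1 \<omega> * f\<^sub>2 ((\<theta> ^^ a) \<omega>) \<partial>P) * (\<integral>\<omega>. g\<^sub>1 \<omega> * g\<^sub>2 ((\<theta> ^^ (c - b)) \<omega>) \<partial>P)\<bar>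
        \<le> C\<^sub>2 * exp (- (real n powr c\<^sub>2)) * lip_norm f\<^sub>1 * lip_norm f\<^sub>2 * lip_norm g\<^sub>1 * lip_norm g\<^sub>2"
    and fiber_mixing: "\<And>(f :: 'x \<Rightarrow> real) g n \<omega>. is_lipschitz f \<Longrightarrow> is_lipschitz g \<Longrightarrow>
        \<bar>(\<integral>x. f x * g (fiber_iterate \<theta> T n \<omega> x) \<partial>\<mu> \<omega>)
          - (\<integral>x. f x \<partial>\<mu> \<omega>) * (\<integral>x. g x \<partial>\<mu> ((\<theta> ^^ n) \<omega>))\<bar>
        \<le> C\<^sub>3 * exp (- (real n powr c\<^sub>3)) * lip_norm f * lip_norm g"
begin

lemma skew_iterate_lipschitz: "(K ^ n)-lipschitz_on UNIV (S ^^ n)"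
proof (induction n)
  case (Suc n)
  have "(K * K ^ n)-lipschitz_on UNIV (S \<circ> S ^^ n)"
    by (rule lipschitz_on_compose[OF Suc lipschitz_on_subset[OF skew_lipschitz]]) simp
  then show ?case by (simp add: comp_def)
qed (simp add: lipschitz_on_def)

lemma dist_orb_le: "dist (orb n \<omega> x) (orb n \<omega>' x') \<le> K ^ n * dist (\<omega>, x) (\<omega>', x')"
  using lipschitz_onD[OF skew_iterate_lipschitz[of n], of "(\<omega>, x)" "(\<omega>', x')"]
    dist_snd_le[of "(S ^^ n) (\<omega>, x)" "(S ^^ n) (\<omega>', x')"]
  by (simp add: skew_iterate)

text \<open>
  The map \<open>\<theta>\<close> inherits the Lipschitz property from \<open>S\<close>, and a continuous bijection of a compact space
  is a homeomorphism.
\<close>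

lemma inverse_base_iterate_measurable: "inv (\<theta> ^^ n) \<in> measurable P P"
proof -
  have bij: "bij (\<theta> ^^ n)" using bij_fn[OF invertible_base] .
  have "(K ^ n)-lipschitz_on UNIV (\<theta> ^^ n)"
  proof (rule lipschitz_onI)
    fix \<omega> \<omega>' :: 'w
    let ?z = "(\<omega>, undefined :: 'x)" and ?z' = "(\<omega>', undefined :: 'x)"
    have "dist ((\<theta> ^^ n) \<omega>) ((\<theta> ^^ n) \<omega>') \<le> dist ((S ^^ n) ?z) ((S ^^ n) ?z')"
      using dist_fst_le[of "(S ^^ n) ?z" "(S ^^ n) ?z'"] by (simp add: skew_iterate)
    also have "\<dots> \<le> K ^ n * dist ?z ?z'"
      using lipschitz_onD[OF skew_iterate_lipschitz[of n]] by blast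
    finally show "dist ((\<theta> ^^ n) \<omega>) ((\<theta> ^^ n) \<omega>') \<le> K ^ n * dist \<omega> \<omega>'"
      by (simp add: dist_Pair_Pair)
  qed (use constants in simp)
  then have "continuous_on UNIV (\<theta> ^^ n)" by (rule lipschitz_on_continuous_on)
  then have "continuous_on ((\<theta> ^^ n) ` UNIV) (inv (\<theta> ^^ n))"
    using bij by (intro continuous_on_inv compact_base) (auto simp: bij_is_inj)
  then have "inv (\<theta> ^^ n) \<in> borel_measurable borel"
    using bij by (intro borel_measurable_continuous_onI) (simp add: bij_is_surj)
  then show ?thesis using sets_base by (simp cong: measurable_cong_sets)
qed

text \<open>
  A bound for the Lipschitz norms of the functions of the base point that replace correlations of
  \<open>l\<close>-Lipschitz observables; the power of \<open>K\<close> is due to time differences below \<open>L\<close>.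
\<close>

definition growth :: "real \<Rightarrow> nat \<Rightarrow> real" where
  "growth l L = 1 + l * K ^ L + C\<^sub>1 * (1 + l + l * K ^ L)"

text \<open>
  The error of mixing along the fibers for \<open>l\<close>-Lipschitz observables and a time difference of at least
  \<open>L\<close>.
\<close>

definition fiber_error :: "real \<Rightarrow> nat \<Rightarrow> real" where
  "fiber_error l L = C\<^sub>3 * exp (- (real L powr c\<^sub>3)) * (1 + l)\<^sup>2"

lemma fiber_error_nonneg: "0 \<le> fiber_error l L"
  using constants by (simp add: fiber_error_def)

lemma fiber_mean_lipschitz:
  assumes \<phi>: "unit_lipschitz l \<phi>"
  defines "F \<equiv> \<lambda>\<omega>. \<integral>x. \<phi> x \<partial>\<mu> \<omega>"
  shows "unit_lipschitz (C\<^sub>1 * (1 + l)) F"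
proof -
  have "(C\<^sub>1 * (1 + l))-lipschitz_on UNIV F"
  proof (rule lipschitz_onI)
    fix \<omega> \<omega>' :: 'w
    have "\<bar>F \<omega> - F \<omega>'\<bar> \<le> C\<^sub>1 * lip_norm \<phi> * dist \<omega> \<omega>'"
      unfolding F_def using unit_lipschitzD(2)[OF \<phi>] by (rule dependence)
    also have "\<dots> \<le> C\<^sub>1 * (1 + l) * dist \<omega> \<omega>'"
      using unit_lipschitzD(9)[OF \<phi>] constants by (intro mult_right_mono mult_left_mono) auto
    finally show "dist (F \<omega>) (F \<omega>') \<le> C\<^sub>1 * (1 + l) * dist \<omega> \<omega>'" by (simp add: dist_real_def)
  qed (use constants unit_lipschitzD(6)[OF \<phi>] in simp)
  then show ?thesis
    using fiber_integral_bounds[of \<phi> 1] unit_lipschitzD[OF \<phi>] by (auto simp: unit_lipschitz_def F_def)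
qed

text \<open>
  Moving \<open>\<omega>\<close> changes the integrand, by at most \<open>l * K ^ k\<close> times the distance since \<open>S\<close> is
  \<open>K\<close>-Lipschitz, and it changes the measure, which costs \<open>C\<^sub>1\<close> times the Lipschitz norm of the
  integrand.
\<close>

lemma corr_lipschitz:
  assumes \<phi>: "unit_lipschitz l \<phi>" and \<psi>: "unit_lipschitz l \<psi>"
  shows "unit_lipschitz (l * K ^ k + C\<^sub>1 * (1 + l + l * K ^ k)) (corr \<phi> \<psi> 0 k)"
proof -
  have l: "0 \<le> l" and K: "1 \<le> K ^ k" using unit_lipschitzD(6)[OF \<phi>] constants by auto
  note [measurable] = obs_measurable[OF \<phi> \<psi>]
  have orb_lip: "(l * K ^ k)-lipschitz_on UNIV (\<lambda>x. \<psi> (orb k \<omega> x))" for \<omega>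
  proof (rule lipschitz_onI)
    fix x y
    have "dist (\<psi> (orb k \<omega> x)) (\<psi> (orb k \<omega> y)) \<le> l * dist (orb k \<omega> x) (orb k \<omega> y)"
      using unit_lipschitzD(1)[OF \<psi>] by (rule lipschitz_onD) auto
    also have "\<dots> \<le> l * (K ^ k * dist x y)"
      using dist_orb_le[of k \<omega> x \<omega> y] l by (intro mult_left_mono) (auto simp: dist_Pair_Pair)
    finally show "dist (\<psi> (orb k \<omega> x)) (\<psi> (orb k \<omega> y)) \<le> l * K ^ k * dist x y" by (simp add: mult.assoc)
  qed (use l K in simp)
  have "(l * K ^ k + C\<^sub>1 * (1 + l + l * K ^ k))-lipschitz_on UNIV (corr \<phi> \<psi> 0 k)"
  proof (rule lipschitz_onI)
    fix \<omega> \<omega>' :: 'w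
    interpret M: prob_space "\<mu> \<omega>" by (rule prob_space_fiber)
    define h where "h x = \<phi> x * \<psi> (orb k \<omega>' x)" for x
    have h_lip: "(l + l * K ^ k)-lipschitz_on UNIV h"
      unfolding h_def using unit_lipschitzD[OF \<phi>] unit_lipschitzD[OF \<psi>] orb_lip
      by (intro lipschitz_on_mult_unit) auto
    have h_unit: "\<bar>h x\<bar> \<le> 1" for x unfolding h_def by (rule prod_unit[OF \<phi> \<psi>])
    have "\<bar>corr \<phi> \<psi> 0 k \<omega> - (\<integral>x. h x \<partial>\<mu> \<omega>)\<bar>
        = \<bar>\<integral>x. \<phi> x * \<psi> (orb k \<omega> x) - h x \<partial>\<mu> \<omega>\<bar>"
      unfolding corr_def using prod_unit[OF \<phi> \<psi>] h_unit lipschitz_borel_measurable[OF h_lip]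
      by (subst Bochner_Integration.integral_diff) (auto intro!: integrable_fiber[where B = 1])
    also have "\<dots> \<le> (\<integral>x. \<bar>\<phi> x * \<psi> (orb k \<omega> x) - h x\<bar> \<partial>\<mu> \<omega>)" by (rule integral_abs_bound)
    also have "\<dots> \<le> (\<integral>x. l * K ^ k * dist \<omega> \<omega>' \<partial>\<mu> \<omega>)"
    proof (rule integral_mono)
      show "integrable (\<mu> \<omega>) (\<lambda>x. \<bar>\<phi> x * \<psi> (orb k \<omega> x) - h x\<bar>)"
        using prod_unit[OF \<phi> \<psi>] h_unit lipschitz_borel_measurable[OF h_lip]
        by (intro integrable_abs Bochner_Integration.integrable_diff) (auto intro!: integrable_fiber[where B = 1])
      fix x
      have "\<bar>\<phi> x * \<psi> (orb k \<omega> x) - h x\<bar> = \<phi> x * \<bar>\<psi> (orb k \<omega> x) - \<psi> (orb k \<omega>' x)\<bar>"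
        using unit_lipschitzD(3)[OF \<phi>, of x] by (simp add: h_def right_diff_distrib[symmetric] abs_mult)
      also have "\<dots> \<le> 1 * (l * dist (orb k \<omega> x) (orb k \<omega>' x))"
        using unit_lipschitzD(3,4)[OF \<phi>, of x] lipschitz_onD[OF unit_lipschitzD(1)[OF \<psi>], of "orb k \<omega> x" "orb k \<omega>' x"]
        by (intro mult_mono) (auto simp: dist_real_def)
      also have "\<dots> \<le> 1 * (l * (K ^ k * dist \<omega> \<omega>'))"
        using dist_orb_le[of k \<omega> x \<omega>' x] l by (intro mult_left_mono) (auto simp: dist_Pair_Pair)
      finally show "\<bar>\<phi> x * \<psi> (orb k \<omega> x) - h x\<bar> \<le> l * K ^ k * dist \<omega> \<omega>'" by (simp add: mult.assoc)
    qed simp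
    finally have 1: "\<bar>corr \<phi> \<psi> 0 k \<omega> - (\<integral>x. h x \<partial>\<mu> \<omega>)\<bar> \<le> l * K ^ k * dist \<omega> \<omega>'"
      using M.prob_space by simp
    have "\<bar>(\<integral>x. h x \<partial>\<mu> \<omega>) - (\<integral>x. h x \<partial>\<mu> \<omega>')\<bar> \<le> C\<^sub>1 * lip_norm h * dist \<omega> \<omega>'"
      using h_lip by (intro dependence) (auto simp: is_lipschitz_def)
    also have "\<dots> \<le> C\<^sub>1 * (1 + l + l * K ^ k) * dist \<omega> \<omega>'"
      using lip_norm_bounds(2)[OF h_lip h_unit] constants
      by (intro mult_right_mono mult_left_mono) auto
    finally have 2: "\<bar>(\<integral>x. h x \<partial>\<mu> \<omega>) - (\<integral>x. h x \<partial>\<mu> \<omega>')\<bar> \<le> C\<^sub>1 * (1 + l + l * K ^ k) * dist \<omega> \<omega>'" .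
    have "(\<integral>x. h x \<partial>\<mu> \<omega>') = corr \<phi> \<psi> 0 k \<omega>'" by (simp add: h_def corr_def)
    with 1 2 show "dist (corr \<phi> \<psi> 0 k \<omega>) (corr \<phi> \<psi> 0 k \<omega>')
        \<le> (l * K ^ k + C\<^sub>1 * (1 + l + l * K ^ k)) * dist \<omega> \<omega>'"
      by (simp add: dist_real_def distrib_right)
  qed (use constants l K in simp)
  then show ?thesis using corr_bounds[OF \<phi> \<psi>] by (auto simp: unit_lipschitz_def)
qed

lemma corr_far:
  assumes \<phi>: "unit_lipschitz l \<phi>" and \<psi>: "unit_lipschitz l \<psi>" and "L \<le> k"
  shows "\<bar>corr \<phi> \<psi> 0 k \<omega> - (\<integral>x. \<phi> x \<partial>\<mu> \<omega>) * (\<integral>x. \<psi> x \<partial>\<mu> ((\<theta> ^^ k) \<omega>))\<bar> \<le> fiber_error l L"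
proof -
  have l: "0 \<le> l" using unit_lipschitzD(6)[OF \<phi>] .
  have "\<bar>corr \<phi> \<psi> 0 k \<omega> - (\<integral>x. \<phi> x \<partial>\<mu> \<omega>) * (\<integral>x. \<psi> x \<partial>\<mu> ((\<theta> ^^ k) \<omega>))\<bar>
      \<le> C\<^sub>3 * exp (- (real k powr c\<^sub>3)) * lip_norm \<phi> * lip_norm \<psi>"
    using fiber_mixing[OF unit_lipschitzD(2)[OF \<phi>] unit_lipschitzD(2)[OF \<psi>], where n = k and \<omega> = \<omega>] by (simp add: corr_def)
  also have "\<dots> \<le> C\<^sub>3 * exp (- (real L powr c\<^sub>3)) * (1 + l) * (1 + l)"
    using unit_lipschitzD(8,9)[OF \<phi>] unit_lipschitzD(8,9)[OF \<psi>] constants \<open>L \<le> k\<close> l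
    by (intro mult_mono) (auto intro!: powr_mono2 mult_nonneg_nonneg)
  finally show ?thesis by (simp add: fiber_error_def power2_eq_square mult.assoc)
qed

text \<open>
  For a time difference of at least \<open>L\<close> the factors are the fiber means of the two observables. For a shorter
  one the first factor is the correlation itself, seen from the earlier time, and the second factor is 1. The
  Lipschitz constant \<open>growth l L - 1\<close> leaves room for the supremum norm, which is at most 1.
\<close>

lemma corr_product_approx:
  assumes \<phi>: "unit_lipschitz l \<phi>" and \<psi>: "unit_lipschitz l \<psi>"
  shows "\<exists>f g. unit_lipschitz (growth l L - 1) f \<and> unit_lipschitz (growth l L - 1) g \<and>
    (AE \<omega> in P. \<bar>corr \<phi> \<psi> i j \<omega> - f ((\<theta> ^^ min i j) \<omega>) * g ((\<theta> ^^ max i j) \<omega>)\<bar> \<le> fiber_error l L)"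
proof -
  have mono: "unit_lipschitz b f" if "unit_lipschitz a f" "a \<le> b" for a b and f :: "'w \<Rightarrow> real"
    using that by (auto simp: unit_lipschitz_def intro: lipschitz_on_le)
  have main: "\<exists>f g. unit_lipschitz (growth l L - 1) f \<and> unit_lipschitz (growth l L - 1) g \<and>
    (AE \<omega> in P. \<bar>corr \<phi> \<psi> i j \<omega> - f ((\<theta> ^^ i) \<omega>) * g ((\<theta> ^^ j) \<omega>)\<bar> \<le> fiber_error l L)"
    if ij: "i \<le> j" and \<phi>: "unit_lipschitz l \<phi>" and \<psi>: "unit_lipschitz l \<psi>" for i j and \<phi> \<psi> :: "'x \<Rightarrow> real"
  proof -
    define k where "k = j - i"
    have l: "0 \<le> l" using unit_lipschitzD(6)[OF \<phi>] .
    have ae: "AE \<omega> in P. corr \<phi> \<psi> i j \<omega> = corr \<phi> \<psi> 0 k ((\<theta> ^^ i) \<omega>)"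
      using corr_equivariant[OF \<phi> \<psi> inverse_base_iterate_measurable[of i], of 0 k] ij by (simp add: k_def)
    have KL: "0 \<le> K ^ L" using constants by simp
    show ?thesis
    proof (cases "L \<le> k")
      case True
      have step: "(\<theta> ^^ k) ((\<theta> ^^ i) \<omega>) = (\<theta> ^^ j) \<omega>" for \<omega>
        using funpow_add[of k i \<theta>] ij by (simp add: k_def)
      have g: "C\<^sub>1 * (1 + l) \<le> growth l L - 1"
        unfolding growth_def using constants l KL by (simp add: algebra_simps)
      have "AE \<omega> in P. \<bar>corr \<phi> \<psi> i j \<omega> - (\<integral>x. \<phi> x \<partial>\<mu> ((\<theta> ^^ i) \<omega>)) * (\<integral>x. \<psi> x \<partial>\<mu> ((\<theta> ^^ j) \<omega>))\<bar>
          \<le> fiber_error l L"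
        using ae by eventually_elim (use corr_far[OF \<phi> \<psi> True] in \<open>simp add: step[symmetric]\<close>)
      then show ?thesis
        using mono[OF fiber_mean_lipschitz[OF \<phi>] g] mono[OF fiber_mean_lipschitz[OF \<psi>] g] by blast
    next
      case False
      then have "K ^ k \<le> K ^ L" using constants by (intro power_increasing) auto
      then have g: "l * K ^ k + C\<^sub>1 * (1 + l + l * K ^ k) \<le> growth l L - 1"
        unfolding growth_def using constants l by (auto intro!: add_mono mult_left_mono)
      have g0: "0 \<le> growth l L - 1"
        unfolding growth_def using constants l KL by simp
      have "AE \<omega> in P. \<bar>corr \<phi> \<psi> i j \<omega> - corr \<phi> \<psi> 0 k ((\<theta> ^^ i) \<omega>) * (\<lambda>_. 1) ((\<theta> ^^ j) \<omega>)\<bar> \<le> fiber_error l L"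
        using ae by eventually_elim (simp add: fiber_error_nonneg)
      then show ?thesis
        using mono[OF corr_lipschitz[OF \<phi> \<psi>] g] unit_lipschitz_1[OF g0] by blast
    qed
  qed
  show ?thesis
  proof (cases "i \<le> j")
    case True
    then show ?thesis using main[OF True \<phi> \<psi>] by (simp add: min_def max_def)
  next
    case False
    then show ?thesis using main[of j i, OF _ \<psi> \<phi>] by (simp add: min_def max_def corr_commute[of \<phi>])
  qed
qed

text \<open>
  The 4-mixing hypothesis has the first time at 0; invariance of \<open>P\<close> moves it to \<open>a\<close>.
\<close>

lemma base_mixing_shifted:
  assumes f: "unit_lipschitz m f\<^sub>1" "unit_lipschitz m f\<^sub>2" "unit_lipschitz m g\<^sub>1" "unit_lipschitz m g\<^sub>2"
    and order: "a \<le> b" "b + n \<le> c" "c \<le> d"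
  shows "\<bar>(\<integral>\<omega>. (f\<^sub>1 ((\<theta> ^^ a) \<omega>) * f\<^sub>2 ((\<theta> ^^ b) \<omega>)) * (g\<^sub>1 ((\<theta> ^^ c) \<omega>) * g\<^sub>2 ((\<theta> ^^ d) \<omega>)) \<partial>P)
      - (\<integral>\<omega>. f\<^sub>1 ((\<theta> ^^ a) \<omega>) * f\<^sub>2 ((\<theta> ^^ b) \<omega>) \<partial>P) * (\<integral>\<omega>. g\<^sub>1 ((\<theta> ^^ c) \<omega>) * g\<^sub>2 ((\<theta> ^^ d) \<omega>) \<partial>P)\<bar>
    \<le> C\<^sub>2 * exp (- (real n powr c\<^sub>2)) * (1 + m) ^ 4"
proof -
  have meas: "f\<^sub>1 \<in> borel_measurable P" "f\<^sub>2 \<in> borel_measurable P"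
    "g\<^sub>1 \<in> borel_measurable P" "g\<^sub>2 \<in> borel_measurable P"
    using unit_lipschitzD(7)[OF f(1)] unit_lipschitzD(7)[OF f(2)] unit_lipschitzD(7)[OF f(3)]
      unit_lipschitzD(7)[OF f(4)] sets_base by (simp_all cong: measurable_cong_sets)
  note [measurable] = meas
  have split: "(\<theta> ^^ (q - p)) ((\<theta> ^^ p) \<omega>) = (\<theta> ^^ q) \<omega>" if "p \<le> q" for p q \<omega>
    using funpow_add[of "q - p" p \<theta>] that by simp
  have i1: "(\<integral>\<omega>. (f\<^sub>1 ((\<theta> ^^ a) \<omega>) * f\<^sub>2 ((\<theta> ^^ b) \<omega>)) * (g\<^sub>1 ((\<theta> ^^ c) \<omega>) * g\<^sub>2 ((\<theta> ^^ d) \<omega>)) \<partial>P)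
    = (\<integral>\<omega>. f\<^sub>1 \<omega> * f\<^sub>2 ((\<theta> ^^ (b - a)) \<omega>) * g\<^sub>1 ((\<theta> ^^ (c - a)) \<omega>) * g\<^sub>2 ((\<theta> ^^ (d - a)) \<omega>) \<partial>P)"
    using order by (subst integral_base_iterate[symmetric, of _ a]) (simp_all add: split mult.assoc)
  have i2: "(\<integral>\<omega>. f\<^sub>1 ((\<theta> ^^ a) \<omega>) * f\<^sub>2 ((\<theta> ^^ b) \<omega>) \<partial>P) = (\<integral>\<omega>. f\<^sub>1 \<omega> * f\<^sub>2 ((\<theta> ^^ (b - a)) \<omega>) \<partial>P)"
    using order by (subst integral_base_iterate[symmetric, of _ a]) (simp_all add: split)
  have i3: "(\<integral>\<omega>. g\<^sub>1 ((\<theta> ^^ c) \<omega>) * g\<^sub>2 ((\<theta> ^^ d) \<omega>) \<partial>P) = (\<integral>\<omega>. g\<^sub>1 \<omega> * g\<^sub>2 ((\<theta> ^^ (d - c)) \<omega>) \<partial>P)"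
    using order by (subst integral_base_iterate[symmetric, of _ c]) (simp_all add: split)
  have "d - a - (c - a) = d - c" using order by simp
  then have "\<bar>(\<integral>\<omega>. (f\<^sub>1 ((\<theta> ^^ a) \<omega>) * f\<^sub>2 ((\<theta> ^^ b) \<omega>)) * (g\<^sub>1 ((\<theta> ^^ c) \<omega>) * g\<^sub>2 ((\<theta> ^^ d) \<omega>)) \<partial>P)
      - (\<integral>\<omega>. f\<^sub>1 ((\<theta> ^^ a) \<omega>) * f\<^sub>2 ((\<theta> ^^ b) \<omega>) \<partial>P) * (\<integral>\<omega>. g\<^sub>1 ((\<theta> ^^ c) \<omega>) * g\<^sub>2 ((\<theta> ^^ d) \<omega>) \<partial>P)\<bar>
    \<le> C\<^sub>2 * exp (- (real n powr c\<^sub>2)) * lip_norm f\<^sub>1 * lip_norm f\<^sub>2 * lip_norm g\<^sub>1 * lip_norm g\<^sub>2"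
    unfolding i1 i2 i3
    using base_mixing[OF unit_lipschitzD(2)[OF f(1)] unit_lipschitzD(2)[OF f(2)] unit_lipschitzD(2)[OF f(3)]
      unit_lipschitzD(2)[OF f(4)], of "b - a" "c - a" "d - a" n] order by simp
  also have "\<dots> \<le> C\<^sub>2 * exp (- (real n powr c\<^sub>2)) * (1 + m) * (1 + m) * (1 + m) * (1 + m)"
    using unit_lipschitzD(6,8,9)[OF f(1)] unit_lipschitzD(8,9)[OF f(2)] unit_lipschitzD(8,9)[OF f(3)]
      unit_lipschitzD(8,9)[OF f(4)] constants
    by (intro mult_mono) auto
  finally show ?thesis by (simp add: power4_eq_xxxx mult.assoc)
qed

definition decoupling_error :: "real \<Rightarrow> nat \<Rightarrow> nat \<Rightarrow> real" where
  "decoupling_error l L n = 4 * fiber_error l L + C\<^sub>2 * exp (- (real n powr c\<^sub>2)) * growth l L ^ 4"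

text \<open>
  Both correlations are nearly products of two Lipschitz functions of the base point, which makes four
  Lipschitz functions in all, at times that split into two groups at distance at least \<open>n\<close>. This is the
  situation of 4-mixing.
\<close>

lemma decoupling:
  assumes obs: "unit_lipschitz l \<phi>" "unit_lipschitz l \<psi>" "unit_lipschitz l \<phi>'" "unit_lipschitz l \<psi>'"
    and order: "max i j + n \<le> min i' j'"
  shows "\<bar>(\<integral>\<omega>. corr \<phi> \<psi> i j \<omega> * corr \<phi>' \<psi>' i' j' \<omega> \<partial>P) - mean_corr \<phi> \<psi> i j * mean_corr \<phi>' \<psi>' i' j'\<bar>
    \<le> decoupling_error l L n"
proof -
  obtain f g where fg: "unit_lipschitz (growth l L - 1) f" "unit_lipschitz (growth l L - 1) g"
    "AE \<omega> in P. \<bar>corr \<phi> \<psi> i j \<omega> - f ((\<theta> ^^ min i j) \<omega>) * g ((\<theta> ^^ max i j) \<omega>)\<bar> \<le> fiber_error l L"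
    using corr_product_approx[OF obs(1,2)] by blast
  obtain f' g' where fg': "unit_lipschitz (growth l L - 1) f'" "unit_lipschitz (growth l L - 1) g'"
    "AE \<omega> in P. \<bar>corr \<phi>' \<psi>' i' j' \<omega> - f' ((\<theta> ^^ min i' j') \<omega>) * g' ((\<theta> ^^ max i' j') \<omega>)\<bar> \<le> fiber_error l L"
    using corr_product_approx[OF obs(3,4)] by blast
  have meas: "f \<in> borel_measurable P" "g \<in> borel_measurable P"
    "f' \<in> borel_measurable P" "g' \<in> borel_measurable P"
    using unit_lipschitzD(7)[OF fg(1)] unit_lipschitzD(7)[OF fg(2)] unit_lipschitzD(7)[OF fg'(1)]
      unit_lipschitzD(7)[OF fg'(2)] sets_base by (simp_all cong: measurable_cong_sets)
  note [measurable] = meas measurable_corr[OF obs(1,2)] measurable_corr[OF obs(3,4)]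
  have unit: "\<bar>f a * g b\<bar> \<le> 1" "\<bar>f' a * g' b\<bar> \<le> 1" for a b
    using prod_unit(3)[of "growth l L - 1"] fg fg' 
    by (auto simp: abs_mult unit_lipschitzD intro!: mult_le_one)
  show ?thesis
    unfolding mean_corr_def decoupling_error_def
    using base_mixing_shifted[OF fg(1,2) fg'(1,2), of "min i j" "max i j" n "min i' j'" "max i' j'"] order
    by (intro P.covariance_perturbation[OF _ _ _ _ corr_bounds(3)[OF obs(1,2)] corr_bounds(3)[OF obs(3,4)] unit fg(3) fg'(3)])
      auto
qed

text \<open>
  In contrast to \<open>decoupling_error\<close> there is no power of \<open>K\<close>. This is crucial: the available time
  difference is only \<open>L\<close>, and \<open>K ^ L\<close> would outweigh \<open>exp (- (L powr c\<^sub>2))\<close> for \<open>c\<^sub>2 < 1\<close> and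
  \<open>K > 1\<close>.
\<close>

definition decay_error :: "real \<Rightarrow> nat \<Rightarrow> real" where
  "decay_error l L = fiber_error l L + C\<^sub>2 * exp (- (real L powr c\<^sub>2)) * (1 + C\<^sub>1 * (1 + l)) ^ 4"

lemma decay_error_nonneg: "0 \<le> decay_error l L"
  using constants by (simp add: decay_error_def fiber_error_nonneg)

text \<open>
  Mixing along the fibers separates the two observables on each fiber, and mixing of the base then
  separates the two fiber means.
\<close>

lemma mean_corr_far:
  assumes \<phi>: "unit_lipschitz l \<phi>" and \<psi>: "unit_lipschitz l \<psi>" and "i + L \<le> j"
  shows "\<bar>mean_corr \<phi> \<psi> i j - mean \<phi> * mean \<psi>\<bar> \<le> decay_error l L"
proof -
  define k where "k = j - i"
  have k: "L \<le> k" "mean_corr \<phi> \<psi> i j = mean_corr \<phi> \<psi> 0 k"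
    using mean_corr_shift[OF \<phi> \<psi>, of i 0 k] assms(3) by (simp_all add: k_def)
  let ?F = "\<lambda>\<omega>. \<integral>x. \<phi> x \<partial>\<mu> \<omega>" and ?G = "\<lambda>\<omega>. \<integral>x. \<psi> x \<partial>\<mu> \<omega>"
  note F = fiber_mean_lipschitz[OF \<phi>] and G = fiber_mean_lipschitz[OF \<psi>]
  have one: "unit_lipschitz l (\<lambda>_. 1)" and one': "unit_lipschitz (C\<^sub>1 * (1 + l)) (\<lambda>_::'w. 1)"
    using unit_lipschitz_1 unit_lipschitzD(6)[OF \<phi>] unit_lipschitzD(6)[OF F] by blast+
  have meas[measurable]: "?F \<in> borel_measurable P" "?G \<in> borel_measurable P"
    using unit_lipschitzD(7)[OF F] unit_lipschitzD(7)[OF G] sets_base by (simp_all cong: measurable_cong_sets)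
  have means: "(\<integral>\<omega>. ?F \<omega> \<partial>P) = mean \<phi>" "(\<integral>\<omega>. ?G ((\<theta> ^^ k) \<omega>) \<partial>P) = mean \<psi>"
    using mean_eq_mean_corr[OF \<phi>, of 0] mean_eq_mean_corr[OF \<psi>, of 0] integral_base_iterate[OF meas(2)]
    by (simp_all add: mean_corr_def corr_def)
  have FG: "\<bar>?F \<omega> * ?G \<omega>'\<bar> \<le> 1" for \<omega> \<omega>'
    using unit_lipschitzD(3,4)[OF F] unit_lipschitzD(3,4)[OF G] by (auto simp: abs_mult intro!: mult_le_one)
  have "\<bar>mean_corr \<phi> \<psi> 0 k - (\<integral>\<omega>. ?F \<omega> * ?G ((\<theta> ^^ k) \<omega>) \<partial>P)\<bar>
      = \<bar>\<integral>\<omega>. corr \<phi> \<psi> 0 k \<omega> - ?F \<omega> * ?G ((\<theta> ^^ k) \<omega>) \<partial>P\<bar>"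
    unfolding mean_corr_def using FG corr_bounds(3)[OF \<phi> \<psi>] measurable_corr[OF \<phi> \<psi>]
    by (subst Bochner_Integration.integral_diff) (auto intro!: P.integrable_const_bound[where B = 1])
  also have "\<dots> \<le> (\<integral>\<omega>. \<bar>corr \<phi> \<psi> 0 k \<omega> - ?F \<omega> * ?G ((\<theta> ^^ k) \<omega>)\<bar> \<partial>P)" by (rule integral_abs_bound)
  also have "\<dots> \<le> (\<integral>\<omega>. fiber_error l L \<partial>P)"
    using FG corr_bounds(3)[OF \<phi> \<psi>] measurable_corr[OF \<phi> \<psi>] corr_far[OF \<phi> \<psi> k(1)]
    by (intro integral_mono integrable_abs Bochner_Integration.integrable_diff)
      (auto intro!: P.integrable_const_bound[where B = 1])
  finally have 1: "\<bar>mean_corr \<phi> \<psi> 0 k - (\<integral>\<omega>. ?F \<omega> * ?G ((\<theta> ^^ k) \<omega>) \<partial>P)\<bar> \<le> fiber_error l L"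
    using P.prob_space by simp
  have "\<bar>(\<integral>\<omega>. ?F \<omega> * ?G ((\<theta> ^^ k) \<omega>) \<partial>P) - mean \<phi> * mean \<psi>\<bar>
      \<le> C\<^sub>2 * exp (- (real L powr c\<^sub>2)) * (1 + C\<^sub>1 * (1 + l)) ^ 4"
    using base_mixing_shifted[OF F one' G one', of 0 0 L k k] k(1) means by simp
  with 1 show ?thesis unfolding k(2) decay_error_def by linarith
qed

end

section \<open>The second moment of the number of encounters\<close>

lemma sq_add_le_weighted:
  fixes A X \<kappa> :: real
  assumes "0 < \<kappa>"
  shows "(A + X)\<^sup>2 \<le> (1 + \<kappa>) * A\<^sup>2 + (1 + 1 / \<kappa>) * X\<^sup>2"
proof -
  \<comment> \<open>Expanding this square gives the weighted inequality \<open>2 * A * X \<le> \<kappa> * A\<^sup>2 + X\<^sup>2 / \<kappa>\<close>.\<close>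
  have "0 \<le> (\<kappa> * A - X)\<^sup>2 / \<kappa>" using assms by simp
  also have "\<dots> = \<kappa> * A\<^sup>2 - 2 * A * X + X\<^sup>2 / \<kappa>"
    using assms by (simp add: power2_diff power_mult_distrib field_simps power2_eq_square)
  finally show ?thesis using assms by (simp add: power2_sum algebra_simps)
qed

lemma card_near_le: "card {j \<in> {..<u}. i < j + L \<and> j < i + L} \<le> 2 * (L :: nat)"
proof -
  have "card {j \<in> {..<u}. i < j + L \<and> j < i + L} \<le> card {i + 1 - L..<i + L}"
    by (intro card_mono) auto
  then show ?thesis by simp
qed

context lipschitz_mixing_rds
begin

context
  fixes I :: "nat set" and \<rho> :: "nat \<Rightarrow> 'x \<Rightarrow> real" and u v L :: nat
begin

definition visits :: "nat \<Rightarrow> nat \<Rightarrow> 'w \<Rightarrow> 'x \<Rightarrow> real" where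
  "visits s p \<omega> x = (\<Sum>i\<in>{s..<s + u}. \<rho> p (orb i \<omega> x))"

text \<open>
  The lower bound for this sum in terms of the correlation integral is
  \<open>correlation_integral_le_sum_bump\<close>. The mean number of encounters is about \<open>(real u)\<^sup>2 * energy\<close>.
\<close>

definition energy :: real where
  "energy = (\<Sum>p\<in>I. (mean (\<rho> p))\<^sup>2)"

definition pair_visits :: "nat \<Rightarrow> nat \<Rightarrow> nat \<Rightarrow> 'w \<Rightarrow> real" where
  "pair_visits p q s \<omega> = (\<Sum>i\<in>{s..<s + u}. \<Sum>j\<in>{s..<s + u}. corr (\<rho> p) (\<rho> q) i j \<omega>)"

definition mean_visits :: "nat \<Rightarrow> nat \<Rightarrow> 'w \<Rightarrow> real" where
  "mean_visits p s \<omega> = (\<Sum>i\<in>{s..<s + u}. corr (\<rho> p) (\<lambda>_. 1) i i \<omega>)"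

text \<open>
  The right-hand side of \<open>second_moment_product\<close> for the measure \<open>\<mu> \<omega>\<close> and the weighted number of
  encounters between the blocks starting at 0 and at \<open>v\<close>, with the approximate mean \<open>c\<close> as centre.
\<close>

definition miss_bound :: "'w \<Rightarrow> real" where
  "miss_bound \<omega> = (let c = (real u)\<^sup>2 * energy in
    ((\<Sum>p\<in>I. \<Sum>q\<in>I. pair_visits p q 0 \<omega> * pair_visits p q v \<omega>)
      - 2 * c * (\<Sum>p\<in>I. mean_visits p 0 \<omega> * mean_visits p v \<omega>) + c\<^sup>2) / c\<^sup>2)"

definition mean_pair_visits :: "nat \<Rightarrow> nat \<Rightarrow> real" where
  "mean_pair_visits p q = (\<Sum>i<u. \<Sum>j<u. mean_corr (\<rho> p) (\<rho> q) i j)"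

text \<open>
  The part of \<open>mean_pair_visits\<close> on which the two observables are not yet decorrelated.
\<close>

definition near :: "nat \<Rightarrow> nat \<Rightarrow> real" where
  "near p q = (\<Sum>i<u. \<Sum>j<u. if i < j + L \<and> j < i + L then mean_corr (\<rho> p) (\<rho> q) i j else 0)"

context
  fixes l C :: real
  assumes fin: "finite I" and \<rho>: "\<And>p. unit_lipschitz l (\<rho> p)"
    and mult: "\<And>x. (\<Sum>p\<in>I. \<rho> p x) \<le> C"
    and u: "0 < u" and gap: "2 * u \<le> v"
begin

lemma l_nonneg: "0 \<le> l" using unit_lipschitzD(6)[OF \<rho>] .

lemmas one_obs = unit_lipschitz_1[OF l_nonneg]

lemma \<rho>_meas[measurable]: "\<rho> p \<in> borel_measurable borel" by (rule unit_lipschitzD(7)[OF \<rho>])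

lemma C_nonneg: "0 \<le> C"
proof -
  have "0 \<le> (\<Sum>p\<in>I. \<rho> p undefined)" using unit_lipschitzD(3)[OF \<rho>] by (intro sum_nonneg)
  then show ?thesis using mult[of undefined] by simp
qed

lemma visits_measurable[measurable]: "visits s p \<omega> \<in> borel_measurable borel"
  unfolding visits_def[abs_def] by measurable

lemma fiber_integral_visits:
  "(\<integral>x. visits s p \<omega> x \<partial>\<mu> \<omega>) = mean_visits p s \<omega>"
  "(\<integral>x. visits s p \<omega> x * visits s q \<omega> x \<partial>\<mu> \<omega>) = pair_visits p q s \<omega>"
proof -
  have i1: "integrable (\<mu> \<omega>) (\<lambda>x. \<rho> p (orb i \<omega> x))" for i
    using unit_lipschitzD(5)[OF \<rho>] by (intro integrable_fiber[where B = 1]) auto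
  then show "(\<integral>x. visits s p \<omega> x \<partial>\<mu> \<omega>) = mean_visits p s \<omega>"
    unfolding visits_def mean_visits_def corr_def by (subst Bochner_Integration.integral_sum) auto
  have i2: "integrable (\<mu> \<omega>) (\<lambda>x. \<rho> p (orb i \<omega> x) * \<rho> q (orb j \<omega> x))" for i j
    using prod_unit(3)[OF \<rho> \<rho>] by (intro integrable_fiber[where B = 1]) auto
  then show "(\<integral>x. visits s p \<omega> x * visits s q \<omega> x \<partial>\<mu> \<omega>) = pair_visits p q s \<omega>"
    unfolding visits_def pair_visits_def corr_def sum_product
    by (simp add: Bochner_Integration.integral_sum Bochner_Integration.integrable_sum)
qed

lemma miss_probability_le:
  assumes "0 < energy"
  shows "measure (\<mu> \<omega> \<Otimes>\<^sub>M \<mu> \<omega>)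
      {z. (\<Sum>p\<in>I. visits 0 p \<omega> (fst z) * visits v p \<omega> (snd z)) = 0} \<le> miss_bound \<omega>"
proof -
  interpret M: prob_space "\<mu> \<omega>" by (rule prob_space_fiber)
  have c: "0 < (real u)\<^sup>2 * energy" using assms u by simp
  have bdd: "\<bar>visits s p \<omega> x\<bar> \<le> real u" for s p x
  proof -
    have "\<bar>visits s p \<omega> x\<bar> \<le> (\<Sum>i\<in>{s..<s + u}. \<bar>\<rho> p (orb i \<omega> x)\<bar>)"
      unfolding visits_def by (rule sum_abs)
    also have "\<dots> \<le> (\<Sum>i\<in>{s..<s + u}. 1)" using unit_lipschitzD(5)[OF \<rho>] by (intro sum_mono)
    finally show ?thesis by simp
  qed
  show ?thesis
    using M.second_moment_product[OF fin c, of "\<lambda>p. visits 0 p \<omega>" "\<lambda>p. visits v p \<omega>" "real u"] bdd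
    by (simp add: space_pair_measure miss_bound_def Let_def fiber_integral_visits)
qed

abbreviation m :: "nat \<Rightarrow> real" where "m p \<equiv> mean (\<rho> p)"

lemma mean_bounds: "0 \<le> m p" "m p \<le> 1"
  using mean_corr_bounds[OF \<rho> one_obs] mean_eq_mean_corr[OF \<rho>] by metis+

lemma mean_corr_le_mean: "mean_corr (\<rho> p) (\<rho> q) i j \<le> m p"
proof -
  have "mean_corr (\<rho> p) (\<rho> q) i j \<le> mean_corr (\<rho> p) (\<lambda>_. 1) i i"
    unfolding mean_corr_eq[OF \<rho> \<rho>] mean_corr_eq[OF \<rho> one_obs]
    using prod_unit(3)[OF \<rho> \<rho>] prod_unit(3)[OF \<rho> one_obs] unit_lipschitzD(3,4)[OF \<rho>]
      measurable_orb_prod[OF \<rho> \<rho>] measurable_orb_prod[OF \<rho> one_obs]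
    by (intro integral_mono \<nu>.integrable_const_bound[where B = 1]) (auto intro: mult_left_le)
  then show ?thesis using mean_eq_mean_corr[OF \<rho>] by metis
qed

lemma sum_mean_corr_le: "(\<Sum>q\<in>I. mean_corr (\<rho> p) (\<rho> q) i j) \<le> C * m p"
proof -
  have int: "integrable \<nu> (\<lambda>z. \<rho> p (orb i (fst z) (snd z)) * \<rho> q (orb j (fst z) (snd z)))" for q
    using prod_unit(3)[OF \<rho> \<rho>] measurable_orb_prod[OF \<rho> \<rho>]
    by (intro \<nu>.integrable_const_bound[where B = 1]) auto
  have int1: "integrable \<nu> (\<lambda>z. \<rho> p (orb i (fst z) (snd z)) * 1)"
    using prod_unit(3)[OF \<rho> one_obs] measurable_orb_prod[OF \<rho> one_obs]
    by (intro \<nu>.integrable_const_bound[where B = 1]) auto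
  have "(\<Sum>q\<in>I. mean_corr (\<rho> p) (\<rho> q) i j)
      = (\<integral>z. (\<Sum>q\<in>I. \<rho> p (orb i (fst z) (snd z)) * \<rho> q (orb j (fst z) (snd z))) \<partial>\<nu>)"
    unfolding mean_corr_eq[OF \<rho> \<rho>] using int by (simp add: Bochner_Integration.integral_sum)
  also have "\<dots> \<le> (\<integral>z. C * (\<rho> p (orb i (fst z) (snd z)) * 1) \<partial>\<nu>)"
  proof (rule integral_mono)
    fix z
    show "(\<Sum>q\<in>I. \<rho> p (orb i (fst z) (snd z)) * \<rho> q (orb j (fst z) (snd z)))
        \<le> C * (\<rho> p (orb i (fst z) (snd z)) * 1)"
      unfolding sum_distrib_left[symmetric]
      using mult_left_mono[OF mult[of "orb j (fst z) (snd z)"] unit_lipschitzD(3)[OF \<rho>, of p "orb i (fst z) (snd z)"]]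
      by (simp add: mult.commute[of C])
  qed (use int int1 in auto)
  also have "\<dots> = C * mean_corr (\<rho> p) (\<lambda>_. 1) i i"
    unfolding mean_corr_eq[OF \<rho> one_obs] by simp
  finally show ?thesis using mean_eq_mean_corr[OF \<rho>] by metis
qed

lemma near_nonneg: "0 \<le> near p q"
  unfolding near_def using mean_corr_bounds[OF \<rho> \<rho>] by (intro sum_nonneg) auto

lemma near_le: "near p q \<le> 2 * real L * real u * m p"
proof -
  have "near p q \<le> (\<Sum>i<u. \<Sum>j<u. if i < j + L \<and> j < i + L then m p else 0)"
    unfolding near_def using mean_corr_le_mean by (intro sum_mono) auto
  also have "\<dots> = (\<Sum>i<u. real (card {j \<in> {..<u}. i < j + L \<and> j < i + L}) * m p)"
    by (simp add: sum.inter_filter[symmetric])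
  also have "\<dots> \<le> (\<Sum>i<u. real (2 * L) * m p)"
    using card_near_le mean_bounds by (intro sum_mono mult_right_mono) (auto simp del: of_nat_mult)
  finally show ?thesis by (simp add: ac_simps)
qed

lemma sum_near_le: "(\<Sum>q\<in>I. near p q) \<le> 2 * real L * real u * (C * m p)"
proof -
  have "(\<Sum>q\<in>I. near p q)
      = (\<Sum>i<u. \<Sum>j<u. \<Sum>q\<in>I. if i < j + L \<and> j < i + L then mean_corr (\<rho> p) (\<rho> q) i j else 0)"
    unfolding near_def by (subst sum.swap) (intro sum.cong refl sum.swap)
  also have "\<dots> \<le> (\<Sum>i<u. \<Sum>j<u. if i < j + L \<and> j < i + L then C * m p else 0)"
    using sum_mean_corr_le by (intro sum_mono) auto
  also have "\<dots> = (\<Sum>i<u. real (card {j \<in> {..<u}. i < j + L \<and> j < i + L}) * (C * m p))"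
    by (simp add: sum.inter_filter[symmetric])
  also have "\<dots> \<le> (\<Sum>i<u. real (2 * L) * (C * m p))"
    using card_near_le mean_bounds C_nonneg
    by (intro sum_mono mult_right_mono) (auto simp del: of_nat_mult)
  finally show ?thesis by (simp add: ac_simps)
qed

text \<open>
  One factor of each square is bounded pointwise by \<open>near_le\<close> and the other in the mean over \<open>q\<close> by
  \<open>sum_near_le\<close>. The bound is linear in \<open>energy\<close>, whereas the square of the main term is quadratic in
  \<open>u\<^sup>2 * energy\<close>; this is what makes the variance small.
\<close>

lemma sum_near_square_le: "(\<Sum>p\<in>I. \<Sum>q\<in>I. (near p q)\<^sup>2) \<le> 4 * (real L)\<^sup>2 * (real u)\<^sup>2 * C * energy"
proof -
  have "(\<Sum>q\<in>I. (near p q)\<^sup>2) \<le> 4 * (real L)\<^sup>2 * (real u)\<^sup>2 * C * (m p)\<^sup>2" for p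
  proof -
    have "(\<Sum>q\<in>I. (near p q)\<^sup>2) \<le> (\<Sum>q\<in>I. (2 * real L * real u * m p) * near p q)"
      unfolding power2_eq_square using near_le near_nonneg by (intro sum_mono mult_right_mono)
    also have "\<dots> = (2 * real L * real u * m p) * (\<Sum>q\<in>I. near p q)" by (simp add: sum_distrib_left)
    also have "\<dots> \<le> (2 * real L * real u * m p) * (2 * real L * real u * (C * m p))"
      using sum_near_le mean_bounds by (intro mult_left_mono) auto
    finally show ?thesis by (simp add: power2_eq_square ac_simps)
  qed
  then have "(\<Sum>p\<in>I. \<Sum>q\<in>I. (near p q)\<^sup>2) \<le> (\<Sum>p\<in>I. 4 * (real L)\<^sup>2 * (real u)\<^sup>2 * C * (m p)\<^sup>2)"
    by (intro sum_mono)
  then show ?thesis by (simp add: energy_def sum_distrib_left)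
qed

lemma mean_pair_visits_nonneg: "0 \<le> mean_pair_visits p q"
  unfolding mean_pair_visits_def using mean_corr_bounds[OF \<rho> \<rho>] by (intro sum_nonneg) auto

lemma mean_pair_visits_le:
  "mean_pair_visits p q \<le> (real u)\<^sup>2 * (m p * m q) + (near p q + (real u)\<^sup>2 * decay_error l L)"
proof -
  have "mean_corr (\<rho> p) (\<rho> q) i j \<le> m p * m q + decay_error l L
      + (if i < j + L \<and> j < i + L then mean_corr (\<rho> p) (\<rho> q) i j else 0)" for i j
  proof -
    consider "i + L \<le> j" | "j + L \<le> i" | "i < j + L \<and> j < i + L" by linarith
    then show ?thesis
    proof cases
      case 1
      then show ?thesis using mean_corr_far[OF \<rho> \<rho> 1, of p q] by auto
    next
      case 2
      then show ?thesis using mean_corr_far[OF \<rho> \<rho> 2, of q p]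
        by (auto simp: mean_corr_def corr_commute[of "\<rho> q"] mult.commute)
    next
      case 3
      have "0 \<le> m p * m q + decay_error l L" using mean_bounds decay_error_nonneg by simp
      then show ?thesis using 3 by auto
    qed
  qed
  then have "mean_pair_visits p q \<le> (\<Sum>i<u. \<Sum>j<u. m p * m q + decay_error l L
      + (if i < j + L \<and> j < i + L then mean_corr (\<rho> p) (\<rho> q) i j else 0))"
    unfolding mean_pair_visits_def by (intro sum_mono)
  also have "\<dots> = (real u)\<^sup>2 * (m p * m q) + (near p q + (real u)\<^sup>2 * decay_error l L)"
    unfolding near_def by (simp add: sum.distrib power2_eq_square algebra_simps)
  finally show ?thesis .
qed

text \<open>
  The parameter \<open>\<kappa>\<close> balances the main term, whose coefficient has to be close to 1, against the
  near-diagonal term and the error.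
\<close>

lemma sum_mean_pair_visits_square_le:
  assumes \<kappa>: "0 < \<kappa>"
  shows "(\<Sum>p\<in>I. \<Sum>q\<in>I. (mean_pair_visits p q)\<^sup>2) \<le> (1 + \<kappa>) * ((real u)\<^sup>2 * energy)\<^sup>2
    + (1 + 1 / \<kappa>) * (8 * (real L)\<^sup>2 * (real u)\<^sup>2 * C * energy
        + 2 * (real (card I))\<^sup>2 * (real u) ^ 4 * (decay_error l L)\<^sup>2)"
proof -
  let ?e = "(real u)\<^sup>2 * decay_error l L"
  have "(mean_pair_visits p q)\<^sup>2 \<le> (1 + \<kappa>) * ((real u)\<^sup>2 * (m p * m q))\<^sup>2
      + (1 + 1 / \<kappa>) * (2 * (near p q)\<^sup>2 + 2 * ?e\<^sup>2)" for p q
  proof -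
    have "(mean_pair_visits p q)\<^sup>2 \<le> ((real u)\<^sup>2 * (m p * m q) + (near p q + ?e))\<^sup>2"
      using mean_pair_visits_le mean_pair_visits_nonneg by (intro power_mono)
    also have "\<dots> \<le> (1 + \<kappa>) * ((real u)\<^sup>2 * (m p * m q))\<^sup>2 + (1 + 1 / \<kappa>) * (near p q + ?e)\<^sup>2"
      using \<kappa> by (rule sq_add_le_weighted)
    also have "\<dots> \<le> (1 + \<kappa>) * ((real u)\<^sup>2 * (m p * m q))\<^sup>2 + (1 + 1 / \<kappa>) * (2 * (near p q)\<^sup>2 + 2 * ?e\<^sup>2)"
      using \<kappa> sq_add_le_weighted[of 1 "near p q" ?e] by (intro add_left_mono mult_left_mono) auto
    finally show ?thesis .
  qed
  then have "(\<Sum>p\<in>I. \<Sum>q\<in>I. (mean_pair_visits p q)\<^sup>2) \<le> (\<Sum>p\<in>I. \<Sum>q\<in>I. (1 + \<kappa>) * ((real u)\<^sup>2 * (m p * m q))\<^sup>2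
      + (1 + 1 / \<kappa>) * (2 * (near p q)\<^sup>2 + 2 * ?e\<^sup>2))"
    by (intro sum_mono)
  also have "\<dots> = (1 + \<kappa>) * (\<Sum>p\<in>I. \<Sum>q\<in>I. ((real u)\<^sup>2 * (m p * m q))\<^sup>2)
      + (1 + 1 / \<kappa>) * (2 * (\<Sum>p\<in>I. \<Sum>q\<in>I. (near p q)\<^sup>2) + 2 * ((real (card I))\<^sup>2 * ?e\<^sup>2))"
    by (simp add: sum.distrib sum_distrib_left[symmetric] power2_eq_square)
  also have "(\<Sum>p\<in>I. \<Sum>q\<in>I. ((real u)\<^sup>2 * (m p * m q))\<^sup>2) = ((real u)\<^sup>2 * energy)\<^sup>2"
    by (simp add: energy_def power_mult_distrib power2_eq_square[of "sum _ _"] sum_product sum_distrib_left[symmetric])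
  also have "(1 + 1 / \<kappa>) * (2 * (\<Sum>p\<in>I. \<Sum>q\<in>I. (near p q)\<^sup>2) + 2 * ((real (card I))\<^sup>2 * ?e\<^sup>2))
      \<le> (1 + 1 / \<kappa>) * (2 * (4 * (real L)\<^sup>2 * (real u)\<^sup>2 * C * energy) + 2 * ((real (card I))\<^sup>2 * ?e\<^sup>2))"
    using \<kappa> sum_near_square_le by (intro mult_left_mono add_right_mono) auto
  finally show ?thesis by (simp add: power_mult_distrib power_mult[symmetric] ac_simps)
qed

lemma integrable_corr_prod:
  assumes "unit_lipschitz l \<phi>" "unit_lipschitz l \<psi>" "unit_lipschitz l \<phi>'" "unit_lipschitz l \<psi>'"
  shows "integrable P (\<lambda>\<omega>. corr \<phi> \<psi> i j \<omega> * corr \<phi>' \<psi>' i' j' \<omega>)"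
  using measurable_corr[OF assms(1,2)] measurable_corr[OF assms(3,4)]
    corr_bounds[OF assms(1,2)] corr_bounds[OF assms(3,4)]
  by (intro P.integrable_const_bound[where B = 1]) (auto intro!: mult_le_one)

text \<open>
  The two blocks are decoupled, and by stationarity each contributes the same mean \<open>mean_pair_visits p q\<close>.
\<close>

lemma integral_pair_visits_prod_le:
  "integrable P (\<lambda>\<omega>. pair_visits p q 0 \<omega> * pair_visits p q v \<omega>)"
  "(\<integral>\<omega>. pair_visits p q 0 \<omega> * pair_visits p q v \<omega> \<partial>P)
    \<le> (mean_pair_visits p q)\<^sup>2 + real u ^ 4 * decoupling_error l L u"
proof -
  note int = integrable_corr_prod[OF \<rho> \<rho> \<rho> \<rho>]
  have expand: "pair_visits p q 0 \<omega> * pair_visits p q v \<omega>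
    = (\<Sum>i<u. \<Sum>i'\<in>{v..<v + u}. \<Sum>j<u. \<Sum>j'\<in>{v..<v + u}.
        corr (\<rho> p) (\<rho> q) i j \<omega> * corr (\<rho> p) (\<rho> q) i' j' \<omega>)" for \<omega>
    unfolding pair_visits_def by (simp add: sum_product lessThan_atLeast0)
  show "integrable P (\<lambda>\<omega>. pair_visits p q 0 \<omega> * pair_visits p q v \<omega>)"
    unfolding expand by (intro Bochner_Integration.integrable_sum int)
  have shift: "(\<Sum>i'\<in>{v..<v + u}. \<Sum>j'\<in>{v..<v + u}. mean_corr (\<rho> p) (\<rho> q) i' j') = mean_pair_visits p q"
    using mean_corr_shift[OF \<rho> \<rho>, of p q v]
    by (simp add: mean_pair_visits_def lessThan_atLeast0 sum.atLeastLessThan_shift_0[of _ v] add.commute)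
  have "(\<integral>\<omega>. pair_visits p q 0 \<omega> * pair_visits p q v \<omega> \<partial>P)
    = (\<Sum>i<u. \<Sum>i'\<in>{v..<v + u}. \<Sum>j<u. \<Sum>j'\<in>{v..<v + u}.
        (\<integral>\<omega>. corr (\<rho> p) (\<rho> q) i j \<omega> * corr (\<rho> p) (\<rho> q) i' j' \<omega> \<partial>P))"
    unfolding expand using int by (simp add: Bochner_Integration.integral_sum Bochner_Integration.integrable_sum)
  also have "\<dots> \<le> (\<Sum>i<u. \<Sum>i'\<in>{v..<v + u}. \<Sum>j<u. \<Sum>j'\<in>{v..<v + u}.
        mean_corr (\<rho> p) (\<rho> q) i j * mean_corr (\<rho> p) (\<rho> q) i' j' + decoupling_error l L u)"
  proof (intro sum_mono)
    fix i i' j j' assume "i \<in> {..<u}" "i' \<in> {v..<v + u}" "j \<in> {..<u}" "j' \<in> {v..<v + u}"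
    then have "max i j + u \<le> min i' j'" using gap by auto
    from decoupling[OF \<rho> \<rho> \<rho> \<rho> this, of p q p q L]
    show "(\<integral>\<omega>. corr (\<rho> p) (\<rho> q) i j \<omega> * corr (\<rho> p) (\<rho> q) i' j' \<omega> \<partial>P)
        \<le> mean_corr (\<rho> p) (\<rho> q) i j * mean_corr (\<rho> p) (\<rho> q) i' j' + decoupling_error l L u" by linarith
  qed
  also have "\<dots> = mean_pair_visits p q * mean_pair_visits p q + real u ^ 4 * decoupling_error l L u"
    by (subst (2) shift[symmetric])
      (simp add: mean_pair_visits_def sum_product sum.distrib power4_eq_xxxx ac_simps)
  finally show "(\<integral>\<omega>. pair_visits p q 0 \<omega> * pair_visits p q v \<omega> \<partial>P)
    \<le> (mean_pair_visits p q)\<^sup>2 + real u ^ 4 * decoupling_error l L u" by (simp add: power2_eq_square)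
qed

lemma integral_mean_visits_prod_ge:
  "integrable P (\<lambda>\<omega>. mean_visits p 0 \<omega> * mean_visits p v \<omega>)"
  "(real u)\<^sup>2 * (m p)\<^sup>2 - (real u)\<^sup>2 * decoupling_error l L u
    \<le> (\<integral>\<omega>. mean_visits p 0 \<omega> * mean_visits p v \<omega> \<partial>P)"
proof -
  note int = integrable_corr_prod[OF \<rho> one_obs \<rho> one_obs]
  have expand: "mean_visits p 0 \<omega> * mean_visits p v \<omega>
    = (\<Sum>i<u. \<Sum>j\<in>{v..<v + u}. corr (\<rho> p) (\<lambda>_. 1) i i \<omega> * corr (\<rho> p) (\<lambda>_. 1) j j \<omega>)" for \<omega>
    unfolding mean_visits_def by (simp add: sum_product lessThan_atLeast0)
  show "integrable P (\<lambda>\<omega>. mean_visits p 0 \<omega> * mean_visits p v \<omega>)"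
    unfolding expand by (intro Bochner_Integration.integrable_sum int)
  have "(real u)\<^sup>2 * (m p)\<^sup>2 - (real u)\<^sup>2 * decoupling_error l L u
      = (\<Sum>i<u. \<Sum>j\<in>{v..<v + u}. (m p)\<^sup>2 - decoupling_error l L u)"
    by (simp add: power2_eq_square algebra_simps)
  also have "\<dots> \<le> (\<Sum>i<u. \<Sum>j\<in>{v..<v + u}.
      (\<integral>\<omega>. corr (\<rho> p) (\<lambda>_. 1) i i \<omega> * corr (\<rho> p) (\<lambda>_. 1) j j \<omega> \<partial>P))"
  proof (intro sum_mono)
    fix i j assume "i \<in> {..<u}" "j \<in> {v..<v + u}"
    then have "max i i + u \<le> min j j" using gap by auto
    from decoupling[OF \<rho> one_obs \<rho> one_obs this, of p p L]
    show "(m p)\<^sup>2 - decoupling_error l L u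
        \<le> (\<integral>\<omega>. corr (\<rho> p) (\<lambda>_. 1) i i \<omega> * corr (\<rho> p) (\<lambda>_. 1) j j \<omega> \<partial>P)"
      by (simp add: mean_eq_mean_corr[OF \<rho>, symmetric] power2_eq_square)
  qed
  also have "\<dots> = (\<integral>\<omega>. mean_visits p 0 \<omega> * mean_visits p v \<omega> \<partial>P)"
    unfolding expand using int by (simp add: Bochner_Integration.integral_sum Bochner_Integration.integrable_sum)
  finally show "(real u)\<^sup>2 * (m p)\<^sup>2 - (real u)\<^sup>2 * decoupling_error l L u
    \<le> (\<integral>\<omega>. mean_visits p 0 \<omega> * mean_visits p v \<omega> \<partial>P)" .
qed

text \<open>
  In the numerator of \<open>miss_bound\<close> the three main terms are \<open>(1 + \<kappa>) * c\<^sup>2\<close>, \<open>- 2 * c\<^sup>2\<close> and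
  \<open>c\<^sup>2\<close>, which leaves \<open>\<kappa> * c\<^sup>2\<close>.
\<close>

lemma integral_miss_bound_le:
  assumes "0 < energy" and \<kappa>: "0 < \<kappa>"
  shows "integrable P miss_bound"
    and "(\<integral>\<omega>. miss_bound \<omega> \<partial>P) \<le> \<kappa>
      + (1 + 1 / \<kappa>) * (8 * (real L)\<^sup>2 * C / ((real u)\<^sup>2 * energy)
          + 2 * (real (card I))\<^sup>2 * (decay_error l L)\<^sup>2 / energy\<^sup>2)
      + (real (card I))\<^sup>2 * decoupling_error l L u / energy\<^sup>2
      + 2 * real (card I) * decoupling_error l L u / energy"
proof -
  define c where "c = (real u)\<^sup>2 * energy"
  have c: "0 < c" using assms(1) u by (simp add: c_def)
  let ?E = "decoupling_error l L u" and ?k = "real (card I)"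
  let ?X = "\<lambda>\<omega>. \<Sum>p\<in>I. \<Sum>q\<in>I. pair_visits p q 0 \<omega> * pair_visits p q v \<omega>"
  let ?Y = "\<lambda>\<omega>. \<Sum>p\<in>I. mean_visits p 0 \<omega> * mean_visits p v \<omega>"
  have intX: "integrable P ?X" and intY: "integrable P ?Y"
    by (intro Bochner_Integration.integrable_sum integral_pair_visits_prod_le integral_mean_visits_prod_ge)+
  have eq: "miss_bound \<omega> = (?X \<omega> - 2 * c * ?Y \<omega> + c\<^sup>2) / c\<^sup>2" for \<omega>
    by (simp add: miss_bound_def c_def Let_def)
  show "integrable P miss_bound"
    unfolding eq[abs_def] using intX intY by (intro integrable_divide Bochner_Integration.integrable_add
      Bochner_Integration.integrable_diff integrable_mult_right) auto
  have X: "(\<integral>\<omega>. ?X \<omega> \<partial>P) \<le> (\<Sum>p\<in>I. \<Sum>q\<in>I. (mean_pair_visits p q)\<^sup>2) + ?k\<^sup>2 * (real u ^ 4 * ?E)"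
  proof -
    have "(\<integral>\<omega>. ?X \<omega> \<partial>P) = (\<Sum>p\<in>I. \<Sum>q\<in>I. (\<integral>\<omega>. pair_visits p q 0 \<omega> * pair_visits p q v \<omega> \<partial>P))"
      using integral_pair_visits_prod_le(1)
      by (simp add: Bochner_Integration.integral_sum Bochner_Integration.integrable_sum)
    also have "\<dots> \<le> (\<Sum>p\<in>I. \<Sum>q\<in>I. (mean_pair_visits p q)\<^sup>2 + real u ^ 4 * ?E)"
      by (intro sum_mono integral_pair_visits_prod_le)
    finally show ?thesis by (simp add: sum.distrib power2_eq_square mult.assoc)
  qed
  have Y: "c - ?k * ((real u)\<^sup>2 * ?E) \<le> (\<integral>\<omega>. ?Y \<omega> \<partial>P)"
  proof -
    have "c - ?k * ((real u)\<^sup>2 * ?E) = (\<Sum>p\<in>I. (real u)\<^sup>2 * (m p)\<^sup>2 - (real u)\<^sup>2 * ?E)"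
      by (simp add: c_def energy_def sum_subtractf sum_distrib_left)
    also have "\<dots> \<le> (\<Sum>p\<in>I. (\<integral>\<omega>. mean_visits p 0 \<omega> * mean_visits p v \<omega> \<partial>P))"
      by (intro sum_mono integral_mean_visits_prod_ge)
    also have "\<dots> = (\<integral>\<omega>. ?Y \<omega> \<partial>P)"
      using integral_mean_visits_prod_ge(1) by (simp add: Bochner_Integration.integral_sum)
    finally show ?thesis .
  qed
  have "(\<integral>\<omega>. miss_bound \<omega> \<partial>P) = ((\<integral>\<omega>. ?X \<omega> \<partial>P) - 2 * c * (\<integral>\<omega>. ?Y \<omega> \<partial>P) + c\<^sup>2) / c\<^sup>2"
    unfolding eq using intX intY P.prob_space by simp
  also have "\<dots> \<le> (((1 + \<kappa>) * c\<^sup>2 + (1 + 1 / \<kappa>) * (8 * (real L)\<^sup>2 * (real u)\<^sup>2 * C * energy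
        + 2 * ?k\<^sup>2 * (real u) ^ 4 * (decay_error l L)\<^sup>2) + ?k\<^sup>2 * (real u ^ 4 * ?E))
      - 2 * c * (c - ?k * ((real u)\<^sup>2 * ?E)) + c\<^sup>2) / c\<^sup>2"
    using c sum_mean_pair_visits_square_le[OF \<kappa>] unfolding c_def[symmetric]
    by (intro divide_right_mono add_right_mono diff_mono order_trans[OF X] mult_left_mono[OF Y]) auto
  also have "\<dots> = \<kappa> * c\<^sup>2 / c\<^sup>2 + (1 + 1 / \<kappa>) * ((8 * (real L)\<^sup>2 * (real u)\<^sup>2 * C * energy
        + 2 * ?k\<^sup>2 * (real u) ^ 4 * (decay_error l L)\<^sup>2) / c\<^sup>2) + ?k\<^sup>2 * (real u ^ 4 * ?E) / c\<^sup>2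
      + 2 * ?k * (c * ((real u)\<^sup>2 * ?E)) / c\<^sup>2"
  proof -
    have "((1 + \<kappa>) * c\<^sup>2 + w * A + B - 2 * c * (c - ?k * D) + c\<^sup>2) / c\<^sup>2
        = \<kappa> * c\<^sup>2 / c\<^sup>2 + w * (A / c\<^sup>2) + B / c\<^sup>2 + 2 * ?k * (c * D) / c\<^sup>2" for w A B D
    proof -
      have "(1 + \<kappa>) * c\<^sup>2 + w * A + B - 2 * c * (c - ?k * D) + c\<^sup>2
          = \<kappa> * c\<^sup>2 + w * A + B + 2 * ?k * (c * D)"
        by (simp add: algebra_simps power2_eq_square)
      then show ?thesis by (simp only: add_divide_distrib times_divide_eq_right)
    qed
    then show ?thesis by blast
  qed
  also have "\<dots> = \<kappa> + (1 + 1 / \<kappa>) * (8 * (real L)\<^sup>2 * C / ((real u)\<^sup>2 * energy)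
          + 2 * ?k\<^sup>2 * (decay_error l L)\<^sup>2 / energy\<^sup>2)
      + ?k\<^sup>2 * ?E / energy\<^sup>2 + 2 * ?k * ?E / energy"
  proof -
    have u0: "real u \<noteq> 0" and e0: "energy \<noteq> 0" using u assms(1) by auto
    have "(8 * (real L)\<^sup>2 * (real u)\<^sup>2 * C * energy + 2 * ?k\<^sup>2 * (real u) ^ 4 * (decay_error l L)\<^sup>2) / c\<^sup>2
        = 8 * (real L)\<^sup>2 * C / ((real u)\<^sup>2 * energy) + 2 * ?k\<^sup>2 * (decay_error l L)\<^sup>2 / energy\<^sup>2"
      unfolding c_def using u0 e0 by (simp add: field_simps power2_eq_square power4_eq_xxxx)
    moreover have "\<kappa> * c\<^sup>2 / c\<^sup>2 = \<kappa>" using c by simp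
    moreover have "?k\<^sup>2 * (real u ^ 4 * ?E) / c\<^sup>2 = ?k\<^sup>2 * ?E / energy\<^sup>2"
      unfolding c_def using u0 e0 by (simp add: power2_eq_square power4_eq_xxxx)
    moreover have "2 * ?k * (c * ((real u)\<^sup>2 * ?E)) / c\<^sup>2 = 2 * ?k * ?E / energy"
      unfolding c_def using u0 e0 by (simp add: power2_eq_square)
    ultimately show ?thesis by simp
  qed
  finally show "(\<integral>\<omega>. miss_bound \<omega> \<partial>P) \<le> \<kappa>
      + (1 + 1 / \<kappa>) * (8 * (real L)\<^sup>2 * C / ((real u)\<^sup>2 * energy)
          + 2 * ?k\<^sup>2 * (decay_error l L)\<^sup>2 / energy\<^sup>2)
      + ?k\<^sup>2 * ?E / energy\<^sup>2 + 2 * ?k * ?E / energy" .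
qed

end

end

end

section \<open>Rapidly decreasing sequences\<close>

text \<open>
  As \<open>a\<close> ranges over all reals, multiplication by a power of \<open>n\<close> preserves this property, which
  makes polynomial factors in error terms harmless (\<open>rapid_mult\<close>).
\<close>

definition rapid :: "(nat \<Rightarrow> real) \<Rightarrow> bool" where
  "rapid f \<longleftrightarrow> (\<forall>a. f \<in> O(\<lambda>n. real n powr a))"

lemma rapid_add: "rapid f \<Longrightarrow> rapid g \<Longrightarrow> rapid (\<lambda>n. f n + g n)"
  unfolding rapid_def by (blast intro: sum_in_bigo)

lemma rapid_mult:
  assumes "rapid f" "g \<in> O(\<lambda>n. real n powr b)"
  shows "rapid (\<lambda>n. g n * f n)"
  unfolding rapid_def
proof
  fix a
  have "(\<lambda>n. g n * f n) \<in> O(\<lambda>n. real n powr b * real n powr (a - b))"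
    using assms unfolding rapid_def by (intro landau_o.big.mult) auto
  then show "(\<lambda>n. g n * f n) \<in> O(\<lambda>n. real n powr a)"
    by (simp add: powr_add[symmetric])
qed

lemma rapid_square:
  assumes "rapid f"
  shows "rapid (\<lambda>n. (f n)\<^sup>2)"
proof -
  have "rapid (\<lambda>n. f n * f n)"
    using assms rapid_mult[of f f 0] unfolding rapid_def by blast
  then show ?thesis by (simp add: power2_eq_square)
qed

lemma rapid_bound:
  assumes "rapid g" "eventually (\<lambda>n. \<bar>f n\<bar> \<le> g n) sequentially"
  shows "rapid f"
proof -
  have "f \<in> O(g)" using assms(2) by (intro bigoI[of _ 1]) (auto elim!: eventually_mono)
  then show ?thesis using assms(1) unfolding rapid_def by (blast intro: landau_o.big.trans)
qed

lemma rapid_exp: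
  assumes "0 < b" "0 < c"
  shows "rapid (\<lambda>n. exp (- (b * real n powr c)))"
  unfolding rapid_def
proof
  fix a
  show "(\<lambda>n. exp (- (b * real n powr c))) \<in> O(\<lambda>n. real n powr a)"
    using assms by real_asymp
qed

lemma nat_powr_power: "1 \<le> n \<Longrightarrow> (real n powr a) ^ k = real n powr (a * real k)"
  by (induction k) (simp_all add: powr_add[symmetric] algebra_simps)

section \<open>Choice of the scales\<close>

context lipschitz_mixing_rds
begin

text \<open>
  At scale \<open>n powr - \<beta>\<close> the bumps have Lipschitz constant \<open>l n\<close>. The separation \<open>L n\<close> is a power of
  \<open>n\<close>, which makes \<open>fiber_error\<close> decay rapidly; its exponent is at most \<open>c\<^sub>2 / 2\<close>, which keeps
  \<open>K ^ L n\<close> negligible against the mixing over a gap of length \<open>n\<close>.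
\<close>

context
  fixes \<beta> \<epsilon> :: real and L :: "nat \<Rightarrow> nat" and l :: "nat \<Rightarrow> real"
  assumes \<beta>: "0 < \<beta>" and \<epsilon>: "0 < \<epsilon>" "\<epsilon> \<le> c\<^sub>2 / 2"
  defines "L \<equiv> \<lambda>n. nat \<lceil>real n powr \<epsilon>\<rceil>" and "l \<equiv> \<lambda>n. real n powr \<beta> / 2"
begin

lemma gap_bounds: "real n powr \<epsilon> \<le> real (L n)" "real (L n) \<le> real n powr \<epsilon> + 1"
proof -
  show "real n powr \<epsilon> \<le> real (L n)" unfolding L_def by (rule real_nat_ceiling_ge)
  have "real (L n) = of_int \<lceil>real n powr \<epsilon>\<rceil>" by (simp add: L_def)
  then show "real (L n) \<le> real n powr \<epsilon> + 1" by linarith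
qed

lemma powr_ge_1: "1 \<le> n \<Longrightarrow> 0 \<le> a \<Longrightarrow> 1 \<le> real n powr a"
  by (simp add: ge_one_powr_ge_zero)

lemma exp_gap_le: "0 < c \<Longrightarrow> exp (- (real (L n) powr c)) \<le> exp (- (1 * real n powr (\<epsilon> * c)))"
  using powr_mono2[of c "real n powr \<epsilon>" "real (L n)"] gap_bounds(1)[of n] by (simp add: powr_powr)

lemma rapid_fiber_error: "rapid (\<lambda>n. fiber_error (l n) (L n))"
proof (rule rapid_bound)
  have "rapid (\<lambda>n. exp (- (1 * real n powr (\<epsilon> * c\<^sub>3))))"
    using \<epsilon> constants by (intro rapid_exp) auto
  then show "rapid (\<lambda>n. 4 * C\<^sub>3 * real n powr (2 * \<beta>) * exp (- (1 * real n powr (\<epsilon> * c\<^sub>3))))"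
    by (rule rapid_mult[of _ _ "2 * \<beta>"]) simp
  show "\<forall>\<^sub>F n in sequentially. \<bar>fiber_error (l n) (L n)\<bar>
      \<le> 4 * C\<^sub>3 * real n powr (2 * \<beta>) * exp (- (1 * real n powr (\<epsilon> * c\<^sub>3)))"
    using eventually_ge_at_top[of 1]
  proof eventually_elim
    case (elim n)
    have "1 + l n \<le> 2 * real n powr \<beta>" using powr_ge_1[OF elim, of \<beta>] \<beta> by (simp add: l_def)
    then have "(1 + l n)\<^sup>2 \<le> (2 * real n powr \<beta>)\<^sup>2" by (intro power_mono) (auto simp: l_def)
    also have "\<dots> = 4 * real n powr (2 * \<beta>)" using elim by (simp add: power_mult_distrib nat_powr_power mult.commute)
    finally have "C\<^sub>3 * exp (- (real (L n) powr c\<^sub>3)) * (1 + l n)\<^sup>2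
        \<le> C\<^sub>3 * exp (- (1 * real n powr (\<epsilon> * c\<^sub>3))) * (4 * real n powr (2 * \<beta>))"
      using exp_gap_le[of c\<^sub>3 n] constants by (intro mult_mono) auto
    then show ?case using fiber_error_nonneg[of "l n" "L n"] by (simp add: fiber_error_def ac_simps)
  qed
qed

lemma rapid_decay_error: "rapid (\<lambda>n. decay_error (l n) (L n))"
  unfolding decay_error_def
proof (intro rapid_add rapid_fiber_error, rule rapid_bound)
  have "rapid (\<lambda>n. exp (- (1 * real n powr (\<epsilon> * c\<^sub>2))))"
    using \<epsilon> constants by (intro rapid_exp) auto
  then show "rapid (\<lambda>n. C\<^sub>2 * (1 + 2 * C\<^sub>1) ^ 4 * real n powr (4 * \<beta>) * exp (- (1 * real n powr (\<epsilon> * c\<^sub>2))))"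
    by (rule rapid_mult[of _ _ "4 * \<beta>"]) simp
  show "\<forall>\<^sub>F n in sequentially. \<bar>C\<^sub>2 * exp (- (real (L n) powr c\<^sub>2)) * (1 + C\<^sub>1 * (1 + l n)) ^ 4\<bar>
      \<le> C\<^sub>2 * (1 + 2 * C\<^sub>1) ^ 4 * real n powr (4 * \<beta>) * exp (- (1 * real n powr (\<epsilon> * c\<^sub>2)))"
    using eventually_ge_at_top[of 1]
  proof eventually_elim
    case (elim n)
    have n1: "1 \<le> real n powr \<beta>" using powr_ge_1[OF elim, of \<beta>] \<beta> by simp
    have "C\<^sub>1 * (1 + l n) \<le> C\<^sub>1 * (2 * real n powr \<beta>)"
      using n1 constants by (intro mult_left_mono) (auto simp: l_def)
    then have "1 + C\<^sub>1 * (1 + l n) \<le> (1 + 2 * C\<^sub>1) * real n powr \<beta>" using n1 by (simp add: algebra_simps)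
    moreover have nn: "0 \<le> 1 + C\<^sub>1 * (1 + l n)" using constants by (simp add: l_def)
    ultimately have "(1 + C\<^sub>1 * (1 + l n)) ^ 4 \<le> ((1 + 2 * C\<^sub>1) * real n powr \<beta>) ^ 4" by (intro power_mono)
    also have "\<dots> = (1 + 2 * C\<^sub>1) ^ 4 * real n powr (4 * \<beta>)"
      using elim by (simp add: power_mult_distrib nat_powr_power mult.commute)
    finally have "C\<^sub>2 * exp (- (real (L n) powr c\<^sub>2)) * (1 + C\<^sub>1 * (1 + l n)) ^ 4
        \<le> C\<^sub>2 * exp (- (1 * real n powr (\<epsilon> * c\<^sub>2))) * ((1 + 2 * C\<^sub>1) ^ 4 * real n powr (4 * \<beta>))"
      using exp_gap_le[of c\<^sub>2 n] constants nn by (intro mult_mono) auto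
    then show ?case using constants by (simp add: ac_simps)
  qed
qed

lemma rapid_growth: "rapid (\<lambda>n. C\<^sub>2 * exp (- (real n powr c\<^sub>2)) * growth (l n) (L n) ^ 4)"
proof (rule rapid_bound)
  let ?a = "ln K"
  let ?B = "C\<^sub>2 * (2 + 3 * C\<^sub>1) ^ 4 * exp (8 * ?a\<^sup>2 + 4 * ?a)"
  have a: "0 \<le> ?a" using constants by simp
  have "rapid (\<lambda>n. exp (- (1 / 2 * real n powr c\<^sub>2)))"
    using constants by (intro rapid_exp) auto
  then show "rapid (\<lambda>n. ?B * real n powr (4 * \<beta>) * exp (- (1 / 2 * real n powr c\<^sub>2)))"
    by (rule rapid_mult[of _ _ "4 * \<beta>"]) simp
  show "\<forall>\<^sub>F n in sequentially. \<bar>C\<^sub>2 * exp (- (real n powr c\<^sub>2)) * growth (l n) (L n) ^ 4\<bar>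
      \<le> ?B * real n powr (4 * \<beta>) * exp (- (1 / 2 * real n powr c\<^sub>2))"
    using eventually_ge_at_top[of 1]
  proof eventually_elim
    case (elim n)
    have n1: "1 \<le> real n powr \<beta>" using powr_ge_1[OF elim, of \<beta>] \<beta> by simp
    have K1: "1 \<le> K ^ L n" using constants by simp
    let ?g = "real n powr \<beta> * K ^ L n"
    have g: "real n powr \<beta> \<le> ?g" "1 \<le> ?g" "l n * K ^ L n \<le> ?g"
      using mult_mono[OF order_refl K1, of "real n powr \<beta>"] n1 K1 by (auto simp: l_def)
    then have "1 + l n + l n * K ^ L n \<le> 3 * ?g" using n1 by (simp add: l_def)
    then have "C\<^sub>1 * (1 + l n + l n * K ^ L n) \<le> C\<^sub>1 * (3 * ?g)"
      using constants by (intro mult_left_mono) auto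
    then have "growth (l n) (L n) \<le> (2 + 3 * C\<^sub>1) * ?g"
      using g by (simp add: growth_def algebra_simps)
    moreover have gn: "0 \<le> growth (l n) (L n)" using constants by (simp add: growth_def l_def)
    ultimately have "growth (l n) (L n) ^ 4 \<le> ((2 + 3 * C\<^sub>1) * ?g) ^ 4" by (intro power_mono)
    also have "\<dots> = (2 + 3 * C\<^sub>1) ^ 4 * real n powr (4 * \<beta>) * (K ^ L n) ^ 4"
      using elim by (simp add: power_mult_distrib nat_powr_power mult.commute)
    finally have 1: "growth (l n) (L n) ^ 4 \<le> (2 + 3 * C\<^sub>1) ^ 4 * real n powr (4 * \<beta>) * (K ^ L n) ^ 4" .
    let ?t = "real n powr (c\<^sub>2 / 2)"
    have "(K ^ L n) ^ 4 = exp ?a ^ (4 * L n)"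
      using constants by (simp add: power_mult[symmetric] mult.commute)
    also have "\<dots> = exp (real (4 * L n) * ?a)" by (rule exp_of_nat_mult[symmetric])
    finally have "(K ^ L n) ^ 4 = exp (4 * real (L n) * ?a)" by simp
    moreover have "4 * real (L n) * ?a - real n powr c\<^sub>2 \<le> 8 * ?a\<^sup>2 + 4 * ?a - 1 / 2 * real n powr c\<^sub>2"
    proof -
      have "real (L n) \<le> ?t + 1"
        using gap_bounds(2)[of n] powr_mono[OF \<epsilon>(2), of "real n"] elim by simp
      then have "4 * real (L n) * ?a \<le> 4 * (?t + 1) * ?a" using a by (intro mult_right_mono) auto
      \<comment> \<open>Half of the mixing exponent \<open>?t\<^sup>2 = n powr c\<^sub>2\<close> pays for the growth \<open>K ^ (4 * L n)\<close>.\<close>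
      moreover have "4 * ?t * ?a \<le> ?t\<^sup>2 / 2 + 8 * ?a\<^sup>2"
        using zero_le_power2[of "?t - 4 * ?a"] by (simp add: power2_eq_square algebra_simps)
      moreover have "?t\<^sup>2 = real n powr c\<^sub>2" using elim by (simp add: nat_powr_power)
      ultimately show ?thesis by (simp add: algebra_simps)
    qed
    ultimately have 2: "exp (- (real n powr c\<^sub>2)) * (K ^ L n) ^ 4
        \<le> exp (8 * ?a\<^sup>2 + 4 * ?a) * exp (- (1 / 2 * real n powr c\<^sub>2))"
      by (simp add: exp_add[symmetric])
    have "C\<^sub>2 * exp (- (real n powr c\<^sub>2)) * growth (l n) (L n) ^ 4
        \<le> C\<^sub>2 * exp (- (real n powr c\<^sub>2)) * ((2 + 3 * C\<^sub>1) ^ 4 * real n powr (4 * \<beta>) * (K ^ L n) ^ 4)"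
      using 1 constants by (intro mult_left_mono) auto
    also have "\<dots> = C\<^sub>2 * (2 + 3 * C\<^sub>1) ^ 4 * real n powr (4 * \<beta>) * (exp (- (real n powr c\<^sub>2)) * (K ^ L n) ^ 4)"
      by (simp add: ac_simps)
    also have "\<dots> \<le> C\<^sub>2 * (2 + 3 * C\<^sub>1) ^ 4 * real n powr (4 * \<beta>)
        * (exp (8 * ?a\<^sup>2 + 4 * ?a) * exp (- (1 / 2 * real n powr c\<^sub>2)))"
      using 2 constants by (intro mult_left_mono) auto
    finally show ?case using constants gn by (simp add: ac_simps)
  qed
qed

lemma rapid_decoupling_error: "rapid (\<lambda>n. decoupling_error (l n) (L n) n)"
  unfolding decoupling_error_def
  using rapid_growth rapid_mult[OF rapid_fiber_error, of "\<lambda>_. 4" 0] by (intro rapid_add) simp_all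

lemma decoupling_error_nonneg: "0 \<le> decoupling_error a b n"
  using constants by (simp add: decoupling_error_def fiber_error_nonneg)

text \<open>
  Here \<open>\<kappa> = n powr - \<delta>\<close>. The only other term of polynomial size is \<open>n powr \<delta> * (L n)\<^sup>2 / (n\<^sup>2 * E)\<close>, which is of
  order at most \<open>n powr (\<delta> + 2 * \<epsilon> - 4 * \<delta>)\<close>, and \<open>\<epsilon> \<le> \<delta>\<close>. All other terms are polynomial
  factors times rapidly decreasing errors.
\<close>

lemma moment_bound_asymptotics:
  fixes D A C \<delta> :: real and m :: nat
  assumes D: "0 < D" and A: "0 \<le> A" and C: "0 \<le> C" and \<delta>: "0 < \<delta>" "\<epsilon> \<le> \<delta>" "4 * \<delta> = 2 - \<beta> * D"
  shows "\<exists>M. \<forall>\<^sub>F n in sequentially. \<forall>E k. real n powr - (\<beta> * D) \<le> E \<longrightarrow> 0 \<le> k \<longrightarrow> k \<le> A * (real n powr \<beta>) ^ m \<longrightarrow>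
    real n powr - \<delta>
      + (1 + 1 / real n powr - \<delta>) * (8 * (real (L n))\<^sup>2 * C / ((real n)\<^sup>2 * E)
          + 2 * k\<^sup>2 * (decay_error (l n) (L n))\<^sup>2 / E\<^sup>2)
      + k\<^sup>2 * decoupling_error (l n) (L n) n / E\<^sup>2
      + 2 * k * decoupling_error (l n) (L n) n / E \<le> M * real n powr - \<delta>"
proof -
  define s where "s n = real n powr (\<beta> * D)" for n
  define q where "q n = A * (real n powr \<beta>) ^ m" for n
  let ?F = "\<lambda>n. (decay_error (l n) (L n))\<^sup>2" and ?G = "\<lambda>n. decoupling_error (l n) (L n) n"
  define R where "R n = (1 + real n powr \<delta>) * (2 * (q n)\<^sup>2 * (s n)\<^sup>2) * ?F n + ((q n)\<^sup>2 * (s n)\<^sup>2 * ?G n + 2 * q n * s n * ?G n)" for n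
  have q_O: "q \<in> O(\<lambda>n. real n powr (\<beta> * m))" 
    unfolding q_def using A by (intro bigoI[of _ A] eventually_mono[OF eventually_ge_at_top[of 1]])
      (auto simp: nat_powr_power abs_mult)
  have s_O: "s \<in> O(\<lambda>n. real n powr (\<beta> * D))" unfolding s_def[abs_def] by simp
  have sq_O: "(\<lambda>n. (f n)\<^sup>2) \<in> O(\<lambda>n. real n powr (2 * b))" if "f \<in> O(\<lambda>n. real n powr b)" for f :: "nat \<Rightarrow> real" and b
    using landau_o.big.mult[OF that that] by (simp add: power2_eq_square powr_add[symmetric])
  have mult_O: "(\<lambda>n. f n * g n) \<in> O(\<lambda>n. real n powr (a + b))"
    if "f \<in> O(\<lambda>n. real n powr a)" "g \<in> O(\<lambda>n. real n powr b)" for f g :: "nat \<Rightarrow> real" and a b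
    using landau_o.big.mult[OF that] by (simp add: powr_add)
  have one_O: "(\<lambda>n. 1 + real n powr \<delta>) \<in> O(\<lambda>n. real n powr \<delta>)"
  proof (rule sum_in_bigo)
    show "(\<lambda>_. 1) \<in> O(\<lambda>n. real n powr \<delta>)"
      using powr_ge_1[of _ \<delta>] \<delta> by (intro bigoI[of _ 1] eventually_mono[OF eventually_ge_at_top[of 1]]) auto
  qed simp
  have qs_O: "(\<lambda>n. (q n)\<^sup>2 * (s n)\<^sup>2) \<in> O(\<lambda>n. real n powr (2 * (\<beta> * m) + 2 * (\<beta> * D)))"
    by (intro mult_O sq_O q_O s_O)
  have c1: "(\<lambda>n. (1 + real n powr \<delta>) * (2 * (q n)\<^sup>2 * (s n)\<^sup>2)) \<in> O(\<lambda>n. real n powr (\<delta> + (2 * (\<beta> * m) + 2 * (\<beta> * D))))"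
    using mult_O[OF one_O landau_o.big.cmult_in_iff[THEN iffD2, OF _ qs_O, of 2]] by (simp add: mult.assoc)
  have c3: "(\<lambda>n. 2 * q n * s n) \<in> O(\<lambda>n. real n powr (\<beta> * m + \<beta> * D))"
    using mult_O[OF q_O s_O] by (simp add: mult.assoc)
  have "rapid R"
    unfolding R_def[abs_def]
    by (intro rapid_add rapid_mult[OF _ c1] rapid_mult[OF _ qs_O] rapid_mult[OF _ c3]
        rapid_square rapid_decay_error rapid_decoupling_error)
  then have "R \<in> O(\<lambda>n. real n powr - \<delta>)" by (simp add: rapid_def)
  then obtain c where c: "\<forall>\<^sub>F n in sequentially. norm (R n) \<le> c * norm (real n powr - \<delta>)"
    by (auto elim!: landau_o.bigE)
  have "\<forall>\<^sub>F n in sequentially. \<forall>E k. real n powr - (\<beta> * D) \<le> E \<longrightarrow> 0 \<le> k \<longrightarrow> k \<le> q n \<longrightarrow>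
    real n powr - \<delta>
      + (1 + 1 / real n powr - \<delta>) * (8 * (real (L n))\<^sup>2 * C / ((real n)\<^sup>2 * E)
          + 2 * k\<^sup>2 * ?F n / E\<^sup>2) + k\<^sup>2 * ?G n / E\<^sup>2 + 2 * k * ?G n / E
    \<le> (1 + 64 * C + c) * real n powr - \<delta>"
    using c eventually_ge_at_top[of 1]
  proof eventually_elim
    case (elim n)
    show ?case
    proof (intro allI impI)
      fix E k :: real
      assume E: "real n powr - (\<beta> * D) \<le> E" and k: "0 \<le> k" "k \<le> q n"
      have n: "0 < real n" using elim by simp
      then have "0 < real n powr - (\<beta> * D)" by simp
      then have E0: "0 < E" using E by linarith
      have inv: "1 / E \<le> s n"
      proof -
        have "1 / E \<le> 1 / real n powr - (\<beta> * D)" using E E0 n by (intro divide_left_mono) auto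
        then show ?thesis using n by (simp add: s_def powr_minus field_simps)
      qed
      have inv2: "1 / E\<^sup>2 \<le> (s n)\<^sup>2"
        using power_mono[OF inv, of 2] E0 by (simp add: power_divide)
      have s0: "0 \<le> s n" by (simp add: s_def)
      have k2: "k\<^sup>2 \<le> (q n)\<^sup>2" using k by (intro power_mono)
      have q0: "0 \<le> q n" using k by simp
      have t1: "8 * (real (L n))\<^sup>2 * C / ((real n)\<^sup>2 * E) \<le> 32 * C * real n powr (- 2 * \<delta>)"
      proof -
        have "real (L n) \<le> 2 * real n powr \<delta>"
          using gap_bounds(2)[of n] powr_ge_1[of n \<epsilon>] powr_mono[OF \<delta>(2), of "real n"] elim \<epsilon> by simp
        then have "(real (L n))\<^sup>2 \<le> (2 * real n powr \<delta>)\<^sup>2" by (intro power_mono) auto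
        then have L2: "(real (L n))\<^sup>2 \<le> 4 * real n powr (2 * \<delta>)"
          using elim by (simp add: power_mult_distrib nat_powr_power mult.commute)
        have "8 * (real (L n))\<^sup>2 * C / ((real n)\<^sup>2 * E) = 8 * (real (L n))\<^sup>2 * C * real n powr - 2 * (1 / E)"
          using n by (simp add: powr_minus field_simps)
        also have "\<dots> \<le> 8 * (4 * real n powr (2 * \<delta>)) * C * real n powr - 2 * real n powr (\<beta> * D)"
          using L2 C inv E0 unfolding s_def by (intro mult_mono) auto
        also have "\<dots> = 32 * C * (real n powr (2 * \<delta>) * real n powr - 2 * real n powr (\<beta> * D))"
          by (simp add: ac_simps)
        also have "real n powr (2 * \<delta>) * real n powr - 2 * real n powr (\<beta> * D) = real n powr (- 2 * \<delta>)"
        proof -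
          have "2 * \<delta> + - 2 + \<beta> * D = - 2 * \<delta>" using \<delta>(3) by linarith
          then show ?thesis by (metis powr_add)
        qed
        finally show ?thesis .
      qed
      have pm: "1 + 1 / real n powr - \<delta> = 1 + real n powr \<delta>" using n by (simp add: powr_minus field_simps)
      have "(1 + real n powr \<delta>) * (8 * (real (L n))\<^sup>2 * C / ((real n)\<^sup>2 * E))
          \<le> (2 * real n powr \<delta>) * (32 * C * real n powr (- 2 * \<delta>))"
        using t1 powr_ge_1[of n \<delta>] elim \<delta> C E0 by (intro mult_mono) auto
      also have "\<dots> = 64 * C * (real n powr \<delta> * real n powr (- 2 * \<delta>))" by simp
      also have "\<dots> = 64 * C * real n powr - \<delta>" by (simp add: powr_add[symmetric])
      finally have 1: "(1 + real n powr \<delta>) * (8 * (real (L n))\<^sup>2 * C / ((real n)\<^sup>2 * E)) \<le> 64 * C * real n powr - \<delta>" .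
      have "2 * k\<^sup>2 * ?F n / E\<^sup>2 = 2 * k\<^sup>2 * (1 / E\<^sup>2) * ?F n" by simp
      also have "\<dots> \<le> 2 * (q n)\<^sup>2 * (s n)\<^sup>2 * ?F n"
        using k2 inv2 by (intro mult_right_mono mult_mono) auto
      finally have 2: "(1 + real n powr \<delta>) * (2 * k\<^sup>2 * ?F n / E\<^sup>2) \<le> (1 + real n powr \<delta>) * (2 * (q n)\<^sup>2 * (s n)\<^sup>2) * ?F n"
        unfolding mult.assoc[of "1 + real n powr \<delta>"] by (rule mult_left_mono) simp
      have "k\<^sup>2 * ?G n / E\<^sup>2 = k\<^sup>2 * (1 / E\<^sup>2) * ?G n" by simp
      also have "\<dots> \<le> (q n)\<^sup>2 * (s n)\<^sup>2 * ?G n"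
        using k2 inv2 decoupling_error_nonneg by (intro mult_right_mono mult_mono) auto
      finally have 3: "k\<^sup>2 * ?G n / E\<^sup>2 \<le> (q n)\<^sup>2 * (s n)\<^sup>2 * ?G n" .
      have "2 * k * ?G n / E = 2 * k * (1 / E) * ?G n" by simp
      also have "\<dots> \<le> 2 * q n * s n * ?G n"
        using k inv E0 q0 decoupling_error_nonneg by (intro mult_right_mono mult_mono) auto
      finally have 4: "2 * k * ?G n / E \<le> 2 * q n * s n * ?G n" .
      have 5: "R n \<le> c * real n powr - \<delta>" using elim(1) by simp
      have "real n powr - \<delta> + (1 + 1 / real n powr - \<delta>) * (8 * (real (L n))\<^sup>2 * C / ((real n)\<^sup>2 * E)
          + 2 * k\<^sup>2 * ?F n / E\<^sup>2) + k\<^sup>2 * ?G n / E\<^sup>2 + 2 * k * ?G n / E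
        \<le> real n powr - \<delta> + 64 * C * real n powr - \<delta> + R n"
        unfolding pm distrib_left[of "1 + real n powr \<delta>"] R_def using 1 2 3 4 by linarith
      also have "\<dots> \<le> (1 + 64 * C + c) * real n powr - \<delta>" using 5 by (simp add: algebra_simps)
      finally show "real n powr - \<delta> + (1 + 1 / real n powr - \<delta>) * (8 * (real (L n))\<^sup>2 * C / ((real n)\<^sup>2 * E)
          + 2 * k\<^sup>2 * ?F n / E\<^sup>2) + k\<^sup>2 * ?G n / E\<^sup>2 + 2 * k * ?G n / E
        \<le> (1 + 64 * C + c) * real n powr - \<delta>" .
    qed
  qed
  then show ?thesis unfolding q_def by blast
qed

end

end

section \<open>Almost sure encounters\<close>

context random_dynamical_system
begin

text \<open>
  The functions \<open>w\<close> dominate the fiber probabilities of the bad events. Summability of their integrals gives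
  \<open>\<Sum>k. w k \<omega> < \<infinity>\<close> for almost every \<open>\<omega>\<close>, and then the Borel-Cantelli lemma applies on that
  fiber.
\<close>

lemma quenched_borel_cantelli:
  assumes ev: "\<forall>\<^sub>F k in sequentially. \<exists>w. integrable P w \<and> (\<integral>\<omega>. w \<omega> \<partial>P) \<le> b k \<and>
      (\<forall>\<omega>. \<exists>N\<in>sets (\<mu> \<omega> \<Otimes>\<^sub>M \<mu> \<omega>). A k \<omega> \<subseteq> N \<and> measure (\<mu> \<omega> \<Otimes>\<^sub>M \<mu> \<omega>) N \<le> w \<omega>)"
    and "summable b"
  shows "AE \<omega> in P. AE z in \<mu> \<omega> \<Otimes>\<^sub>M \<mu> \<omega>. \<forall>\<^sub>F k in sequentially. z \<notin> A k \<omega>"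
proof -
  obtain k0 where k0: "\<And>k. k \<ge> k0 \<Longrightarrow> \<exists>w. integrable P w \<and> (\<integral>\<omega>. w \<omega> \<partial>P) \<le> b k \<and>
      (\<forall>\<omega>. \<exists>N\<in>sets (\<mu> \<omega> \<Otimes>\<^sub>M \<mu> \<omega>). A k \<omega> \<subseteq> N \<and> measure (\<mu> \<omega> \<Otimes>\<^sub>M \<mu> \<omega>) N \<le> w \<omega>)"
    using ev unfolding eventually_sequentially by blast
  have "\<forall>k. \<exists>w. integrable P w \<and> (\<integral>\<omega>. w \<omega> \<partial>P) \<le> b (k + k0) \<and>
      (\<forall>\<omega>. \<exists>N\<in>sets (\<mu> \<omega> \<Otimes>\<^sub>M \<mu> \<omega>). A (k + k0) \<omega> \<subseteq> N \<and> measure (\<mu> \<omega> \<Otimes>\<^sub>M \<mu> \<omega>) N \<le> w \<omega>)"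
    using k0 by simp
  from choice[OF this] obtain w where
    w: "\<And>k. integrable P (w k)" "\<And>k. (\<integral>\<omega>. w k \<omega> \<partial>P) \<le> b (k + k0)"
    and N: "\<And>k \<omega>. \<exists>N\<in>sets (\<mu> \<omega> \<Otimes>\<^sub>M \<mu> \<omega>). A (k + k0) \<omega> \<subseteq> N \<and> measure (\<mu> \<omega> \<Otimes>\<^sub>M \<mu> \<omega>) N \<le> w k \<omega>"
    by blast
  have w0: "0 \<le> w k \<omega>" for k \<omega> using N[of \<omega> k] by (meson measure_nonneg order_trans)
  have [measurable]: "w k \<in> borel_measurable P" for k using w(1) by (rule borel_measurable_integrable)
  have b0: "0 \<le> b (k + k0)" for k
  proof -
    have "0 \<le> (\<integral>\<omega>. w k \<omega> \<partial>P)" using w0 by simp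
    then show ?thesis using w(2)[of k] by simp
  qed
  have sb: "summable (\<lambda>k. b (k + k0))" using \<open>summable b\<close> by (simp add: summable_iff_shift)
  have "(\<integral>\<^sup>+ \<omega>. (\<Sum>k. ennreal (w k \<omega>)) \<partial>P) = (\<Sum>k. \<integral>\<^sup>+ \<omega>. ennreal (w k \<omega>) \<partial>P)"
    by (rule nn_integral_suminf) measurable
  also have "\<dots> = (\<Sum>k. ennreal (\<integral>\<omega>. w k \<omega> \<partial>P))"
    using w(1) w0 by (simp add: nn_integral_eq_integral)
  also have "\<dots> \<le> (\<Sum>k. ennreal (b (k + k0)))"
    using w(2) by (intro suminf_le ennreal_leI) auto
  also have "\<dots> = ennreal (\<Sum>k. b (k + k0))" using b0 sb by (rule suminf_ennreal2)
  finally have "(\<integral>\<^sup>+ \<omega>. (\<Sum>k. ennreal (w k \<omega>)) \<partial>P) \<noteq> \<infinity>" by (auto simp: top_unique)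
  then have "AE \<omega> in P. (\<Sum>k. ennreal (w k \<omega>)) \<noteq> \<infinity>"
    by (intro nn_integral_noteq_infinite) measurable
  then show ?thesis
  proof eventually_elim
    case (elim \<omega>)
    interpret M: prob_space "\<mu> \<omega>" by (rule prob_space_fiber)
    interpret MM: pair_prob_space "\<mu> \<omega>" "\<mu> \<omega>" ..
    have "\<forall>k. \<exists>N. N \<in> sets (\<mu> \<omega> \<Otimes>\<^sub>M \<mu> \<omega>) \<and> A (k + k0) \<omega> \<subseteq> N \<and> measure (\<mu> \<omega> \<Otimes>\<^sub>M \<mu> \<omega>) N \<le> w k \<omega>"
      using N by blast
    from choice[OF this] obtain N' where
      N': "\<And>k. N' k \<in> sets (\<mu> \<omega> \<Otimes>\<^sub>M \<mu> \<omega>)" "\<And>k. A (k + k0) \<omega> \<subseteq> N' k"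
        "\<And>k. measure (\<mu> \<omega> \<Otimes>\<^sub>M \<mu> \<omega>) (N' k) \<le> w k \<omega>" by blast
    have "summable (\<lambda>k. w k \<omega>)" using w0 elim by (intro summable_suminf_not_top) auto
    then have "summable (\<lambda>k. measure (\<mu> \<omega> \<Otimes>\<^sub>M \<mu> \<omega>) (N' k))"
      by (rule summable_comparison_test') (use N'(3) in auto)
    then have "AE z in \<mu> \<omega> \<Otimes>\<^sub>M \<mu> \<omega>. \<forall>\<^sub>F k in sequentially. z \<in> space (\<mu> \<omega> \<Otimes>\<^sub>M \<mu> \<omega>) - N' k"
      using N'(1) by (intro borel_cantelli_AE1) (auto simp: less_top[symmetric])
    then show ?case
    proof eventually_elim
      case (elim z)
      then have "\<forall>\<^sub>F k in sequentially. z \<notin> A (k + k0) \<omega>"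
        by eventually_elim (use N'(2) in blast)
      then show ?case by (simp add: eventually_sequentially_seg[of "\<lambda>k. z \<notin> A k \<omega>"])
    qed
  qed
qed

lemma prob_space_fiber_marginal: "prob_space (fiber_marginal \<nu>)"
  and sets_fiber_marginal: "sets (fiber_marginal \<nu>) = sets borel"
  unfolding fiber_marginal_def by (auto intro!: \<nu>.prob_space_distr simp: measurable_total_iff)

definition correlation_integral :: "real \<Rightarrow> real" where
  "correlation_integral r = (\<integral>x. measure (fiber_marginal \<nu>) (ball x r) \<partial>fiber_marginal \<nu>)"

text \<open>
  The pairs of points without encounter between the two time blocks. Two points in the support of a common
  bump at scale \<open>r\<close> are at distance less than \<open>8 * r\<close>, which is the reason for the constant.
\<close>

definition distant :: "nat \<Rightarrow> nat \<Rightarrow> real \<Rightarrow> 'w \<Rightarrow> ('x \<times> 'x) set" where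
  "distant u v r \<omega> = {z. \<forall>i\<in>{..<u}. \<forall>j\<in>{v..<v + u}. 8 * r \<le> dist (orb i \<omega> (fst z)) (orb j \<omega> (snd z))}"

end

context lipschitz_mixing_rds
begin

lemma distant_probability:
  fixes c :: "nat \<Rightarrow> 'x"
  assumes gc: "good_cover C r k c" and "0 < r" "0 < u" "2 * u \<le> v" "0 < \<kappa>" "0 < correlation_integral r"
  obtains E w where "correlation_integral r \<le> E" "integrable P w"
    "(\<integral>\<omega>. w \<omega> \<partial>P) \<le> \<kappa>
      + (1 + 1 / \<kappa>) * (8 * (real L)\<^sup>2 * real C / ((real u)\<^sup>2 * E)
          + 2 * (real k)\<^sup>2 * (decay_error (1 / (2 * r)) L)\<^sup>2 / E\<^sup>2)
      + (real k)\<^sup>2 * decoupling_error (1 / (2 * r)) L u / E\<^sup>2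
      + 2 * real k * decoupling_error (1 / (2 * r)) L u / E"
    "\<And>\<omega>. \<exists>N\<in>sets (\<mu> \<omega> \<Otimes>\<^sub>M \<mu> \<omega>). distant u v r \<omega> \<subseteq> N \<and> measure (\<mu> \<omega> \<Otimes>\<^sub>M \<mu> \<omega>) N \<le> w \<omega>"
proof -
  define \<rho> where "\<rho> p = bump (c p) r" for p
  have \<rho>: "unit_lipschitz (1 / (2 * r)) (\<rho> p)" for p
    using lipschitz_bump[OF \<open>0 < r\<close>] bump_unit by (auto simp: unit_lipschitz_def \<rho>_def)
  have mult: "(\<Sum>p\<in>{1..k}. \<rho> p x) \<le> real C" for x
    unfolding \<rho>_def using gc \<open>0 < r\<close> by (rule sum_bump_le)
  note setting = finite_atLeastAtMost[of 1 k] \<rho> mult \<open>0 < u\<close> \<open>2 * u \<le> v\<close>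
  let ?E = "energy {1..k} \<rho>" and ?w = "miss_bound {1..k} \<rho> u v"
  have E: "correlation_integral r \<le> ?E"
    unfolding correlation_integral_def energy_def mean_def unfolding \<rho>_def
    by (rule correlation_integral_le_sum_bump[OF prob_space_fiber_marginal sets_fiber_marginal gc \<open>0 < r\<close>])
  then have E0: "0 < ?E" using assms by simp
  show thesis
  proof (rule that[OF E])
    show "integrable P ?w" by (rule integral_miss_bound_le(1)[OF setting E0 \<open>0 < \<kappa>\<close>])
    show "(\<integral>\<omega>. ?w \<omega> \<partial>P) \<le> \<kappa>
      + (1 + 1 / \<kappa>) * (8 * (real L)\<^sup>2 * real C / ((real u)\<^sup>2 * ?E)
          + 2 * (real k)\<^sup>2 * (decay_error (1 / (2 * r)) L)\<^sup>2 / ?E\<^sup>2)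
      + (real k)\<^sup>2 * decoupling_error (1 / (2 * r)) L u / ?E\<^sup>2
      + 2 * real k * decoupling_error (1 / (2 * r)) L u / ?E"
      using integral_miss_bound_le(2)[OF setting E0 \<open>0 < \<kappa>\<close>, of L] by simp
    fix \<omega>
    let ?N = "{z. (\<Sum>p\<in>{1..k}. visits \<rho> u 0 p \<omega> (fst z) * visits \<rho> u v p \<omega> (snd z)) = 0}"
    have [measurable]: "visits \<rho> u s p \<omega> \<in> borel_measurable borel" for s p
      by (rule visits_measurable[OF setting])
    have "?N = {z \<in> space (\<mu> \<omega> \<Otimes>\<^sub>M \<mu> \<omega>).
        (\<Sum>p\<in>{1..k}. visits \<rho> u 0 p \<omega> (fst z) * visits \<rho> u v p \<omega> (snd z)) = 0}"
      by (simp add: space_pair_measure)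
    also have "\<dots> \<in> sets (\<mu> \<omega> \<Otimes>\<^sub>M \<mu> \<omega>)" by measurable
    finally have "?N \<in> sets (\<mu> \<omega> \<Otimes>\<^sub>M \<mu> \<omega>)" .
    moreover have "distant u v r \<omega> \<subseteq> ?N"
    proof
      fix z assume z: "z \<in> distant u v r \<omega>"
      have "\<rho> p (orb i \<omega> (fst z)) * \<rho> p (orb j \<omega> (snd z)) = 0"
        if "i \<in> {0..<0 + u}" "j \<in> {v..<v + u}" for p i j
      proof (rule ccontr)
        assume "\<not> ?thesis"
        then have "dist (orb i \<omega> (fst z)) (c p) < 4 * r" "dist (orb j \<omega> (snd z)) (c p) < 4 * r"
          using bump_pos_imp_dist[OF \<open>0 < r\<close>] by (auto simp: \<rho>_def)
        then have "dist (orb i \<omega> (fst z)) (orb j \<omega> (snd z)) < 8 * r"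
          using dist_triangle2[of "orb i \<omega> (fst z)" "orb j \<omega> (snd z)" "c p"] by linarith
        moreover have "8 * r \<le> dist (orb i \<omega> (fst z)) (orb j \<omega> (snd z))"
          using z that unfolding distant_def by auto
        ultimately show False by linarith
      qed
      then have vis0: "visits \<rho> u 0 p \<omega> (fst z) * visits \<rho> u v p \<omega> (snd z) = 0" for p
        unfolding visits_def sum_product by (intro sum.neutral ballI) blast
      show "z \<in> ?N" by (rule CollectI, rule sum.neutral, rule ballI, rule vis0)
    qed
    moreover have "measure (\<mu> \<omega> \<Otimes>\<^sub>M \<mu> \<omega>) ?N \<le> ?w \<omega>"
      by (rule miss_probability_le[OF setting E0])
    ultimately show "\<exists>N\<in>sets (\<mu> \<omega> \<Otimes>\<^sub>M \<mu> \<omega>). distant u v r \<omega> \<subseteq> N \<and> measure (\<mu> \<omega> \<Otimes>\<^sub>M \<mu> \<omega>) N \<le> ?w \<omega>"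
      by blast
  qed
qed

text \<open>
  The numbers \<open>\<delta> = (2 - \<beta> * D) / 4\<close> and \<open>\<epsilon> = min \<delta> (c\<^sub>2 / 2)\<close> satisfy the constraints of
  \<open>moment_bound_asymptotics\<close>, so the probability of no encounter is \<open>O(n powr - \<delta>)\<close>, which is summable
  along powers of 2.
\<close>

lemma dyadic_encounters:
  fixes \<beta> D :: real and b :: nat
  assumes "compact (UNIV :: 'x set)" "bounded_local_complexity (UNIV :: 'x set)"
    and pos: "0 < \<beta>" "0 < D" "\<beta> * D < 2" "2 \<le> b"
    and corr_int: "\<forall>\<^sub>F r in at_right 0. r powr D \<le> correlation_integral r"
  shows "AE \<omega> in P. AE z in \<mu> \<omega> \<Otimes>\<^sub>M \<mu> \<omega>. \<forall>\<^sub>F k in sequentially.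
    z \<notin> distant (2 ^ k) (b * 2 ^ k) (real (2 ^ k) powr - \<beta>) \<omega>"
proof -
  define \<delta> where "\<delta> = (2 - \<beta> * D) / 4"
  define \<epsilon> where "\<epsilon> = min \<delta> (c\<^sub>2 / 2)"
  define L where "L n = nat \<lceil>real n powr \<epsilon>\<rceil>" for n :: nat
  have "\<epsilon> \<le> \<delta>" by (simp add: \<epsilon>_def)
  then have \<delta>: "0 < \<delta>" "\<epsilon> \<le> \<delta>" "4 * \<delta> = 2 - \<beta> * D"
    using pos by (simp_all add: \<delta>_def)
  have \<epsilon>: "0 < \<epsilon>" "\<epsilon> \<le> c\<^sub>2 / 2" using \<delta> constants by (auto simp: \<epsilon>_def)
  obtain C :: nat and A r0 :: real where r0: "0 < r0" "0 \<le> A"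
    and cover: "\<And>r. 0 < r \<Longrightarrow> r < r0 \<Longrightarrow>
      \<exists>k (c :: nat \<Rightarrow> 'x). good_cover C r k c \<and> real k \<le> A * (1 / r) ^ C"
    by (rule good_covers_polynomial[OF assms(1,2)], rule that)
  obtain M where M: "\<forall>\<^sub>F n in sequentially. \<forall>E k. real n powr - (\<beta> * D) \<le> E \<longrightarrow> 0 \<le> k \<longrightarrow>
      k \<le> A * (real n powr \<beta>) ^ C \<longrightarrow>
    real n powr - \<delta>
      + (1 + 1 / real n powr - \<delta>) * (8 * (real (L n))\<^sup>2 * real C / ((real n)\<^sup>2 * E)
          + 2 * k\<^sup>2 * (decay_error (real n powr \<beta> / 2) (L n))\<^sup>2 / E\<^sup>2)
      + k\<^sup>2 * decoupling_error (real n powr \<beta> / 2) (L n) n / E\<^sup>2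
      + 2 * k * decoupling_error (real n powr \<beta> / 2) (L n) n / E \<le> M * real n powr - \<delta>"
    using moment_bound_asymptotics[OF pos(1) \<epsilon> pos(2) r0(2) of_nat_0_le_iff[of C] \<delta>, of C]
    unfolding L_def by (elim exE)
  have lim: "filterlim (\<lambda>n. real n powr - \<beta>) (at_right 0) sequentially"
    using pos by real_asymp
  have "\<forall>\<^sub>F n in sequentially. \<exists>w. integrable P w \<and> (\<integral>\<omega>. w \<omega> \<partial>P) \<le> M * real n powr - \<delta> \<and>
      (\<forall>\<omega>. \<exists>N\<in>sets (\<mu> \<omega> \<Otimes>\<^sub>M \<mu> \<omega>). distant n (b * n) (real n powr - \<beta>) \<omega> \<subseteq> N \<and>
        measure (\<mu> \<omega> \<Otimes>\<^sub>M \<mu> \<omega>) N \<le> w \<omega>)"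
    using M eventually_gt_at_top[of 0] eventually_compose_filterlim[OF corr_int lim]
      eventually_compose_filterlim[OF eventually_at_right_real[OF r0(1)] lim]
  proof eventually_elim
    case (elim n)
    define r where "r = real n powr - \<beta>"
    have r: "0 < r" "r < r0" using elim(4) by (auto simp: r_def)
    have inv: "1 / r = real n powr \<beta>" "1 / (2 * r) = real n powr \<beta> / 2"
      using elim(2) by (simp_all add: r_def powr_minus divide_simps)
    have rD: "real n powr - (\<beta> * D) \<le> correlation_integral r"
      using elim(3) by (simp add: r_def powr_powr)
    have ci: "0 < correlation_integral r"
    proof -
      have "0 < real n powr - (\<beta> * D)" using elim(2) by simp
      then show ?thesis using rD by linarith
    qed
    obtain k and c :: "nat \<Rightarrow> 'x" where kc: "good_cover C r k c" "real k \<le> A * (real n powr \<beta>) ^ C"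
      using cover[OF r] unfolding inv by blast
    have v: "2 * n \<le> b * n" using pos(4) by (rule mult_le_mono1)
    have \<kappa>: "0 < real n powr - \<delta>" using elim(2) by simp
    obtain E w where w: "correlation_integral r \<le> E" "integrable P w"
      "(\<integral>\<omega>. w \<omega> \<partial>P) \<le> real n powr - \<delta>
        + (1 + 1 / real n powr - \<delta>) * (8 * (real (L n))\<^sup>2 * real C / ((real n)\<^sup>2 * E)
            + 2 * (real k)\<^sup>2 * (decay_error (1 / (2 * r)) (L n))\<^sup>2 / E\<^sup>2)
        + (real k)\<^sup>2 * decoupling_error (1 / (2 * r)) (L n) n / E\<^sup>2
        + 2 * real k * decoupling_error (1 / (2 * r)) (L n) n / E"
      "\<And>\<omega>. \<exists>N\<in>sets (\<mu> \<omega> \<Otimes>\<^sub>M \<mu> \<omega>). distant n (b * n) r \<omega> \<subseteq> N \<and> measure (\<mu> \<omega> \<Otimes>\<^sub>M \<mu> \<omega>) N \<le> w \<omega>"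
      by (rule distant_probability[OF kc(1) r(1) elim(2) v \<kappa> ci], rule that)
    have "(\<integral>\<omega>. w \<omega> \<partial>P) \<le> M * real n powr - \<delta>"
      by (rule order_trans[OF w(3)[unfolded inv(2)]
            elim(1)[rule_format, OF order_trans[OF rD w(1)] of_nat_0_le_iff kc(2)]])
    then show ?case using w(2,4) unfolding r_def by blast
  qed
  moreover have "filterlim (\<lambda>k. 2 ^ k :: nat) sequentially sequentially" by real_asymp
  ultimately have "\<forall>\<^sub>F k in sequentially. \<exists>w. integrable P w \<and> (\<integral>\<omega>. w \<omega> \<partial>P) \<le> M * real (2 ^ k) powr - \<delta> \<and>
      (\<forall>\<omega>. \<exists>N\<in>sets (\<mu> \<omega> \<Otimes>\<^sub>M \<mu> \<omega>). distant (2 ^ k) (b * 2 ^ k) (real (2 ^ k) powr - \<beta>) \<omega> \<subseteq> N \<and>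
        measure (\<mu> \<omega> \<Otimes>\<^sub>M \<mu> \<omega>) N \<le> w \<omega>)"
    by (rule eventually_compose_filterlim)
  moreover have "summable (\<lambda>k. M * real (2 ^ k) powr - \<delta>)"
  proof -
    have "real (2 ^ k) powr - \<delta> = (2 powr - \<delta>) ^ k" for k
      by (simp add: powr_realpow[symmetric] powr_powr mult.commute)
    moreover have "(2 :: real) powr - \<delta> < 1" using powr_less_mono[of "- \<delta>" 0 "2 :: real"] \<delta> by simp
    ultimately show ?thesis by (simp add: summable_mult summable_geometric)
  qed
  ultimately show ?thesis by (rule quenched_borel_cantelli)
qed

end

section \<open>The minimal distance along all times\<close>

text \<open>
  For \<open>16 * u \<le> n < 32 * u\<close> with \<open>u = 2 ^ k\<close>, put \<open>q = n div u\<close> and \<open>b = q - 4\<close>. The block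
  \<open>{b * u..<b * u + u}\<close> ends before \<open>n\<close>, and it starts no earlier than \<open>2 * n / 3\<close> because \<open>n < (q + 1) * u\<close> and
  \<open>3 * (q - 4) \<ge> 2 * (q + 1)\<close> as soon as \<open>q \<ge> 14\<close>. Only 16 values of \<open>b\<close> occur.
\<close>

lemma dyadic_block:
  fixes n k0 :: nat
  assumes "16 * 2 ^ Suc k0 \<le> n"
  obtains k b where "k0 \<le> k" "b \<in> {12..27}" "2 * n \<le> 3 * (b * 2 ^ k)" "b * 2 ^ k + 2 ^ k \<le> n"
    "3 * 2 ^ k < n" "n < 32 * (2 :: nat) ^ k"
proof -
  have "(1 :: nat) \<le> 2 ^ Suc k0" by simp
  then have "16 \<le> n" using assms by linarith
  then have "1 \<le> n div 16" by simp
  then obtain k where k: "2 ^ k \<le> n div 16" "n div 16 < 2 ^ (k + 1)"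
    using ex_power_ivl1[of 2 "n div 16"] by auto
  define u where "u = (2 :: nat) ^ k"
  have u: "0 < u" "16 * u \<le> n" "n < 32 * u" using k by (simp_all add: u_def)
  have "(2 :: nat) ^ Suc k0 < 2 ^ Suc k"
    using assms u(3) unfolding u_def power_Suc by linarith
  then have "k0 \<le> k" using power_less_imp_less_exp[of 2 "Suc k0" "Suc k"] by simp
  define q where "q = n div u"
  have q: "q * u \<le> n" "n < q * u + u"
    using div_mult_mod_eq[of n u] mod_less_divisor[OF u(1), of n] unfolding q_def by linarith+
  have "16 \<le> q" unfolding q_def using u by (simp add: less_eq_div_iff_mult_less_eq)
  moreover have "q < 32" unfolding q_def using u by (simp add: less_mult_imp_div_less)
  ultimately have b: "q - 4 \<in> {12..27}" by auto
  have "16 * u \<le> q * u" using \<open>16 \<le> q\<close> by (rule mult_le_mono1)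
  moreover have "(q - 4) * u = q * u - 4 * u" by (simp add: diff_mult_distrib)
  ultimately have "2 * n \<le> 3 * ((q - 4) * u)" "(q - 4) * u + u \<le> n" "3 * u < n"
    using q u by linarith+
  then show thesis using that[OF \<open>k0 \<le> k\<close> b] u(3) by (simp add: u_def)
qed

lemma (in random_dynamical_system) min_dist_of_dyadic_encounters:
  assumes z: "\<And>b. b \<in> {12..27} \<Longrightarrow> \<forall>\<^sub>F k in sequentially.
      (x, y) \<notin> distant (2 ^ k) (b * 2 ^ k) (real (2 ^ k) powr - \<beta>) \<omega>"
    and \<alpha>: "0 < \<alpha>" "\<alpha> < \<beta>"
  shows "\<forall>\<^sub>F n in sequentially. min_dist_separated \<theta> T n \<omega> x y \<le> ereal (real n powr - \<alpha>)"
proof -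
  have scale: "\<forall>\<^sub>F u in sequentially. 8 * real u powr - \<beta> \<le> (32 * real u) powr - \<alpha>"
    using \<alpha> by real_asymp
  have pow: "filterlim (\<lambda>k. 2 ^ k :: nat) sequentially sequentially" by real_asymp
  have "\<forall>\<^sub>F k in sequentially. \<forall>b\<in>{12..27::nat}. (x, y) \<notin> distant (2 ^ k) (b * 2 ^ k) (real (2 ^ k) powr - \<beta>) \<omega>"
    using z by (intro eventually_ball_finite) auto
  then have "\<forall>\<^sub>F k in sequentially. (\<forall>b\<in>{12..27::nat}. (x, y) \<notin> distant (2 ^ k) (b * 2 ^ k) (real (2 ^ k) powr - \<beta>) \<omega>)
      \<and> 8 * real (2 ^ k) powr - \<beta> \<le> (32 * real (2 ^ k)) powr - \<alpha>"
    using eventually_compose_filterlim[OF scale pow] by (rule eventually_conj)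
  then obtain k0 where k0: "\<And>k b. k0 \<le> k \<Longrightarrow> b \<in> {12..27::nat} \<Longrightarrow>
      (x, y) \<notin> distant (2 ^ k) (b * 2 ^ k) (real (2 ^ k) powr - \<beta>) \<omega>"
    "\<And>k. k0 \<le> k \<Longrightarrow> 8 * real (2 ^ k) powr - \<beta> \<le> (32 * real (2 ^ k)) powr - \<alpha>"
    unfolding eventually_sequentially by blast
  show ?thesis
  proof (rule eventually_mono[OF eventually_ge_at_top[of "16 * 2 ^ Suc k0"]])
    fix n :: nat assume "16 * 2 ^ Suc k0 \<le> n"
    then obtain k b where kb: "k0 \<le> k" "b \<in> {12..27}" "2 * n \<le> 3 * (b * 2 ^ k)" "b * 2 ^ k + 2 ^ k \<le> n"
      "3 * 2 ^ k < n" "n < 32 * 2 ^ k" by (rule dyadic_block)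
    obtain i j where ij: "i < 2 ^ k" "b * 2 ^ k \<le> j" "j < b * 2 ^ k + 2 ^ k"
      "dist (orb i \<omega> x) (orb j \<omega> y) < 8 * real (2 ^ k) powr - \<beta>"
      using k0(1)[OF kb(1,2)] by (auto simp: distant_def not_le)
    have "real i < real n / 3" "2 * real n / 3 \<le> real j" "j < n"
      using ij kb by linarith+
    then have "min_dist_separated \<theta> T n \<omega> x y \<le> ereal (dist (orb i \<omega> x) (orb j \<omega> y))"
      unfolding min_dist_separated_def by (intro Inf_lower) auto
    also have "\<dots> \<le> ereal ((32 * real (2 ^ k)) powr - \<alpha>)" using ij(4) k0(2)[OF kb(1)] by simp
    also have "(32 * real (2 ^ k)) powr - \<alpha> \<le> real n powr - \<alpha>"
    proof (rule powr_mono2')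
      have "real n \<le> real (32 * 2 ^ k)" using kb(6) by (intro of_nat_mono) simp
      then show "real n \<le> 32 * real (2 ^ k)" by simp
    qed (use \<alpha> kb(5) in auto)
    finally show "min_dist_separated \<theta> T n \<omega> x y \<le> ereal (real n powr - \<alpha>)" by simp
  qed
qed

lemma min_dist_separated_nonneg: "0 \<le> min_dist_separated \<theta> T n \<omega> x y"
  unfolding min_dist_separated_def by (rule Inf_greatest) auto

lemma neg_log_ratio_ge:
  assumes "2 \<le> n" "t \<le> ereal (real n powr - a)" "0 \<le> t"
  shows "ereal a \<le> neg_log t / ereal (ln (real n))"
proof -
  have ln: "0 < ln (real n)" using assms(1) by simp
  show ?thesis
  proof (cases "t = 0")
    case True
    then show ?thesis using ln by (simp add: neg_log_def)
  next
    case False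
    then obtain s where s: "t = ereal s" "0 < s" using assms by (cases t) auto
    then have "ln s \<le> ln (real n powr - a)"
      using assms(1,2) by (subst ln_le_cancel_iff) simp_all
    also have "\<dots> = - a * ln (real n)" using assms(1) by (simp add: ln_powr)
    finally have "a \<le> - ln s / ln (real n)" using ln by (subst pos_le_divide_eq) auto
    then show ?thesis using s ln by (simp add: neg_log_def)
  qed
qed

text \<open>
  Distances are bounded on a compact space. This covers infinite correlation dimension, where \<open>2 / \<infinity> = 0\<close>
  and only negative exponents have to be treated.
\<close>

lemma min_dist_trivial:
  fixes x y :: "'x :: metric_space"
  assumes "compact (UNIV :: 'x set)" "a < 0"
  shows "\<forall>\<^sub>F n in sequentially. min_dist_separated \<theta> T n \<omega> x y \<le> ereal (real n powr - a)"
proof -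
  obtain B where B: "\<And>p q :: 'x. dist p q \<le> B"
    using compact_imp_bounded[OF assms(1)] unfolding bounded_two_points by auto
  have "\<forall>\<^sub>F n in sequentially. B \<le> real n powr - a" using assms(2) by real_asymp
  then show ?thesis
    using eventually_ge_at_top[of 3]
  proof eventually_elim
    case (elim n)
    have "min_dist_separated \<theta> T n \<omega> x y
        \<le> ereal (dist (fiber_iterate \<theta> T 0 \<omega> x) (fiber_iterate \<theta> T (n - 1) \<omega> y))"
      unfolding min_dist_separated_def using elim(2)
      by (intro Inf_lower CollectI exI[of _ 0] exI[of _ "n - 1"]) auto
    also have "\<dots> \<le> ereal (real n powr - a)" by (simp only: ereal_less_eq order_trans[OF B elim(1)])
    finally show ?case .
  qed
qed

text \<open>
  For \<open>a > 0\<close> the hypothesis forces the dimension to be finite, and there is room for \<open>D\<close> above the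
  dimension and \<open>\<beta>\<close> above \<open>a\<close> with \<open>\<beta> * D < 2\<close>. The margin between \<open>a\<close> and \<open>\<beta>\<close> absorbs the
  constants 8 and 32.
\<close>

lemma (in lipschitz_mixing_rds) min_dist_le_power:
  assumes cpt: "compact (UNIV :: 'x set)" and blc: "bounded_local_complexity (UNIV :: 'x set)"
    and a: "ereal a < 2 / upper_correlation_dimension (fiber_marginal \<nu>)" "a \<noteq> 0"
  shows "AE \<omega> in P. AE z in \<mu> \<omega> \<Otimes>\<^sub>M \<mu> \<omega>. \<forall>\<^sub>F n in sequentially.
    min_dist_separated \<theta> T n \<omega> (fst z) (snd z) \<le> ereal (real n powr - a)"
proof (cases "a < 0")
  case True
  then show ?thesis using min_dist_trivial[OF cpt] by (intro AE_I2)
next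
  case False
  then have a0: "0 < a" using a(2) by simp
  let ?D = "upper_correlation_dimension (fiber_marginal \<nu>)"
  obtain D where D: "0 < D" "a * D < 2" "?D < ereal D"
  proof (cases ?D)
    case (real d)
    have "d \<ge> 0" using a(1) a0 real by (cases "d = 0") (auto simp: field_simps not_less split: if_splits, smt (verit) divide_nonneg_neg)
    have "a * d < 2" using a(1) a0 real \<open>d \<ge> 0\<close> by (cases "d = 0") (auto simp: pos_less_divide_eq)
    define D where "D = (d + 2 / a) / 2"
    have "d < 2 / a" using \<open>a * d < 2\<close> a0 by (simp add: field_simps)
    then have "d < D" "D < 2 / a" by (simp_all add: D_def)
    then show thesis using \<open>d \<ge> 0\<close> real a0 by (intro that[of D]) (auto simp: field_simps)
  next
    case PInf
    then show thesis using a(1) a0 by simp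
  next
    case MInf
    then show thesis using a(1) a0 by simp
  qed
  define \<beta> where "\<beta> = (a + 2 / D) / 2"
  have "a < 2 / D" using D by (simp add: field_simps)
  then have \<beta>: "a < \<beta>" "\<beta> < 2 / D" by (simp_all add: \<beta>_def)
  then have \<beta>0: "0 < \<beta>" "\<beta> * D < 2" using a0 D by (simp_all add: field_simps)
  have "\<forall>\<^sub>F r in at_right 0. ereal (ln (correlation_integral r) / ln r) < ereal D"
    using D(3) unfolding upper_correlation_dimension_def correlation_integral_def by (rule Limsup_lessD)
  then have ci: "\<forall>\<^sub>F r in at_right 0. r powr D \<le> correlation_integral r"
    using eventually_at_right_real[of 0 1, OF zero_less_one]
  proof eventually_elim
    case (elim r)
    have "0 < correlation_integral r"
      unfolding correlation_integral_def
      using elim(2) by (intro correlation_integral_pos prob_space_fiber_marginal sets_fiber_marginal cpt) auto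
    moreover have "ln r < 0" using elim(2) by simp
    then have "D * ln r \<le> ln (correlation_integral r)"
      using elim(1) by (simp add: neg_divide_less_eq)
    ultimately show ?case using elim(2) by (simp add: powr_def ln_ge_iff[symmetric])
  qed
  have "AE \<omega> in P. \<forall>b\<in>{12..27::nat}. AE z in \<mu> \<omega> \<Otimes>\<^sub>M \<mu> \<omega>. \<forall>\<^sub>F k in sequentially.
      z \<notin> distant (2 ^ k) (b * 2 ^ k) (real (2 ^ k) powr - \<beta>) \<omega>"
    using dyadic_encounters[OF cpt blc \<beta>0(1) D(1) \<beta>0(2) _ ci] by (intro AE_finite_allI) auto
  then show ?thesis
  proof eventually_elim
    case (elim \<omega>)
    then have "AE z in \<mu> \<omega> \<Otimes>\<^sub>M \<mu> \<omega>. \<forall>b\<in>{12..27::nat}. \<forall>\<^sub>F k in sequentially.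
      z \<notin> distant (2 ^ k) (b * 2 ^ k) (real (2 ^ k) powr - \<beta>) \<omega>"
      by (intro AE_finite_allI) auto
    then show ?case
    proof eventually_elim
      case (elim z)
      then show ?case
        using min_dist_of_dyadic_encounters[of "fst z" "snd z" \<beta> \<omega> a] a0 \<beta>(1) by simp
    qed
  qed
qed

text \<open>
  Countably many exponents suffice, which allows them to be treated outside the almost everywhere
  quantifiers. The exponent 0 is left out because it is covered neither by \<open>min_dist_trivial\<close> nor by the
  second moment argument.
\<close>

lemma ereal_le_of_rationals:
  fixes X Y :: ereal
  assumes "\<And>a. a \<in> \<rat> \<Longrightarrow> a \<noteq> 0 \<Longrightarrow> ereal a < Y \<Longrightarrow> ereal a \<le> X"
  shows "Y \<le> X"
proof (rule ccontr)
  assume "\<not> Y \<le> X"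
  then have "X < Y" by simp
  then obtain p where p: "X < ereal p" "ereal p < Y" using ereal_dense2 by blast
  then obtain q where q: "p < q" "ereal q < Y" using ereal_dense2[of "ereal p" Y] by auto
  have "max p 0 < q \<or> q \<le> 0" using q(1) by auto
  then obtain a where "a \<in> \<rat>" "p < a" "a < q" "a \<noteq> 0"
    using Rats_dense_in_real[of "max p 0" q] Rats_dense_in_real[OF q(1)] by (metis max_less_iff_conj not_le order_less_irrefl)
  then show False using assms[of a] p q by (meson ereal_less(1) less_ereal.simps(1) less_le_trans less_trans not_less)
qed

theorem proposition1p12:
  fixes P :: "'w :: metric_space measure"
    and \<theta> :: "'w \<Rightarrow> 'w"
    and T :: "'w \<Rightarrow> 'x :: metric_space \<Rightarrow> 'x"
    and \<nu> :: "('w \<times> 'x) measure"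
    and \<mu> :: "'w \<Rightarrow> 'x measure"
  assumes "random_dynamical_system P \<theta> T \<nu> \<mu>"
    and "compact (UNIV :: 'x set)"
    and "bounded_local_complexity (UNIV :: 'x set)"
    and "lipschitz_dependence \<mu>"
    and "stretched_exponential_4_mixing P \<theta>"
    and "stretched_exponential_fiber_mixing \<theta> T \<mu>"
    and "is_lipschitz (skew_product \<theta> T)"
  shows "AE \<omega> in P. AE (x, y) in \<mu> \<omega> \<Otimes>\<^sub>M \<mu> \<omega>.
    liminf (\<lambda>n. neg_log (min_dist_separated \<theta> T n \<omega> x y) / ereal (ln (real n)))
      \<ge> 2 / upper_correlation_dimension (fiber_marginal \<nu>)"
proof -
  obtain K where K: "K-lipschitz_on UNIV (skew_product \<theta> T)"
    using assms(7) by (auto simp: is_lipschitz_def)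
  obtain C\<^sub>1 where C1: "0 < C\<^sub>1" "\<And>(f :: 'x \<Rightarrow> real) \<omega> \<omega>'. is_lipschitz f \<Longrightarrow>
      \<bar>(\<integral>x. f x \<partial>\<mu> \<omega>) - (\<integral>x. f x \<partial>\<mu> \<omega>')\<bar> \<le> C\<^sub>1 * lip_norm f * dist \<omega> \<omega>'"
    using assms(4) unfolding lipschitz_dependence_def by blast
  obtain c\<^sub>2 C\<^sub>2 where C2: "0 < c\<^sub>2" "0 < C\<^sub>2"
    "\<forall>(f\<^sub>1 :: 'w \<Rightarrow> real) f\<^sub>2 g\<^sub>1 g\<^sub>2.
      is_lipschitz f\<^sub>1 \<longrightarrow> is_lipschitz f\<^sub>2 \<longrightarrow> is_lipschitz g\<^sub>1 \<longrightarrow> is_lipschitz g\<^sub>2 \<longrightarrow>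
      (\<forall>(n :: nat) (a :: nat) (b :: nat) (c :: nat). a \<le> b \<longrightarrow> b \<le> c \<longrightarrow> n \<le> b - a \<longrightarrow>
        \<bar>(\<integral>\<omega>. f\<^sub>1 \<omega> * f\<^sub>2 ((\<theta> ^^ a) \<omega>) * g\<^sub>1 ((\<theta> ^^ b) \<omega>) * g\<^sub>2 ((\<theta> ^^ c) \<omega>) \<partial>P)
          - (\<integral>\<omega>. f\<^sub>1 \<omega> * f\<^sub>2 ((\<theta> ^^ a) \<omega>) \<partial>P) * (\<integral>\<omega>. g\<^sub>1 \<omega> * g\<^sub>2 ((\<theta> ^^ (c - b)) \<omega>) \<partial>P)\<bar>
        \<le> C\<^sub>2 * exp (- (real n powr c\<^sub>2)) * lip_norm f\<^sub>1 * lip_norm f\<^sub>2 * lip_norm g\<^sub>1 * lip_norm g\<^sub>2)"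
    using assms(5) unfolding stretched_exponential_4_mixing_def by (elim exE conjE)
  obtain c\<^sub>3 C\<^sub>3 where C3: "0 < c\<^sub>3" "0 < C\<^sub>3"
    "\<forall>(f :: 'x \<Rightarrow> real) g. is_lipschitz f \<longrightarrow> is_lipschitz g \<longrightarrow>
      (\<forall>(n :: nat) \<omega>. \<bar>(\<integral>x. f x * g (fiber_iterate \<theta> T n \<omega> x) \<partial>\<mu> \<omega>)
          - (\<integral>x. f x \<partial>\<mu> \<omega>) * (\<integral>x. g x \<partial>\<mu> ((\<theta> ^^ n) \<omega>))\<bar>
        \<le> C\<^sub>3 * exp (- (real n powr c\<^sub>3)) * lip_norm f * lip_norm g)"
    using assms(6) unfolding stretched_exponential_fiber_mixing_def by (elim exE conjE)
  interpret random_dynamical_system P \<theta> T \<nu> \<mu> by (rule assms(1))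
  interpret lipschitz_mixing_rds P \<theta> T \<nu> \<mu> "max K 1" C\<^sub>1 c\<^sub>2 C\<^sub>2 c\<^sub>3 C\<^sub>3
    using lipschitz_on_le[OF K, of "max K 1"] C1 C2(1,2) C3(1,2) C2(3)[rule_format] C3(3)[rule_format]
    by unfold_locales simp_all
  let ?Y = "2 / upper_correlation_dimension (fiber_marginal \<nu>)"
  let ?Q = "{a \<in> \<rat>. a \<noteq> 0 \<and> ereal a < ?Y}"
  have Q: "countable ?Q" by (rule countable_subset[OF _ countable_rat]) auto
  have "AE \<omega> in P. \<forall>a\<in>?Q. AE z in \<mu> \<omega> \<Otimes>\<^sub>M \<mu> \<omega>. \<forall>\<^sub>F n in sequentially.
      min_dist_separated \<theta> T n \<omega> (fst z) (snd z) \<le> ereal (real n powr - a)"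
    using min_dist_le_power[OF assms(2,3)] by (subst AE_ball_countable[OF Q]) auto
  then show ?thesis
  proof eventually_elim
    case (elim \<omega>)
    then have "AE z in \<mu> \<omega> \<Otimes>\<^sub>M \<mu> \<omega>. \<forall>a\<in>?Q. \<forall>\<^sub>F n in sequentially.
      min_dist_separated \<theta> T n \<omega> (fst z) (snd z) \<le> ereal (real n powr - a)"
      by (subst AE_ball_countable[OF Q])
    then show ?case
    proof eventually_elim
      case (elim z)
      have "?Y \<le> liminf (\<lambda>n. neg_log (min_dist_separated \<theta> T n \<omega> (fst z) (snd z)) / ereal (ln (real n)))"
      proof (rule ereal_le_of_rationals, rule Liminf_bounded)
        fix a assume "a \<in> \<rat>" "a \<noteq> 0" "ereal a < ?Y"
        then have "\<forall>\<^sub>F n in sequentially. min_dist_separated \<theta> T n \<omega> (fst z) (snd z) \<le> ereal (real n powr - a)"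
          using elim by blast
        then show "\<forall>\<^sub>F n in sequentially.
            ereal a \<le> neg_log (min_dist_separated \<theta> T n \<omega> (fst z) (snd z)) / ereal (ln (real n))"
          using eventually_ge_at_top[of 2]
          by eventually_elim (intro neg_log_ratio_ge min_dist_separated_nonneg)
      qed
      then show ?case by (simp add: case_prod_beta)
    qed
  qed
qed

end
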